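(* Assume that the support projection $\hat\rho_1^0$ of $\hat\rho_1$ belongs to $\mathcal A_1$ (i.e. $\operatorname{supp}\rho_1$ is $G$-invariant) and that $\operatorname{supp}\rho_0\le\operatorname{supp}\rho_1$. Then for every $\varepsilon\in(0,1)$, $$-\psi'_+(1)\le\underline s_{G,\varepsilon}(\rho_0\,\|\,\rho_1)\le\overline s_{G,\varepsilon}(\rho_0\,\|\,\rho_1)\le-\psi'_-(1),$$ where $\psi'_+(1)$ and $\psi'_-(1)$ denote the right and left derivatives of $\psi$ at $1$.
   Context: Let $\mathcal H$ be a finite-dimensional complex Hilbert space, $G$ a compact group and $g\mapsto u_g$ a continuous unitary representation of $G$ on $\mathcal H$. For $n\in\mathbb N$ let $\mathcal A_n=\{A\in\mathcal B(\mathcal H^{\otimes n}):Au_g^{\otimes n}=u_g^{\otimes n}A\ \forall g\in G\}$ and $E_{\mathcal A_n}(X)=\int_G u_g^{\otimes n}Xu_g^{*\otimes n}\,dg$ (normalized Haar measure). Let $\rho_0,\rho_1$ be states on $\mathcal B(\mathcal H)$ with density matrices $\hat\rho_0,\hat\rho_1$, and $\hat\rho_{k,n}:=E_{\mathcal A_n}(\hat\rho_k^{\otimes n})$, $k=0,1$. Powers of positive semidefinite operators use the convention $0^s=0$ for all real $s$. Let $\psi_n(s)=\log\operatorname{Tr}\hat\rho_{0,n}^s\hat\rho_{1,n}^{1-s}$ and $\psi(s)=\lim_n\frac1n\psi_n(s)$; under the hypotheses of the claim this limit exists and is finite for all $s\in[0,2]$, and $\psi$ is convex there. For $T_n\in\mathcal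 A_n$, $0\le T_n\le I$, put $\beta_{0,n}(T_n)=\operatorname{Tr}\hat\rho_0^{\otimes n}(I-T_n)$, $\beta_{1,n}(T_n)=\operatorname{Tr}\hat\rho_1^{\otimes n}T_n$. For $\varepsilon\in(0,1)$, $\underline s_{G,\varepsilon}(\rho_0\|\rho_1)$ (resp. $\overline s_{G,\varepsilon}(\rho_0\|\rho_1)$) is the infimum of $\liminf_n\frac1n\log\beta_{1,n}(T_n)$ (resp. $\limsup_n\frac1n\log\beta_{1,n}(T_n)$) over all sequences $T_n\in\mathcal A_n$, $0\le T_n\le I$, with $\beta_{0,n}(T_n)\le\varepsilon$ for all $n$. *)

theory Defs
  imports "HOL-Probability.Probability_Measure" "Jordan_Normal_Form.Schur_Decomposition"
begin

text \<open>The Hilbert space H is modelled as C^d; operators on H^(tensor n) as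
  complex matrices of dimension d^n.\<close>

definition mtrace :: "complex mat \<Rightarrow> complex" where
  "mtrace A = (\<Sum>i<dim_row A. A $$ (i,i))"

definition hermitian :: "complex mat \<Rightarrow> bool" where
  "hermitian A \<longleftrightarrow> A = mat_adjoint A"

definition psd :: "nat \<Rightarrow> complex mat \<Rightarrow> bool" where
  "psd N A \<longleftrightarrow> A \<in> carrier_mat N N \<and> hermitian A \<and>
     (\<forall>v\<in>carrier_vec N. 0 \<le> Re (conjugate v \<bullet> (A *\<^sub>v v)))"

definition unitary :: "nat \<Rightarrow> complex mat \<Rightarrow> bool" where
  "unitary N U \<longleftrightarrow> U \<in> carrier_mat N N \<and> U * mat_adjoint U = 1\<^sub>m N \<and> mat_adjoint U * U = 1\<^sub>m N"

definition state_mat :: "nat \<Rightarrow> complex mat \<Rightarrow> bool" where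
  "state_mat N A \<longleftrightarrow> psd N A \<and> mtrace A = 1"

text \<open>Real powers of positive semidefinite matrices via the spectral decomposition,
  with the convention 0^s = 0 for all real s (note that 0 powr s = 0 in Isabelle,
  and x powr 0 = 1 for x > 0, so A^0 is the support projection).\<close>
definition mpow :: "complex mat \<Rightarrow> real \<Rightarrow> complex mat" where
  "mpow A s = (SOME B. \<exists>U ev. unitary (dim_row A) U \<and> (\<forall>i. 0 \<le> ev i) \<and>
      A = U * mat_diag (dim_row A) (\<lambda>i. complex_of_real (ev i)) * mat_adjoint U \<and>
      B = U * mat_diag (dim_row A) (\<lambda>i. complex_of_real (ev i powr s)) * mat_adjoint U)"

definition kron :: "complex mat \<Rightarrow> complex mat \<Rightarrow> complex mat" where
  "kron A B = mat (dim_row A * dim_row B) (dim_col A * dim_col B)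
     (\<lambda>(i,j). A $$ (i div dim_row B, j div dim_col B) * B $$ (i mod dim_row B, j mod dim_col B))"

fun tpow :: "complex mat \<Rightarrow> nat \<Rightarrow> complex mat" where
  "tpow A 0 = 1\<^sub>m 1"
| "tpow A (Suc n) = kron (tpow A n) A"

text \<open>A compact (Hausdorff) topological group G (written additively as a type class
  group, not necessarily commutative) with a normalized left-invariant Borel
  (Haar) probability measure mu.\<close>
definition haar_prob :: "'g::{topological_group_add,t2_space} measure \<Rightarrow> bool" where
  "haar_prob \<mu> \<longleftrightarrow> sets \<mu> = sets borel \<and> prob_space \<mu> \<and>
     (\<forall>g A. A \<in> sets borel \<longrightarrow> emeasure \<mu> ((\<lambda>x. g + x) ` A) = emeasure \<mu> A)"

definition unitary_rep :: "nat \<Rightarrow> ('g::{topological_group_add} \<Rightarrow> complex mat) \<Rightarrow> bool" where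
  "unitary_rep d u \<longleftrightarrow> (\<forall>g. unitary d (u g)) \<and> u 0 = 1\<^sub>m d \<and>
     (\<forall>g h. u (g + h) = u g * u h) \<and>
     (\<forall>i<d. \<forall>j<d. continuous_on UNIV (\<lambda>g. u g $$ (i,j)))"

definition commutant :: "nat \<Rightarrow> ('g \<Rightarrow> complex mat) \<Rightarrow> nat \<Rightarrow> complex mat set" where
  "commutant d u n = {A \<in> carrier_mat (d^n) (d^n). \<forall>g. A * tpow (u g) n = tpow (u g) n * A}"

definition twirl :: "nat \<Rightarrow> 'g measure \<Rightarrow> ('g \<Rightarrow> complex mat) \<Rightarrow> nat \<Rightarrow> complex mat \<Rightarrow> complex mat" where
  "twirl d \<mu> u n X = mat (d^n) (d^n)
     (\<lambda>(i,j). \<integral>g. (tpow (u g) n * X * mat_adjoint (tpow (u g) n)) $$ (i,j) \<partial>\<mu>)"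

definition psi_n :: "nat \<Rightarrow> 'g measure \<Rightarrow> ('g \<Rightarrow> complex mat) \<Rightarrow> complex mat \<Rightarrow> complex mat
    \<Rightarrow> nat \<Rightarrow> real \<Rightarrow> real" where
  "psi_n d \<mu> u r0 r1 n s = ln (Re (mtrace (mpow (twirl d \<mu> u n (tpow r0 n)) s
                                       * mpow (twirl d \<mu> u n (tpow r1 n)) (1 - s))))"

definition psi :: "nat \<Rightarrow> 'g measure \<Rightarrow> ('g \<Rightarrow> complex mat) \<Rightarrow> complex mat \<Rightarrow> complex mat
    \<Rightarrow> real \<Rightarrow> real" where
  "psi d \<mu> u r0 r1 s = lim (\<lambda>n. psi_n d \<mu> u r0 r1 n s / real n)"

definition beta0 :: "nat \<Rightarrow> complex mat \<Rightarrow> nat \<Rightarrow> complex mat \<Rightarrow> real" where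
  "beta0 d r0 n T = Re (mtrace (tpow r0 n * (1\<^sub>m (d^n) - T)))"

definition beta1 :: "complex mat \<Rightarrow> nat \<Rightarrow> complex mat \<Rightarrow> real" where
  "beta1 r1 n T = Re (mtrace (tpow r1 n * T))"

definition elog :: "real \<Rightarrow> ereal" where
  "elog x = (if x = 0 then -\<infinity> else ereal (ln x))"

definition admissible :: "nat \<Rightarrow> ('g \<Rightarrow> complex mat) \<Rightarrow> complex mat \<Rightarrow> real \<Rightarrow> (nat \<Rightarrow> complex mat) \<Rightarrow> bool" where
  "admissible d u r0 \<epsilon> T \<longleftrightarrow> (\<forall>n. T n \<in> commutant d u n \<and> psd (d^n) (T n) \<and>
      psd (d^n) (1\<^sub>m (d^n) - T n) \<and> beta0 d r0 n (T n) \<le> \<epsilon>)"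

definition s_lower :: "nat \<Rightarrow> ('g \<Rightarrow> complex mat) \<Rightarrow> complex mat \<Rightarrow> complex mat \<Rightarrow> real \<Rightarrow> ereal" where
  "s_lower d u r0 r1 \<epsilon> = (INF T \<in> {T. admissible d u r0 \<epsilon> T}.
      liminf (\<lambda>n. elog (beta1 r1 n (T n)) / ereal (real n)))"

definition s_upper :: "nat \<Rightarrow> ('g \<Rightarrow> complex mat) \<Rightarrow> complex mat \<Rightarrow> complex mat \<Rightarrow> real \<Rightarrow> ereal" where
  "s_upper d u r0 r1 \<epsilon> = (INF T \<in> {T. admissible d u r0 \<epsilon> T}.
      limsup (\<lambda>n. elog (beta1 r1 n (T n)) / ereal (real n)))"

end

theory Submission
  imports Defs "Jordan_Normal_Form.Spectral_Radius" "HOL-Probability.Sinc_Integral"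
begin

text \<open>
  All comparisons of the quasi-entropies \<open>Tr A\<^sup>s B\<^sup>1\<^sup>-\<^sup>s\<close> are reduced to the functional
  \<open>F\<^sub>t(A,B) = inf\<^sub>X (Tr A X X\<^sup>* + t Tr B (1 - X)\<^sup>* (1 - X))\<close>. In the eigenbases of \<open>A\<close> and \<open>B\<close>, with
  eigenvalues \<open>x\<close>, \<open>y\<close> and squared overlaps \<open>w\<close>, it equals \<open>\<Sum> w t x y / (x + t y)\<close>, and an integral over
  \<open>t\<close> recovers \<open>Tr A\<^sup>s B\<^sup>1\<^sup>-\<^sup>s\<close> for \<open>0 < s < 1\<close>; for \<open>1 < s < 2\<close> the same holds for \<open>Tr A - F\<^sub>t(A,B)\<close>.

  As an infimum of functionals that are linear in \<open>(A,B)\<close>, \<open>F\<^sub>t\<close> is monotone (which yields the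
  Loewner--Heinz inequality), and it increases under group averages, because the minimiser for the
  averaged pair commutes with the group and sees no difference between a state and its average.
  Hence \<open>\<psi>\<^sub>n(s)\<close> is subadditive in \<open>n\<close> for \<open>s < 1\<close> and superadditive for \<open>s > 1\<close>, so \<open>\<psi>\<close> exists on \<open>(0,2)\<close>
  and is convex there.

  The upper bound comes from the Neyman--Pearson tests \<open>{\<rho>\<^sub>n - e\<^sup>n\<^sup>a \<sigma>\<^sub>n > 0}\<close> and the inequality of Audenaert
  et al., the lower bound from inserting an arbitrary test \<open>T\<close> as \<open>X = 1 - x T\<close> into \<open>F\<^sub>t\<close>.
\<close>

subsection \<open>Adjoints, traces and unitary matrices\<close>

declare index_mult_mat(1) [simp del]

lemma index_mult_mat_sum:
  assumes "i < dim_row A" "j < dim_col B" "dim_col A = dim_row B"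
  shows "(A * B) $$ (i,j) = (\<Sum>k<dim_row B. A $$ (i,k) * B $$ (k,j))"
  using assms by (simp add: index_mult_mat(1) scalar_prod_def lessThan_atLeast0)

lemma mult_mat_assoc:
  fixes A B C :: "complex mat"
  assumes "dim_col A = dim_row B" "dim_col B = dim_row C"
  shows "A * B * C = A * (B * C)"
  by (rule assoc_mult_mat) (use assms in auto)

lemma mult_mat_minus_distrib:
  fixes A B C :: "complex mat"
  assumes "dim_row B = dim_row C" "dim_col B = dim_col C"
  shows "dim_col A = dim_row C \<Longrightarrow> A * (B - C) = A * B - A * C"
    and "dim_row A = dim_col C \<Longrightarrow> (B - C) * A = B * A - C * A"
  by (rule mult_minus_distrib_mat, use assms in auto) (rule minus_mult_distrib_mat, use assms in auto)

lemma mult_mat_smult: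
  fixes A B :: "complex mat"
  assumes "dim_col A = dim_row B"
  shows "A * (c \<cdot>\<^sub>m B) = c \<cdot>\<^sub>m (A * B)" and "c \<cdot>\<^sub>m A * B = c \<cdot>\<^sub>m (A * B)"
  by (rule mult_smult_distrib, use assms in auto) (rule mult_smult_assoc_mat, use assms in auto)

lemma mult_carrier_iff [simp]:
  fixes A B :: "complex mat"
  shows "A * B \<in> carrier_mat a b \<longleftrightarrow> dim_row A = a \<and> dim_col B = b"
  using carrier_matD[of "A * B" a b] by (auto intro: carrier_matI)

lemma minus_carrier_iff [simp]:
  fixes A B :: "complex mat"
  shows "A - B \<in> carrier_mat a b \<longleftrightarrow> B \<in> carrier_mat a b"
  using carrier_matD[of "A - B" a b] by (auto intro: carrier_matI)

lemma dim_mat_adjoint [simp]: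
  "dim_row (mat_adjoint A) = dim_col A" "dim_col (mat_adjoint A) = dim_row A"
  by (auto simp: mat_adjoint_def)

lemma index_mat_adjoint [simp]:
  fixes A :: "complex mat"
  assumes "i < dim_col A" "j < dim_row A"
  shows "mat_adjoint A $$ (i,j) = cnj (A $$ (j,i))"
  using assms by (simp add: mat_adjoint_def mat_of_rows_index conjugate_complex_def)

lemma mat_adjoint_adjoint [simp]: "mat_adjoint (mat_adjoint A) = (A :: complex mat)"
  by (rule eq_matI) auto

lemma mat_adjoint_carrier_iff [simp]:
  fixes A :: "complex mat"
  shows "mat_adjoint A \<in> carrier_mat b a \<longleftrightarrow> A \<in> carrier_mat a b"
  using carrier_matD[of A a b] carrier_matD[of "mat_adjoint A" b a] by (auto intro: carrier_matI)

lemma mat_adjoint_one [simp]: "mat_adjoint (1\<^sub>m n) = (1\<^sub>m n :: complex mat)"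
  by (rule eq_matI) auto

lemma mat_adjoint_mult:
  fixes A B :: "complex mat"
  assumes "dim_col A = dim_row B"
  shows "mat_adjoint (A * B) = mat_adjoint B * mat_adjoint A"
  by (rule eq_matI) (use assms in \<open>auto simp: index_mult_mat_sum mult.commute\<close>)

lemma mat_adjoint_add:
  fixes A B :: "complex mat"
  assumes "dim_row A = dim_row B" "dim_col A = dim_col B"
  shows "mat_adjoint (A + B) = mat_adjoint A + mat_adjoint B"
  by (rule eq_matI) (use assms in auto)

lemma mat_adjoint_minus:
  fixes A B :: "complex mat"
  assumes "dim_row A = dim_row B" "dim_col A = dim_col B"
  shows "mat_adjoint (A - B) = mat_adjoint A - mat_adjoint B"
  by (rule eq_matI) (use assms in auto)

lemma index_mult_adjoint_diag:
  fixes A :: "complex mat"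
  assumes "i < dim_row A"
  shows "(A * mat_adjoint A) $$ (i,i) = complex_of_real (\<Sum>k<dim_col A. (cmod (A $$ (i,k)))\<^sup>2)"
  using assms by (simp add: index_mult_mat_sum complex_norm_square del: of_real_power)

lemma mtrace_add:
  assumes "dim_row A = dim_row B" "dim_col B = dim_row B"
  shows "mtrace (A + B) = mtrace A + mtrace B"
  using assms by (simp add: mtrace_def sum.distrib)

lemma mtrace_minus:
  assumes "dim_row A = dim_row B" "dim_col B = dim_row B"
  shows "mtrace (A - B) = mtrace A - mtrace B"
  using assms by (simp add: mtrace_def sum_subtractf)

lemma mtrace_smult: "dim_col A = dim_row A \<Longrightarrow> mtrace (c \<cdot>\<^sub>m A) = c * mtrace A"
  by (simp add: mtrace_def sum_distrib_left)

lemma mtrace_mult_sum: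
  assumes "dim_col A = dim_row B" "dim_col B = dim_row A"
  shows "mtrace (A * B) = (\<Sum>i<dim_row A. \<Sum>k<dim_row B. A $$ (i,k) * B $$ (k,i))"
  using assms by (simp add: mtrace_def index_mult_mat_sum)

lemma mtrace_mult_commute:
  assumes "dim_col A = dim_row B" "dim_col B = dim_row A"
  shows "mtrace (A * B) = mtrace (B * A)"
proof -
  have "mtrace (A * B) = (\<Sum>k<dim_row B. \<Sum>i<dim_row A. B $$ (k,i) * A $$ (i,k))"
    using assms by (subst sum.swap) (simp add: mtrace_mult_sum mult.commute)
  then show ?thesis using assms by (simp add: mtrace_mult_sum)
qed

lemma mtrace_adjoint:
  assumes "dim_col A = dim_row A"
  shows "mtrace (mat_adjoint A) = cnj (mtrace A)"
  using assms by (simp add: mtrace_def)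

lemma mtrace_adjoint_mult:
  assumes "A \<in> carrier_mat n n" "B \<in> carrier_mat n n"
  shows "mtrace (mat_adjoint A * B) = cnj (mtrace (A * mat_adjoint B))"
proof -
  have "mtrace (mat_adjoint A * B) = mtrace (mat_adjoint (mat_adjoint B * A))"
    using assms by (simp add: mat_adjoint_mult)
  also have "\<dots> = cnj (mtrace (mat_adjoint B * A))" using assms by (intro mtrace_adjoint) simp
  also have "mtrace (mat_adjoint B * A) = mtrace (A * mat_adjoint B)"
    using assms by (intro mtrace_mult_commute) auto
  finally show ?thesis .
qed

lemma mtrace_conj_mult:
  assumes "V \<in> carrier_mat n n" "A \<in> carrier_mat n n" "B \<in> carrier_mat n n"
  shows "mtrace (V * A * mat_adjoint V * B) = mtrace (A * (mat_adjoint V * B * V))"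
proof -
  have "mtrace (V * A * mat_adjoint V * B) = mtrace (V * (A * mat_adjoint V * B))"
    using assms by (simp add: mult_mat_assoc)
  also have "\<dots> = mtrace (A * mat_adjoint V * B * V)"
    using assms by (intro mtrace_mult_commute) auto
  finally show ?thesis using assms by (simp add: mult_mat_assoc)
qed

text \<open>The trace pairing is nondegenerate: test against matrix units.\<close>

lemma mat_eq_if_mtrace_mult_eq:
  assumes A: "A \<in> carrier_mat n n" and B: "B \<in> carrier_mat n n"
    and eq: "\<And>R. R \<in> carrier_mat n n \<Longrightarrow> mtrace (A * R) = mtrace (B * R)"
  shows "A = B"
proof (rule eq_matI)
  fix i j assume "i < dim_row B" "j < dim_col B"
  then have ij: "i < n" "j < n" using B by auto
  let ?R = "mat n n (\<lambda>(k,l). if k = j then (if l = i then 1 else 0) else 0)"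
  have "mtrace (C * ?R) = C $$ (i,j)" if C: "C \<in> carrier_mat n n" for C
    using C ij by (simp add: mtrace_mult_sum mult_delta_right)
  then show "A $$ (i,j) = B $$ (i,j)" using eq[of ?R] A B by simp
qed (use A B in auto)

lemma unitaryD:
  assumes "unitary n U"
  shows "U \<in> carrier_mat n n" "dim_row U = n" "dim_col U = n"
    "U * mat_adjoint U = 1\<^sub>m n" "mat_adjoint U * U = 1\<^sub>m n"
  using assms by (auto simp: unitary_def)

lemma unitaryI:
  assumes "U \<in> carrier_mat n n" "mat_adjoint U * U = 1\<^sub>m n"
  shows "unitary n U"
  unfolding unitary_def
  using assms mat_mult_left_right_inverse[of "mat_adjoint U" n U] by simp

lemma unitary_cancel:
  assumes "unitary n U" "dim_row X = n"
  shows "U * (mat_adjoint U * X) = X" "mat_adjoint U * (U * X) = X"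
proof -
  note u = unitaryD[OF assms(1)]
  have X: "1\<^sub>m n * X = X" using assms(2) by (intro left_mult_one_mat') simp
  show "U * (mat_adjoint U * X) = X"
    using u assms(2) X by (subst mult_mat_assoc[symmetric]) auto
  show "mat_adjoint U * (U * X) = X"
    using u assms(2) X by (subst mult_mat_assoc[symmetric]) auto
qed

lemma unitary_one [simp]: "unitary n (1\<^sub>m n)"
  by (simp add: unitary_def)

lemma unitary_mult:
  assumes "unitary n U" "unitary n V"
  shows "unitary n (U * V)"
  using unitaryD[OF assms(1)] unitaryD[OF assms(2)]
  by (intro unitaryI) (simp_all add: mat_adjoint_mult mult_mat_assoc unitary_cancel[OF assms(1)])

lemma mtrace_unitary_conj:
  assumes "unitary n U" "X \<in> carrier_mat n n"
  shows "mtrace (U * X * mat_adjoint U) = mtrace X"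
proof -
  note u = unitaryD[OF assms(1)]
  have "mtrace (U * X * mat_adjoint U) = mtrace (mat_adjoint U * (U * X))"
    using u assms(2) by (intro mtrace_mult_commute) auto
  then show ?thesis using assms by (simp add: unitary_cancel)
qed

lemma mtrace_unitary_conj_mult:
  assumes V: "unitary n V" and A: "A \<in> carrier_mat n n" and S: "S \<in> carrier_mat n n"
    and comm: "V * S = S * V"
  shows "mtrace (V * A * mat_adjoint V * S) = mtrace (A * S)"
proof -
  note v = unitaryD[OF V]
  have "mat_adjoint V * S * V = S"
    using v S by (simp add: mult_mat_assoc comm[symmetric] unitary_cancel[OF V])
  then show ?thesis using mtrace_conj_mult[OF v(1) A S] by simp
qed

subsection \<open>Unitarily diagonalized matrices\<close>

abbreviation real_diag :: "nat \<Rightarrow> (nat \<Rightarrow> real) \<Rightarrow> complex mat" where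
  "real_diag n f \<equiv> mat_diag n (\<lambda>i. complex_of_real (f i))"

definition unitary_diag :: "nat \<Rightarrow> complex mat \<Rightarrow> (nat \<Rightarrow> real) \<Rightarrow> complex mat" where
  "unitary_diag n U f = U * real_diag n f * mat_adjoint U"

lemma dim_mat_diag [simp]: "dim_row (mat_diag n f) = n" "dim_col (mat_diag n f) = n"
  by (auto simp: mat_diag_def)

lemma real_diag_adjoint [simp]: "mat_adjoint (real_diag n f) = real_diag n f"
  by (rule eq_matI) (auto simp: mat_diag_def)

lemma unitary_diag_carrier: "unitary n U \<Longrightarrow> unitary_diag n U f \<in> carrier_mat n n"
  by (simp add: unitary_diag_def unitaryD)

lemma dim_unitary_diag [simp]:
  "dim_row (unitary_diag n U f) = dim_row U" "dim_col (unitary_diag n U f) = dim_row U"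
  by (auto simp: unitary_diag_def)

lemma unitary_diag_adjoint: "unitary n U \<Longrightarrow> mat_adjoint (unitary_diag n U f) = unitary_diag n U f"
  using unitaryD[of n U] by (simp add: unitary_diag_def mat_adjoint_mult mult_mat_assoc)

lemma unitary_diag_cong: "(\<And>i. i < n \<Longrightarrow> f i = g i) \<Longrightarrow> unitary_diag n U f = unitary_diag n U g"
  unfolding unitary_diag_def
  by (intro arg_cong2[where f="(*)"] refl eq_matI) (auto simp: mat_diag_def)

lemma unitary_diag_one: "unitary n U \<Longrightarrow> unitary_diag n U (\<lambda>_. 1) = 1\<^sub>m n"
  using unitaryD[of n U] by (simp add: unitary_diag_def)

lemma unitary_diag_mult:
  assumes "unitary n U"
  shows "unitary_diag n U f * unitary_diag n U g = unitary_diag n U (\<lambda>i. f i * g i)"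
proof -
  note u = unitaryD[OF assms]
  have "unitary_diag n U f * unitary_diag n U g = U * (real_diag n f * (real_diag n g * mat_adjoint U))"
    using u by (simp add: unitary_diag_def mult_mat_assoc unitary_cancel[OF assms])
  also have "\<dots> = U * (real_diag n f * real_diag n g * mat_adjoint U)"
    using u by (subst mult_mat_assoc[of "real_diag n f"]) auto
  also have "\<dots> = unitary_diag n U (\<lambda>i. f i * g i)"
    using u by (simp add: unitary_diag_def mult_mat_assoc)
  finally show ?thesis .
qed

lemma unitary_diag_minus:
  assumes "unitary n U"
  shows "unitary_diag n U f - unitary_diag n U g = unitary_diag n U (\<lambda>i. f i - g i)"
proof -
  have "real_diag n (\<lambda>i. f i - g i) = real_diag n f - real_diag n g"
    by (rule eq_matI) (auto simp: mat_diag_def)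
  then show ?thesis
    unfolding unitary_diag_def using unitaryD[OF assms] by (simp add: mult_mat_minus_distrib)
qed

lemma unitary_diag_smult:
  assumes "unitary n U"
  shows "complex_of_real c \<cdot>\<^sub>m unitary_diag n U f = unitary_diag n U (\<lambda>i. c * f i)"
proof -
  have "real_diag n (\<lambda>i. c * f i) = complex_of_real c \<cdot>\<^sub>m real_diag n f"
    by (rule eq_matI) (auto simp: mat_diag_def)
  then show ?thesis
    unfolding unitary_diag_def using unitaryD[OF assms] by (simp add: mult_mat_smult)
qed

lemma unitary_diag_conj:
  assumes "dim_col U = n" "V \<in> carrier_mat n n"
  shows "U * unitary_diag n V f * mat_adjoint U = unitary_diag n (U * V) f"
  using assms by (simp add: unitary_diag_def mat_adjoint_mult mult_mat_assoc)

lemma unitary_diag_eigenbasis: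
  assumes "unitary n U"
  shows "mat_adjoint U * unitary_diag n U f = real_diag n f * mat_adjoint U"
    and "unitary_diag n U f * U = U * real_diag n f"
  using unitaryD[OF assms]
  by (simp_all add: unitary_diag_def mult_mat_assoc unitary_cancel[OF assms])

subsection \<open>The spectral theorem\<close>

definition direct_sum :: "complex mat \<Rightarrow> complex mat \<Rightarrow> complex mat" where
  "direct_sum A B = four_block_mat A (0\<^sub>m (dim_row A) (dim_col B)) (0\<^sub>m (dim_row B) (dim_col A)) B"

lemma dim_direct_sum [simp]:
  "dim_row (direct_sum A B) = dim_row A + dim_row B" "dim_col (direct_sum A B) = dim_col A + dim_col B"
  by (simp_all add: direct_sum_def)

lemma direct_sum_mult:
  assumes "dim_col A = dim_row C" "dim_col B = dim_row D"
  shows "direct_sum A B * direct_sum C D = direct_sum (A * C) (B * D)"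
  unfolding direct_sum_def using assms
  by (subst mult_four_block_mat[of _ "dim_row A" "dim_col A" _ "dim_col B" _ "dim_row B" _ _
      "dim_col C" _ "dim_col D"])
    (auto intro!: cong_four_block_mat eq_matI)

lemma direct_sum_adjoint: "mat_adjoint (direct_sum A B) = direct_sum (mat_adjoint A) (mat_adjoint B)"
  by (rule eq_matI) (auto simp: direct_sum_def)

lemma direct_sum_one: "direct_sum (1\<^sub>m m) (1\<^sub>m n) = 1\<^sub>m (m + n)"
  by (simp add: direct_sum_def)

lemma unitary_direct_sum:
  assumes "unitary m U" "unitary n V"
  shows "unitary (m + n) (direct_sum U V)"
  using unitaryD[OF assms(1)] unitaryD[OF assms(2)]
  by (intro unitaryI carrier_matI) (simp_all add: direct_sum_adjoint direct_sum_mult direct_sum_one)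

lemma unitary_diag_direct_sum:
  assumes "U \<in> carrier_mat m m" "V \<in> carrier_mat n n"
  shows "direct_sum (unitary_diag m U f) (unitary_diag n V g)
    = unitary_diag (m + n) (direct_sum U V) (\<lambda>i. if i < m then f i else g (i - m))"
proof -
  have "real_diag (m + n) (\<lambda>i. if i < m then f i else g (i - m)) = direct_sum (real_diag m f) (real_diag n g)"
    by (rule eq_matI) (auto simp: mat_diag_def direct_sum_def)
  then show ?thesis
    using assms by (simp add: unitary_diag_def direct_sum_adjoint direct_sum_mult)
qed

lemma corthogonal_mat_normalize:
  assumes W: "W \<in> carrier_mat n n" and orth: "corthogonal_mat W"
  obtains c where "unitary n (W * real_diag n c)"
proof -
  define g where "g j = (\<Sum>k<n. (cmod (W $$ (k,j)))\<^sup>2)" for j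
  have diag: "(mat_adjoint W * W) $$ (j,j) = complex_of_real (g j)" if "j < n" for j
    using that W index_mult_adjoint_diag[of j "mat_adjoint W"] by (simp add: g_def)
  have gram: "(mat_adjoint W * W) $$ (i,j) = (if i = j then complex_of_real (g j) else 0)"
    if "i < n" "j < n" for i j
    using that W orth diag[of j] by (simp add: corthogonal_mat_def Let_def diagonal_mat_def)
  have pos: "0 < g j" if "j < n" for j
  proof -
    have "g j \<noteq> 0" using that W orth diag[of j] by (auto simp: corthogonal_mat_def Let_def)
    moreover have "0 \<le> g j" unfolding g_def by (intro sum_nonneg zero_le_power2)
    ultimately show ?thesis by simp
  qed
  define c where "c j = 1 / sqrt (g j)" for j
  let ?U = "W * real_diag n c"
  have "mat_adjoint ?U * ?U = 1\<^sub>m n"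
  proof (rule eq_matI)
    fix i j assume ij: "i < dim_row (1\<^sub>m n)" "j < dim_col (1\<^sub>m n)"
    have "mat_adjoint ?U * ?U = real_diag n c * (mat_adjoint W * W) * real_diag n c"
      using W by (simp add: mat_adjoint_mult mult_mat_assoc)
    then have "(mat_adjoint ?U * ?U) $$ (i,j) = c i * (mat_adjoint W * W) $$ (i,j) * c j"
      using W ij by (simp add: mat_diag_mult_left[of _ n n] mat_diag_mult_right[of _ n n])
    also have "\<dots> = 1\<^sub>m n $$ (i,j)"
      using ij pos[of j] by (simp add: gram c_def flip: of_real_mult)
    finally show "(mat_adjoint ?U * ?U) $$ (i,j) = 1\<^sub>m n $$ (i,j)" .
  qed (use W in auto)
  then show ?thesis using W by (intro that[of c] unitaryI) auto
qed

lemma unitary_with_eigenvector_column: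
  fixes A :: "complex mat"
  assumes A: "A \<in> carrier_mat n n" and n: "0 < n"
  obtains U e where "unitary n U" "A *\<^sub>v col U 0 = e \<cdot>\<^sub>v col U 0"
proof -
  obtain e where "eigenvalue A e" using spectrum_non_empty[OF A] n by (auto simp: spectrum_def)
  then obtain v where v: "v \<in> carrier_vec n" "v \<noteq> 0\<^sub>v n" and eigen: "A *\<^sub>v v = e \<cdot>\<^sub>v v"
    using A by (auto simp: eigenvalue_def eigenvector_def)
  interpret cof_vec_space n "TYPE(complex)" .
  note basis = basis_completion[OF v]
  define ws where "ws = gram_schmidt n (basis_completion v)"
  note gs = gram_schmidt_result[OF basis(2,4,5) ws_def]
  have len: "length ws = n" using gs(4) basis(6) by simp
  have "basis_completion v = v # tl (basis_completion v)"
    using basis(6,7) n by (cases "basis_completion v") auto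
  then have "hd ws = v" unfolding ws_def by (metis gram_schmidt_hd[OF v(1)])
  then have ws0: "ws ! 0 = v" using len n by (metis hd_conv_nth length_greater_0_conv)
  define W where "W = mat_of_cols n ws"
  have W: "W \<in> carrier_mat n n" using len by (auto simp: W_def)
  have W0: "col W 0 = v" using v len n ws0 by (simp add: W_def col_mat_of_cols)
  have "corthogonal_mat W" unfolding W_def by (rule orthogonal_mat_of_cols[OF gs(3,2) len])
  then obtain c where U: "unitary n (W * real_diag n c)" by (rule corthogonal_mat_normalize[OF W])
  have "col (W * real_diag n c) 0 = complex_of_real (c 0) \<cdot>\<^sub>v v"
    using W n unfolding W0[symmetric]
    by (intro eq_vecI) (auto simp: mat_diag_mult_right[of _ n n])
  then have "A *\<^sub>v col (W * real_diag n c) 0 = e \<cdot>\<^sub>v col (W * real_diag n c) 0"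
    using A v eigen by (simp add: mult_mat_vec smult_smult_assoc mult.commute)
  then show ?thesis using U by (rule that[rotated])
qed

lemma unitary_conj_eigenvector_column:
  assumes U: "unitary n U" and A: "A \<in> carrier_mat n n"
    and eigen: "A *\<^sub>v col U k = e \<cdot>\<^sub>v col U k" and ik: "i < n" "k < n"
  shows "(mat_adjoint U * A * U) $$ (i,k) = (if i = k then e else 0)"
proof -
  note u = unitaryD[OF U]
  have AU: "(A * U) $$ (l,k) = e * U $$ (l,k)" if "l < n" for l
    using arg_cong[OF eigen, of "\<lambda>v. v $ l"] that A u ik by (simp add: index_mult_mat(1))
  have "(mat_adjoint U * A * U) $$ (i,k) = (\<Sum>l<n. mat_adjoint U $$ (i,l) * (A * U) $$ (l,k))"
    using A u ik by (subst mult_mat_assoc) (simp_all add: index_mult_mat_sum)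
  also have "\<dots> = e * (mat_adjoint U * U) $$ (i,k)"
    using u(1-3) ik by (simp add: AU index_mult_mat_sum sum_distrib_left mult.left_commute)
  finally show ?thesis using u ik by simp
qed

lemma hermitian_eq_direct_sum:
  fixes B :: "complex mat"
  assumes B: "B \<in> carrier_mat (Suc m) (Suc m)" and herm: "mat_adjoint B = B"
    and col0: "\<And>i. 0 < i \<Longrightarrow> i < Suc m \<Longrightarrow> B $$ (i,0) = 0"
  obtains c C where "C \<in> carrier_mat m m" "mat_adjoint C = C"
    "B = direct_sum (unitary_diag 1 (1\<^sub>m 1) (\<lambda>_. c)) C"
proof
  let ?C = "mat m m (\<lambda>(i,j). B $$ (Suc i, Suc j))"
  have cnj: "cnj (B $$ (i,j)) = B $$ (j,i)" if "i < Suc m" "j < Suc m" for i j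
    using that B herm index_mat_adjoint[of j B i] by simp
  show "?C \<in> carrier_mat m m" by simp
  show "mat_adjoint ?C = ?C" by (rule eq_matI) (auto simp: cnj)
  have "complex_of_real (Re (B $$ (0,0))) = B $$ (0,0)"
    using cnj[of 0 0] by (simp add: complex_eq_iff)
  moreover have "B $$ (0,j) = 0" if "0 < j" "j < Suc m" for j
    using cnj[of j 0] col0[OF that] that by simp
  ultimately show "B = direct_sum (unitary_diag 1 (1\<^sub>m 1) (\<lambda>_. Re (B $$ (0,0)))) ?C"
    using B col0 by (intro eq_matI) (auto simp: unitary_diag_def mat_diag_def direct_sum_def not_less_eq)
qed

theorem hermitian_unitary_diag:
  fixes A :: "complex mat"
  assumes "A \<in> carrier_mat n n" "mat_adjoint A = A"
  obtains U p where "unitary n U" "A = unitary_diag n U p"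
proof -
  have "\<exists>U p. unitary n U \<and> A = unitary_diag n U p"
    using assms
  proof (induction n arbitrary: A)
    case 0
    then have "A = unitary_diag 0 (1\<^sub>m 0) (\<lambda>_. 0)" by (intro eq_matI) auto
    then show ?case using unitary_one by blast
  next
    case (Suc m)
    note A = Suc.prems(1)
    obtain U e where U: "unitary (Suc m) U" and eigen: "A *\<^sub>v col U 0 = e \<cdot>\<^sub>v col U 0"
      using unitary_with_eigenvector_column[OF A] by blast
    note u = unitaryD[OF U]
    define B where "B = mat_adjoint U * A * U"
    have B: "B \<in> carrier_mat (Suc m) (Suc m)" and herm: "mat_adjoint B = B"
      using A u Suc.prems(2) by (simp_all add: B_def mat_adjoint_mult mult_mat_assoc)
    have col0: "B $$ (i,0) = 0" if "0 < i" "i < Suc m" for i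
      unfolding B_def using that unitary_conj_eigenvector_column[OF U A eigen] by simp
    obtain c C where C: "C \<in> carrier_mat m m" "mat_adjoint C = C"
      and B_eq: "B = direct_sum (unitary_diag 1 (1\<^sub>m 1) (\<lambda>_. c)) C"
      using hermitian_eq_direct_sum[OF B herm col0] by blast
    obtain V p where V: "unitary m V" and C_eq: "C = unitary_diag m V p" using Suc.IH[OF C] by blast
    define W where "W = direct_sum (1\<^sub>m 1) V"
    have W: "unitary (Suc m) W" using unitary_direct_sum[OF unitary_one V, of 1] by (simp add: W_def)
    obtain q where B_diag: "B = unitary_diag (Suc m) W q"
      unfolding B_eq C_eq W_def using unitary_diag_direct_sum[of "1\<^sub>m 1" 1 V m] unitaryD(1)[OF V] by simp
    have "A = U * B * mat_adjoint U"
      using A u by (simp add: B_def mult_mat_assoc unitary_cancel[OF U])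
    also have "\<dots> = unitary_diag (Suc m) (U * W) q"
      unfolding B_diag by (rule unitary_diag_conj) (simp_all add: u unitaryD[OF W])
    finally show ?case using unitary_mult[OF U W] by blast
  qed
  then show ?thesis using that by blast
qed

subsection \<open>Intertwiners of diagonal matrices\<close>

lemma real_diag_intertwiner_index:
  assumes Z: "Z \<in> carrier_mat n n" and comm: "Z * real_diag n q = real_diag n p * Z"
    and ij: "i < n" "j < n"
  shows "Z $$ (i,j) = 0 \<or> p i = q j"
proof -
  have "Z $$ (i,j) * complex_of_real (q j) = complex_of_real (p i) * Z $$ (i,j)"
    using arg_cong[OF comm, of "\<lambda>M. M $$ (i,j)"] Z ij
    by (simp add: mat_diag_mult_left[of _ n n] mat_diag_mult_right[of _ n n])
  then have "Z $$ (i,j) * (complex_of_real (q j) - complex_of_real (p i)) = 0"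
    by (simp add: algebra_simps)
  then show ?thesis by auto
qed

lemma real_diag_intertwiner_function:
  assumes Z: "Z \<in> carrier_mat n n" and comm: "Z * real_diag n q = real_diag n p * Z"
  shows "Z * real_diag n (\<lambda>i. f (q i)) = real_diag n (\<lambda>i. f (p i)) * Z"
proof (rule eq_matI)
  fix i j assume "i < dim_row (real_diag n (\<lambda>i. f (p i)) * Z)" "j < dim_col (real_diag n (\<lambda>i. f (p i)) * Z)"
  then have ij: "i < n" "j < n" using Z by auto
  then show "(Z * real_diag n (\<lambda>i. f (q i))) $$ (i,j) = (real_diag n (\<lambda>i. f (p i)) * Z) $$ (i,j)"
    using real_diag_intertwiner_index[OF Z comm ij] Z
    by (auto simp: mat_diag_mult_left[of _ n n] mat_diag_mult_right[of _ n n])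
qed (use Z in auto)

lemma unitary_diag_intertwiner_iff:
  assumes U: "unitary n U" and V: "unitary n V" and M: "M \<in> carrier_mat n n"
  shows "M * unitary_diag n V q = unitary_diag n U p * M
    \<longleftrightarrow> (mat_adjoint U * M * V) * real_diag n q = real_diag n p * (mat_adjoint U * M * V)"
    (is "?lhs \<longleftrightarrow> ?rhs")
proof -
  note u = unitaryD[OF U] and v = unitaryD[OF V]
  have left: "mat_adjoint U * (M * unitary_diag n V q) * V = (mat_adjoint U * M * V) * real_diag n q"
    using u v M by (simp add: mult_mat_assoc unitary_diag_eigenbasis(2)[OF V])
  have right: "mat_adjoint U * (unitary_diag n U p * M) * V = real_diag n p * (mat_adjoint U * M * V)"
    using u v M unitary_diag_eigenbasis(1)[OF U, of p]
    by (subst mult_mat_assoc[symmetric]) (auto simp: mult_mat_assoc)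
  have cancel: "X = Y"
    if "mat_adjoint U * X * V = mat_adjoint U * Y * V" "X \<in> carrier_mat n n" "Y \<in> carrier_mat n n" for X Y
  proof -
    have "Z = U * (mat_adjoint U * Z * V) * mat_adjoint V" if "Z \<in> carrier_mat n n" for Z
      using that u v by (simp add: mult_mat_assoc unitary_cancel[OF U])
    then show ?thesis using that by metis
  qed
  show ?thesis
  proof
    assume ?lhs
    then show ?rhs unfolding left[symmetric] right[symmetric] by simp
  next
    assume ?rhs
    then have "mat_adjoint U * (M * unitary_diag n V q) * V = mat_adjoint U * (unitary_diag n U p * M) * V"
      unfolding left right .
    then show ?lhs by (rule cancel) (use u v M in auto)
  qed
qed

lemma unitary_diag_intertwiner_function:
  assumes "unitary n U" "unitary n V" "M \<in> carrier_mat n n"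
    and "M * unitary_diag n V q = unitary_diag n U p * M"
  shows "M * unitary_diag n V (\<lambda>i. f (q i)) = unitary_diag n U (\<lambda>i. f (p i)) * M"
  using assms real_diag_intertwiner_function[of "mat_adjoint U * M * V" n q p f]
  by (simp add: unitary_diag_intertwiner_iff unitaryD)

lemma unitary_diag_unique:
  assumes "unitary n U" "unitary n V" "unitary_diag n U p = unitary_diag n V q"
  shows "unitary_diag n U (\<lambda>i. f (p i)) = unitary_diag n V (\<lambda>i. f (q i))"
  using unitary_diag_intertwiner_function[OF assms(1,2) one_carrier_mat, of q p f] assms(3)
  by (simp add: unitaryD[OF assms(1)] unitaryD[OF assms(2)]
      left_mult_one_mat[OF unitary_diag_carrier] right_mult_one_mat[OF unitary_diag_carrier] assms)

definition schur_multiplier :: "(nat \<Rightarrow> nat \<Rightarrow> real) \<Rightarrow> complex mat \<Rightarrow> complex mat" where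
  "schur_multiplier m K = mat (dim_row K) (dim_col K) (\<lambda>(i,j). complex_of_real (m i j) * K $$ (i,j))"

lemma dim_schur_multiplier [simp]:
  "dim_row (schur_multiplier m K) = dim_row K" "dim_col (schur_multiplier m K) = dim_col K"
  by (simp_all add: schur_multiplier_def)

lemma index_schur_multiplier [simp]:
  "i < dim_row K \<Longrightarrow> j < dim_col K \<Longrightarrow> schur_multiplier m K $$ (i,j) = complex_of_real (m i j) * K $$ (i,j)"
  by (simp add: schur_multiplier_def)

text \<open>The entries of \<open>S\<close> and \<open>R\<close> vanish unless the two eigenvalues involved coincide, so the multiplier
  can be pulled out of the matrix products.\<close>

lemma schur_multiplier_intertwiner:
  fixes \<phi> :: "real \<Rightarrow> real \<Rightarrow> real"
  assumes S: "S \<in> carrier_mat n n" "S * real_diag n p = real_diag n p * S"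
    and R: "R \<in> carrier_mat n n" "R * real_diag n q = real_diag n q * R"
    and K: "K \<in> carrier_mat n n" "S * K = K * R"
  shows "S * schur_multiplier (\<lambda>i j. \<phi> (p i) (q j)) K = schur_multiplier (\<lambda>i j. \<phi> (p i) (q j)) K * R"
    (is "S * ?Y = ?Y * R")
proof (rule eq_matI)
  fix i j assume "i < dim_row (?Y * R)" "j < dim_col (?Y * R)"
  then have ij: "i < n" "j < n" using K R by auto
  have S_pull: "S $$ (i,k) * (\<phi> (p k) (q j) * K $$ (k,j)) = \<phi> (p i) (q j) * (S $$ (i,k) * K $$ (k,j))"
    if "k < n" for k
    using real_diag_intertwiner_index[OF S ij(1) that] by auto
  have R_pull: "\<phi> (p i) (q k) * K $$ (i,k) * R $$ (k,j) = \<phi> (p i) (q j) * (K $$ (i,k) * R $$ (k,j))"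
    if "k < n" for k
    using real_diag_intertwiner_index[OF R that ij(2)] by auto
  have "(S * ?Y) $$ (i,j) = (\<Sum>k<n. \<phi> (p i) (q j) * (S $$ (i,k) * K $$ (k,j)))"
    using ij S(1) K(1) by (simp add: index_mult_mat_sum S_pull)
  also have "\<dots> = \<phi> (p i) (q j) * (S * K) $$ (i,j)"
    using ij S(1) K(1) by (simp add: index_mult_mat_sum sum_distrib_left)
  also have "\<dots> = \<phi> (p i) (q j) * (K * R) $$ (i,j)" by (simp only: K(2))
  also have "\<dots> = (\<Sum>k<n. \<phi> (p i) (q j) * (K $$ (i,k) * R $$ (k,j)))"
    using ij R(1) K(1) by (simp add: index_mult_mat_sum sum_distrib_left)
  also have "\<dots> = (?Y * R) $$ (i,j)"
    using ij R(1) K(1) by (simp add: index_mult_mat_sum R_pull)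
  finally show "(S * ?Y) $$ (i,j) = (?Y * R) $$ (i,j)" .
qed (use S R K in auto)

lemma schur_multiplier_commute:
  fixes \<phi> :: "real \<Rightarrow> real \<Rightarrow> real"
  assumes U: "unitary n U" and V: "unitary n V" and M: "M \<in> carrier_mat n n"
    and MU: "M * unitary_diag n U p = unitary_diag n U p * M"
    and MV: "M * unitary_diag n V q = unitary_diag n V q * M"
  defines "Y \<equiv> schur_multiplier (\<lambda>i j. \<phi> (p i) (q j)) (mat_adjoint U * V)"
  shows "M * (U * Y * mat_adjoint V) = U * Y * mat_adjoint V * M"
proof -
  note u = unitaryD[OF U] and v = unitaryD[OF V]
  define S where "S = mat_adjoint U * M * U"
  define R where "R = mat_adjoint V * M * V"
  have carrier: "S \<in> carrier_mat n n" "R \<in> carrier_mat n n" "mat_adjoint U * V \<in> carrier_mat n n"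
    using u v M by (auto simp: S_def R_def)
  have dim_Y: "dim_row Y = n" "dim_col Y = n" using u v by (simp_all add: Y_def)
  have S: "S * real_diag n p = real_diag n p * S" and R: "R * real_diag n q = real_diag n q * R"
    using MU MV unfolding S_def R_def
    by (simp_all only: unitary_diag_intertwiner_iff[OF U U M] unitary_diag_intertwiner_iff[OF V V M])
  have "S * (mat_adjoint U * V) = mat_adjoint U * V * R"
    using u v M by (simp add: S_def R_def mult_mat_assoc unitary_cancel[OF U] unitary_cancel[OF V])
  then have SY: "S * Y = Y * R"
    unfolding Y_def by (rule schur_multiplier_intertwiner[OF carrier(1) S carrier(2) R carrier(3)])
  have "M * (U * Y * mat_adjoint V) = U * (S * Y) * mat_adjoint V"
    using u v M dim_Y by (simp add: S_def mult_mat_assoc unitary_cancel[OF U])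
  also have "\<dots> = U * Y * mat_adjoint V * M"
    unfolding SY using u v M dim_Y by (simp add: R_def mult_mat_assoc)
  finally show ?thesis .
qed

subsection \<open>Traces against diagonalized matrices\<close>

lemma index_unitary_diag_diag:
  assumes "K \<in> carrier_mat n n" "i < n"
  shows "unitary_diag n K g $$ (i,i) = complex_of_real (\<Sum>j<n. g j * (cmod (K $$ (i,j)))\<^sup>2)"
  using assms
  by (simp add: unitary_diag_def mat_diag_mult_right[of _ n n] index_mult_mat_sum
      complex_norm_square mult.assoc mult.left_commute del: of_real_power)

lemma mtrace_mult_unitary_diag:
  assumes U: "unitary n U" and A: "A \<in> carrier_mat n n"
  shows "mtrace (A * unitary_diag n U f) = (\<Sum>i<n. (mat_adjoint U * A * U) $$ (i,i) * complex_of_real (f i))"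
proof -
  note u = unitaryD[OF U]
  define B where "B = mat_adjoint U * A * U"
  have B: "B \<in> carrier_mat n n" using u by (simp add: B_def)
  have "A * unitary_diag n U f = U * (B * real_diag n f) * mat_adjoint U"
    using A u by (simp add: B_def unitary_diag_def mult_mat_assoc unitary_cancel[OF U])
  also have "mtrace \<dots> = mtrace (B * real_diag n f)"
    using B by (intro mtrace_unitary_conj[OF U]) simp
  also have "\<dots> = (\<Sum>i<n. B $$ (i,i) * complex_of_real (f i))"
    using B by (simp add: mat_diag_mult_right[of B n n] mtrace_def)
  finally show ?thesis unfolding B_def .
qed

lemma mtrace_unitary_diag_mult:
  assumes U: "unitary n U" and V: "unitary n V"
  shows "mtrace (unitary_diag n U f * unitary_diag n V g)
    = complex_of_real (\<Sum>i<n. \<Sum>j<n. (cmod ((mat_adjoint U * V) $$ (i,j)))\<^sup>2 * (f i * g j))"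
proof -
  note u = unitaryD[OF U] and v = unitaryD[OF V]
  have conj: "mat_adjoint U * unitary_diag n V g * U = unitary_diag n (mat_adjoint U * V) g"
    using unitary_diag_conj[of "mat_adjoint U" n V g] u v by simp
  have "mtrace (unitary_diag n U f * unitary_diag n V g) = mtrace (unitary_diag n V g * unitary_diag n U f)"
    using u v by (intro mtrace_mult_commute) auto
  also have "\<dots> = (\<Sum>i<n. complex_of_real (\<Sum>j<n. g j * (cmod ((mat_adjoint U * V) $$ (i,j)))\<^sup>2)
      * complex_of_real (f i))"
    unfolding mtrace_mult_unitary_diag[OF U unitary_diag_carrier[OF V]] conj
    by (intro sum.cong refl) (use u v in \<open>simp add: index_unitary_diag_diag\<close>)
  also have "\<dots> = complex_of_real (\<Sum>i<n. \<Sum>j<n. (cmod ((mat_adjoint U * V) $$ (i,j)))\<^sup>2 * (f i * g j))"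
    by (simp add: sum_distrib_left sum_distrib_right ac_simps)
  finally show ?thesis .
qed

lemma mtrace_unitary_diag_mult_gram:
  assumes U: "unitary n U" and V: "unitary n V" and X: "X \<in> carrier_mat n n"
  shows "mtrace (unitary_diag n U f * (X * mat_adjoint X))
    = complex_of_real (\<Sum>i<n. \<Sum>j<n. f i * (cmod ((mat_adjoint U * X * V) $$ (i,j)))\<^sup>2)"
proof -
  note u = unitaryD[OF U] and v = unitaryD[OF V]
  define Y where "Y = mat_adjoint U * X * V"
  have Y: "Y \<in> carrier_mat n n" using u v by (simp add: Y_def)
  have conj: "mat_adjoint U * (X * mat_adjoint X) * U = Y * mat_adjoint Y"
    using u v X by (simp add: Y_def mat_adjoint_mult mult_mat_assoc unitary_cancel[OF V])
  have "mtrace (unitary_diag n U f * (X * mat_adjoint X)) = mtrace (X * mat_adjoint X * unitary_diag n U f)"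
    using u X by (intro mtrace_mult_commute) auto
  also have "\<dots> = (\<Sum>i<n. (Y * mat_adjoint Y) $$ (i,i) * complex_of_real (f i))"
    unfolding conj[symmetric] using X by (intro mtrace_mult_unitary_diag[OF U]) simp
  also have "\<dots> = complex_of_real (\<Sum>i<n. \<Sum>j<n. f i * (cmod (Y $$ (i,j)))\<^sup>2)"
    using Y by (simp add: index_mult_adjoint_diag sum_distrib_left mult.commute)
  finally show ?thesis by (simp only: Y_def)
qed

subsection \<open>Positive semidefinite matrices\<close>

lemma psd_carrier: "psd n A \<Longrightarrow> A \<in> carrier_mat n n"
  by (simp add: psd_def)

lemma psd_adjoint: "psd n A \<Longrightarrow> mat_adjoint A = A"
  by (simp add: psd_def hermitian_def)

lemma quadratic_form_col:
  fixes A :: "complex mat"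
  assumes A: "A \<in> carrier_mat n n" and X: "X \<in> carrier_mat n m" and k: "k < m"
  shows "conjugate (col X k) \<bullet> (A *\<^sub>v col X k) = (mat_adjoint X * A * X) $$ (k,k)"
proof -
  have "row (mat_adjoint X) k = conjugate (col X k)"
    using X k by (intro eq_vecI) (auto simp: conjugate_complex_def)
  then have "conjugate (col X k) \<bullet> (A *\<^sub>v col X k) = (mat_adjoint X * (A * X)) $$ (k,k)"
    using A X k by (simp add: index_mult_mat(1) mult_mat_vec_def)
  then show ?thesis using A X by (simp add: mult_mat_assoc)
qed

lemma quadratic_form_eq_mtrace:
  fixes A :: "complex mat"
  assumes A: "A \<in> carrier_mat n n" and v: "v \<in> carrier_vec n"
  defines "X \<equiv> mat_of_cols n [v]"
  shows "conjugate v \<bullet> (A *\<^sub>v v) = mtrace (A * (X * mat_adjoint X))"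
proof -
  have X: "X \<in> carrier_mat n 1" "col X 0 = v" using v by (auto simp: X_def mat_of_cols_def)
  then have "conjugate v \<bullet> (A *\<^sub>v v) = mtrace (mat_adjoint X * (A * X))"
    using quadratic_form_col[OF A X(1), of 0] A by (simp add: mtrace_def mult_mat_assoc)
  also have "\<dots> = mtrace (A * X * mat_adjoint X)"
    using A X by (intro mtrace_mult_commute) auto
  finally show ?thesis using A X by (simp add: mult_mat_assoc)
qed

lemma psd_gram:
  assumes X: "X \<in> carrier_mat n m"
  shows "psd n (X * mat_adjoint X)"
  unfolding psd_def
proof (intro conjI ballI)
  show "X * mat_adjoint X \<in> carrier_mat n n" using X by simp
  show "hermitian (X * mat_adjoint X)" using X by (simp add: hermitian_def mat_adjoint_mult)
  fix v :: "complex vec" assume v: "v \<in> carrier_vec n"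
  define C where "C = mat_of_cols n [v]"
  have C: "C \<in> carrier_mat n 1" "col C 0 = v" using v by (auto simp: C_def mat_of_cols_def)
  let ?Y = "mat_adjoint C * X"
  have "conjugate v \<bullet> (X * mat_adjoint X *\<^sub>v v) = (mat_adjoint C * (X * mat_adjoint X) * C) $$ (0,0)"
    using quadratic_form_col[of "X * mat_adjoint X" n C 1 0] X C by simp
  also have "mat_adjoint C * (X * mat_adjoint X) * C = ?Y * mat_adjoint ?Y"
    using X C by (simp add: mat_adjoint_mult mult_mat_assoc)
  also have "(?Y * mat_adjoint ?Y) $$ (0,0) = complex_of_real (\<Sum>k<m. (cmod (?Y $$ (0,k)))\<^sup>2)"
    using X C by (subst index_mult_adjoint_diag) auto
  finally show "0 \<le> Re (conjugate v \<bullet> (X * mat_adjoint X *\<^sub>v v))"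
    by (simp add: sum_nonneg)
qed

lemma psd_one: "psd n (1\<^sub>m n)"
  using psd_gram[of "1\<^sub>m n" n n] by simp

lemma psd_conj_diag_nonneg:
  assumes A: "psd n A" and X: "X \<in> carrier_mat n m" and k: "k < m"
  shows "0 \<le> Re ((mat_adjoint X * A * X) $$ (k,k))"
proof -
  have "col X k \<in> carrier_vec n" using X by auto
  then show ?thesis
    using A quadratic_form_col[OF psd_carrier[OF A] X k] by (auto simp: psd_def)
qed

lemma psd_unitary_diag:
  assumes U: "unitary n U" and f: "\<And>i. i < n \<Longrightarrow> 0 \<le> f i"
  shows "psd n (unitary_diag n U f)"
proof -
  have "unitary_diag n U f
      = unitary_diag n U (\<lambda>i. sqrt (f i)) * mat_adjoint (unitary_diag n U (\<lambda>i. sqrt (f i)))"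
    unfolding unitary_diag_adjoint[OF U] unitary_diag_mult[OF U] using f by (intro unitary_diag_cong) auto
  then show ?thesis using psd_gram[OF unitary_diag_carrier[OF U], of "\<lambda>i. sqrt (f i)"] by simp
qed

lemma psd_unitary_diag_nonneg:
  assumes U: "unitary n U" and psd: "psd n (unitary_diag n U p)" and k: "k < n"
  shows "0 \<le> p k"
proof -
  have "mat_adjoint U * unitary_diag n U p * U = real_diag n p"
    using unitaryD[OF U] by (simp add: unitary_diag_eigenbasis(1)[OF U] mult_mat_assoc)
  then show ?thesis
    using psd_conj_diag_nonneg[OF psd unitaryD(1)[OF U] k] k by (simp add: mat_diag_def)
qed

lemma psd_spectralE:
  assumes "psd n A"
  obtains U p where "unitary n U" "\<And>i. 0 \<le> p i" "A = unitary_diag n U p"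
proof -
  obtain U p where U: "unitary n U" and A: "A = unitary_diag n U p"
    using hermitian_unitary_diag[OF psd_carrier[OF assms] psd_adjoint[OF assms]] .
  define p' where "p' i = (if i < n then p i else 0)" for i
  have "0 \<le> p' i" for i
    using psd_unitary_diag_nonneg[OF U, of p i] assms A by (simp add: p'_def)
  moreover have "A = unitary_diag n U p'" unfolding A by (rule unitary_diag_cong) (simp add: p'_def)
  ultimately show ?thesis by (rule that[OF U])
qed

lemma psd_unitary_conj:
  assumes "psd n A" "unitary n V"
  shows "psd n (V * A * mat_adjoint V)"
proof -
  obtain U p where U: "unitary n U" "\<And>i. 0 \<le> p i" "A = unitary_diag n U p"
    using psd_spectralE[OF assms(1)] by blast
  show ?thesis
    unfolding U(3) using U assms(2)
    by (subst unitary_diag_conj) (auto simp: unitaryD intro!: psd_unitary_diag unitary_mult)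
qed

lemma mtrace_psd_mult_nonneg:
  assumes A: "psd n A" and B: "psd n B"
  shows "0 \<le> Re (mtrace (A * B))"
proof -
  obtain V q where V: "unitary n V" "\<And>i. 0 \<le> q i" "B = unitary_diag n V q"
    using psd_spectralE[OF B] by blast
  show ?thesis
    unfolding V(3) mtrace_mult_unitary_diag[OF V(1) psd_carrier[OF A]]
    using psd_conj_diag_nonneg[OF A unitaryD(1)[OF V(1)]] V(2)
    by (auto intro!: sum_nonneg mult_nonneg_nonneg)
qed

lemma mtrace_psd_mult_real:
  assumes "psd n A" "psd n B"
  shows "mtrace (A * B) = complex_of_real (Re (mtrace (A * B)))"
proof -
  obtain U p where U: "unitary n U" "A = unitary_diag n U p" using psd_spectralE[OF assms(1)] by blast
  obtain V q where V: "unitary n V" "B = unitary_diag n V q" using psd_spectralE[OF assms(2)] by blast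
  show ?thesis unfolding U(2) V(2) mtrace_unitary_diag_mult[OF U(1) V(1)] Re_complex_of_real ..
qed

lemma psdI_mtrace:
  assumes A: "A \<in> carrier_mat n n" "mat_adjoint A = A"
    and tr: "\<And>B. psd n B \<Longrightarrow> 0 \<le> Re (mtrace (A * B))"
  shows "psd n A"
proof -
  have "0 \<le> Re (conjugate v \<bullet> (A *\<^sub>v v))" if "v \<in> carrier_vec n" for v
    unfolding quadratic_form_eq_mtrace[OF A(1) that] by (rule tr[OF psd_gram[OF mat_of_cols_carrier(1)]])
  then show ?thesis using A by (simp add: psd_def hermitian_def)
qed

lemma psd_add:
  assumes A: "psd n A" and B: "psd n B"
  shows "psd n (A + B)"
proof (rule psdI_mtrace)
  note carrier = psd_carrier[OF A] psd_carrier[OF B]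
  show "A + B \<in> carrier_mat n n" using carrier by simp
  show "mat_adjoint (A + B) = A + B"
    using carrier psd_adjoint[OF A] psd_adjoint[OF B] by (simp add: mat_adjoint_add)
  fix C assume C: "psd n C"
  have "mtrace ((A + B) * C) = mtrace (A * C) + mtrace (B * C)"
    using carrier psd_carrier[OF C] by (simp add: add_mult_distrib_mat[of _ n n] mtrace_add)
  then show "0 \<le> Re (mtrace ((A + B) * C))"
    using mtrace_psd_mult_nonneg[OF A C] mtrace_psd_mult_nonneg[OF B C] by simp
qed

lemma psd_smult:
  assumes "psd n A" "0 \<le> c"
  shows "psd n (complex_of_real c \<cdot>\<^sub>m A)"
proof -
  obtain U p where U: "unitary n U" "\<And>i. 0 \<le> p i" "A = unitary_diag n U p"
    using psd_spectralE[OF assms(1)] by blast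
  show ?thesis
    unfolding U(3) unitary_diag_smult[OF U(1)] using U assms(2) by (simp add: psd_unitary_diag)
qed

lemma Re_mtrace_minus_mult:
  assumes "A \<in> carrier_mat n n" "B \<in> carrier_mat n n" "C \<in> carrier_mat n n"
  shows "Re (mtrace ((A - B) * C)) = Re (mtrace (A * C)) - Re (mtrace (B * C))"
    and "Re (mtrace (C * (A - B))) = Re (mtrace (C * A)) - Re (mtrace (C * B))"
  using assms by (simp_all add: mult_mat_minus_distrib mtrace_minus)

subsection \<open>Powers of positive semidefinite matrices\<close>

lemma mpow_unitary_diag:
  assumes U: "unitary n U" and p: "\<And>i. 0 \<le> p i"
  shows "mpow (unitary_diag n U p) s = unitary_diag n U (\<lambda>i. p i powr s)"
proof -
  let ?A = "unitary_diag n U p"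
  let ?P = "\<lambda>B. \<exists>V q. unitary n V \<and> (\<forall>i. 0 \<le> q i) \<and> ?A = unitary_diag n V q
    \<and> B = unitary_diag n V (\<lambda>i. q i powr s)"
  have mpow_eq: "mpow ?A s = (SOME B. ?P B)"
    using unitaryD[OF U] unfolding mpow_def unitary_diag_def by simp
  have "?P (unitary_diag n U (\<lambda>i. p i powr s))" using U p by blast
  then have "?P (mpow ?A s)" unfolding mpow_eq by (rule someI)
  then obtain V q where "unitary n V" "?A = unitary_diag n V q"
    and "mpow ?A s = unitary_diag n V (\<lambda>i. q i powr s)"
    by blast
  then show ?thesis using unitary_diag_unique[OF U, of V p q "\<lambda>x. x powr s"] by simp
qed

lemma psd_mpow:
  assumes "psd n A"
  shows "psd n (mpow A s)"
proof -
  obtain U p where U: "unitary n U" "\<And>i. 0 \<le> p i" "A = unitary_diag n U p"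
    using psd_spectralE[OF assms] by blast
  then show ?thesis by (simp add: mpow_unitary_diag psd_unitary_diag)
qed

lemma mpow_one:
  assumes "psd n A"
  shows "mpow A 1 = A"
proof -
  obtain U p where U: "unitary n U" "\<And>i. 0 \<le> p i" "A = unitary_diag n U p"
    using psd_spectralE[OF assms] by blast
  then show ?thesis by (simp add: mpow_unitary_diag)
qed

lemma mpow_mult:
  assumes "psd n A"
  shows "mpow A s * mpow A t = mpow A (s + t)"
proof -
  obtain U p where U: "unitary n U" "\<And>i. 0 \<le> p i" "A = unitary_diag n U p"
    using psd_spectralE[OF assms] by blast
  then show ?thesis by (simp add: mpow_unitary_diag unitary_diag_mult powr_add)
qed

lemma mpow_mpow:
  assumes "psd n A"
  shows "mpow (mpow A s) t = mpow A (s * t)"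
proof -
  obtain U p where U: "unitary n U" "\<And>i. 0 \<le> p i" "A = unitary_diag n U p"
    using psd_spectralE[OF assms] by blast
  then show ?thesis by (simp add: mpow_unitary_diag powr_powr)
qed

lemma mpow_smult:
  assumes "psd n A" "0 \<le> c"
  shows "mpow (complex_of_real c \<cdot>\<^sub>m A) s = complex_of_real (c powr s) \<cdot>\<^sub>m mpow A s"
proof -
  obtain U p where U: "unitary n U" "\<And>i. 0 \<le> p i" "A = unitary_diag n U p"
    using psd_spectralE[OF assms(1)] by blast
  then show ?thesis using assms(2) by (simp add: mpow_unitary_diag unitary_diag_smult powr_mult)
qed

lemma mpow_one_mat: "mpow (1\<^sub>m n) s = 1\<^sub>m n"
  using mpow_unitary_diag[of n "1\<^sub>m n" "\<lambda>_. 1" s] by (simp add: unitary_diag_one)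

lemma psd_one_minus_support:
  assumes "psd n A"
  shows "psd n (1\<^sub>m n - mpow A 0)"
proof -
  obtain U p where U: "unitary n U" "\<And>i. 0 \<le> p i" "A = unitary_diag n U p"
    using psd_spectralE[OF assms] by blast
  then have "1\<^sub>m n - mpow A 0 = unitary_diag n U (\<lambda>i. 1 - p i powr 0)"
    by (simp add: mpow_unitary_diag unitary_diag_minus flip: unitary_diag_one[OF U(1)])
  then show ?thesis using U(1) by (simp add: psd_unitary_diag)
qed

subsection \<open>Sums over pairs of eigenvalues\<close>

definition spectral_decomposition :: "complex mat \<Rightarrow> complex mat \<times> (nat \<Rightarrow> real)" where
  "spectral_decomposition A = (SOME (U, p). unitary (dim_row A) U \<and> (\<forall>i. 0 \<le> p i)
     \<and> A = unitary_diag (dim_row A) U p)"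

abbreviation spectral_basis :: "complex mat \<Rightarrow> complex mat" where
  "spectral_basis A \<equiv> fst (spectral_decomposition A)"

abbreviation spectral_value :: "complex mat \<Rightarrow> nat \<Rightarrow> real" where
  "spectral_value A \<equiv> snd (spectral_decomposition A)"

lemma spectral_decomposition:
  assumes "psd n A"
  shows "unitary n (spectral_basis A)" and "0 \<le> spectral_value A i"
    and "unitary_diag n (spectral_basis A) (spectral_value A) = A"
proof -
  have dim: "dim_row A = n" using psd_carrier[OF assms] by simp
  obtain U p where "unitary n U" "\<And>i. 0 \<le> p i" "A = unitary_diag n U p"
    using psd_spectralE[OF assms] by blast
  then have "\<exists>Up. case Up of (U, p) \<Rightarrow> unitary n U \<and> (\<forall>i. 0 \<le> p i) \<and> A = unitary_diag n U p"
    by (intro exI[of _ "(U, p)"]) simp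
  then have "case spectral_decomposition A of (U, p) \<Rightarrow>
      unitary n U \<and> (\<forall>i. 0 \<le> p i) \<and> A = unitary_diag n U p"
    unfolding spectral_decomposition_def dim by (rule someI_ex)
  then show "unitary n (spectral_basis A)" "0 \<le> spectral_value A i"
    "unitary_diag n (spectral_basis A) (spectral_value A) = A"
    by (auto split: prod.splits)
qed

lemma mpow_spectral:
  assumes "psd n A"
  shows "mpow A s = unitary_diag n (spectral_basis A) (\<lambda>i. spectral_value A i powr s)"
  using mpow_unitary_diag[of n "spectral_basis A" "spectral_value A" s] spectral_decomposition[OF assms]
  by simp

definition overlap :: "complex mat \<Rightarrow> complex mat \<Rightarrow> nat \<Rightarrow> nat \<Rightarrow> real" where
  "overlap A B i j = (cmod ((mat_adjoint (spectral_basis A) * spectral_basis B) $$ (i,j)))\<^sup>2"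

text \<open>The overlaps are the Nussbaum--Szkola weights: they turn traces of products of functions of two
  noncommuting matrices into expectations of functions of two real variables.\<close>

definition overlap_sum :: "complex mat \<Rightarrow> complex mat \<Rightarrow> (real \<Rightarrow> real \<Rightarrow> real) \<Rightarrow> real" where
  "overlap_sum A B F = (\<Sum>i<dim_row A. \<Sum>j<dim_row B.
     overlap A B i j * F (spectral_value A i) (spectral_value B j))"

definition overlap_support :: "complex mat \<Rightarrow> complex mat \<Rightarrow> (real \<times> real) set" where
  "overlap_support A B = {(spectral_value A i, spectral_value B j) | i j.
     i < dim_row A \<and> j < dim_row B \<and> overlap A B i j \<noteq> 0}"

lemma overlap_nonneg [simp]: "0 \<le> overlap A B i j"
  by (simp add: overlap_def)

lemma overlap_support_nonneg:
  assumes "psd n A" "psd m B" "(x, y) \<in> overlap_support A B"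
  shows "0 \<le> x" "0 \<le> y"
  using assms spectral_decomposition(2) by (auto simp: overlap_support_def)

lemma overlap_supportI:
  "i < dim_row A \<Longrightarrow> j < dim_row B \<Longrightarrow> overlap A B i j \<noteq> 0
    \<Longrightarrow> (spectral_value A i, spectral_value B j) \<in> overlap_support A B"
  by (auto simp: overlap_support_def)

lemma overlap_sum_mono:
  assumes "\<And>x y. (x, y) \<in> overlap_support A B \<Longrightarrow> F x y \<le> G x y"
  shows "overlap_sum A B F \<le> overlap_sum A B G"
  unfolding overlap_sum_def
proof (intro sum_mono)
  fix i j assume "i \<in> {..<dim_row A}" "j \<in> {..<dim_row B}"
  then show "overlap A B i j * F (spectral_value A i) (spectral_value B j)
      \<le> overlap A B i j * G (spectral_value A i) (spectral_value B j)"
    using assms overlap_supportI[of i A j B] by (cases "overlap A B i j = 0") (auto intro: mult_left_mono)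
qed

lemma overlap_sum_cong:
  assumes "\<And>x y. (x, y) \<in> overlap_support A B \<Longrightarrow> F x y = G x y"
  shows "overlap_sum A B F = overlap_sum A B G"
  using assms by (intro antisym overlap_sum_mono) simp_all

lemma overlap_sum_cmult: "overlap_sum A B (\<lambda>x y. c * F x y) = c * overlap_sum A B F"
  by (simp add: overlap_sum_def sum_distrib_left mult.left_commute)

lemma overlap_sum_add: "overlap_sum A B (\<lambda>x y. F x y + G x y) = overlap_sum A B F + overlap_sum A B G"
  by (simp add: overlap_sum_def sum.distrib distrib_left)

lemma overlap_sum_diff: "overlap_sum A B (\<lambda>x y. F x y - G x y) = overlap_sum A B F - overlap_sum A B G"
  by (simp add: overlap_sum_def sum_subtractf right_diff_distrib)

lemma overlap_sum_nonneg:
  assumes "\<And>x y. (x, y) \<in> overlap_support A B \<Longrightarrow> 0 \<le> F x y"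
  shows "0 \<le> overlap_sum A B F"
  using overlap_sum_mono[of A B "\<lambda>_ _. 0" F] assms by (simp add: overlap_sum_def)

lemma overlap_sum_eq_0_iff:
  assumes nonneg: "\<And>x y. (x, y) \<in> overlap_support A B \<Longrightarrow> 0 \<le> F x y"
  shows "overlap_sum A B F = 0 \<longleftrightarrow> (\<forall>(x, y)\<in>overlap_support A B. F x y = 0)"
proof -
  let ?I = "{..<dim_row A} \<times> {..<dim_row B}"
  let ?f = "\<lambda>(i, j). overlap A B i j * F (spectral_value A i) (spectral_value B j)"
  have "0 \<le> ?f k" if "k \<in> ?I" for k
  proof (cases k)
    case (Pair i j)
    then show ?thesis
      using that nonneg overlap_supportI[of i A j B] by (cases "overlap A B i j = 0") auto
  qed
  then have "sum ?f ?I = 0 \<longleftrightarrow> (\<forall>k\<in>?I. ?f k = 0)"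
    by (intro sum_nonneg_eq_0_iff) auto
  then show ?thesis
    by (auto simp: overlap_sum_def sum.cartesian_product overlap_support_def)
qed

lemma has_bochner_integral_overlap_sum:
  assumes "\<And>x y. (x, y) \<in> overlap_support A B \<Longrightarrow> has_bochner_integral M (\<lambda>\<tau>. F \<tau> x y) (G x y)"
  shows "has_bochner_integral M (\<lambda>\<tau>. overlap_sum A B (F \<tau>)) (overlap_sum A B G)"
  unfolding overlap_sum_def
proof (intro has_bochner_integral_sum)
  fix i j assume "i \<in> {..<dim_row A}" "j \<in> {..<dim_row B}"
  then show "has_bochner_integral M (\<lambda>\<tau>. overlap A B i j * F \<tau> (spectral_value A i) (spectral_value B j))
      (overlap A B i j * G (spectral_value A i) (spectral_value B j))"
    using assms overlap_supportI[of i A j B]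
    by (cases "overlap A B i j = 0") (auto intro!: has_bochner_integral_mult_right has_bochner_integral_zero)
qed

lemma Re_mtrace_mpow_mult_mpow:
  assumes A: "psd n A" and B: "psd n B"
  shows "Re (mtrace (mpow A s * mpow B t)) = overlap_sum A B (\<lambda>x y. x powr s * y powr t)"
  using psd_carrier[OF A] psd_carrier[OF B]
  by (simp add: mpow_spectral[OF A] mpow_spectral[OF B] overlap_sum_def overlap_def
      mtrace_unitary_diag_mult[OF spectral_decomposition(1)[OF A] spectral_decomposition(1)[OF B]])

lemma Re_mtrace_eq_overlap_sum:
  assumes A: "psd n A" and B: "psd n B"
  shows "Re (mtrace A) = overlap_sum A B (\<lambda>x y. x)"
proof -
  have "mtrace A = mtrace (unitary_diag n (spectral_basis A) (spectral_value A)
      * unitary_diag n (spectral_basis B) (\<lambda>_. 1))"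
    using psd_carrier[OF A] spectral_decomposition[OF A] spectral_decomposition(1)[OF B]
    by (simp add: unitary_diag_one)
  then show ?thesis
    using psd_carrier[OF A] psd_carrier[OF B]
    by (simp add: overlap_sum_def overlap_def
        mtrace_unitary_diag_mult[OF spectral_decomposition(1)[OF A] spectral_decomposition(1)[OF B]])
qed

subsection \<open>Commutants and trace-preserving expectations\<close>

definition matrix_commutant :: "nat \<Rightarrow> complex mat set \<Rightarrow> complex mat set" where
  "matrix_commutant n \<S> = {M \<in> carrier_mat n n. \<forall>A\<in>\<S>. M * A = A * M}"

lemma matrix_commutantI:
  "M \<in> carrier_mat n n \<Longrightarrow> (\<And>A. A \<in> \<S> \<Longrightarrow> M * A = A * M) \<Longrightarrow> M \<in> matrix_commutant n \<S>"
  by (simp add: matrix_commutant_def)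

lemma matrix_commutantD:
  assumes "M \<in> matrix_commutant n \<S>"
  shows "M \<in> carrier_mat n n" "A \<in> \<S> \<Longrightarrow> M * A = A * M"
  using assms by (auto simp: matrix_commutant_def)

lemma matrix_commutant_antimono: "\<S> \<subseteq> \<T> \<Longrightarrow> matrix_commutant n \<T> \<subseteq> matrix_commutant n \<S>"
  by (auto simp: matrix_commutant_def)

lemma matrix_commutant_swap:
  assumes "\<S> \<subseteq> matrix_commutant n \<T>" "\<T> \<subseteq> carrier_mat n n"
  shows "\<T> \<subseteq> matrix_commutant n \<S>"
  using assms by (fastforce simp: matrix_commutant_def)

lemma one_in_matrix_commutant: "\<S> \<subseteq> carrier_mat n n \<Longrightarrow> 1\<^sub>m n \<in> matrix_commutant n \<S>"
  by (auto intro!: matrix_commutantI)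

lemma minus_in_matrix_commutant:
  assumes "\<S> \<subseteq> carrier_mat n n" "M \<in> matrix_commutant n \<S>" "K \<in> matrix_commutant n \<S>"
  shows "M - K \<in> matrix_commutant n \<S>"
proof (rule matrix_commutantI)
  note carrier = matrix_commutantD(1)[OF assms(2)] matrix_commutantD(1)[OF assms(3)]
  show "M - K \<in> carrier_mat n n" using carrier by simp
  fix A assume A: "A \<in> \<S>"
  then have "A \<in> carrier_mat n n" using assms(1) by blast
  then show "(M - K) * A = A * (M - K)"
    using carrier matrix_commutantD(2)[OF assms(2) A] matrix_commutantD(2)[OF assms(3) A]
    by (simp add: mult_mat_minus_distrib)
qed

lemma mult_in_matrix_commutant:
  assumes "\<S> \<subseteq> carrier_mat n n" "M \<in> matrix_commutant n \<S>" "K \<in> matrix_commutant n \<S>"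
  shows "M * K \<in> matrix_commutant n \<S>"
proof (rule matrix_commutantI)
  note carrier = matrix_commutantD(1)[OF assms(2)] matrix_commutantD(1)[OF assms(3)]
  show "M * K \<in> carrier_mat n n" using carrier by simp
  fix A assume A: "A \<in> \<S>"
  then have dim: "dim_row A = n" "dim_col A = n" using assms(1) by auto
  have "M * K * A = M * (A * K)"
    using carrier dim matrix_commutantD(2)[OF assms(3) A] by (simp add: mult_mat_assoc)
  also have "\<dots> = A * M * K"
    using carrier dim matrix_commutantD(2)[OF assms(2) A] by (subst mult_mat_assoc[symmetric]) auto
  also have "\<dots> = A * (M * K)" using carrier dim by (simp add: mult_mat_assoc)
  finally show "M * K * A = A * (M * K)" .
qed

lemma adjoint_in_matrix_commutant:
  assumes "\<S> \<subseteq> carrier_mat n n" "\<And>A. A \<in> \<S> \<Longrightarrow> mat_adjoint A \<in> \<S>" "M \<in> matrix_commutant n \<S>"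
  shows "mat_adjoint M \<in> matrix_commutant n \<S>"
proof (rule matrix_commutantI)
  note M = matrix_commutantD[OF assms(3)]
  show "mat_adjoint M \<in> carrier_mat n n" using M(1) by simp
  fix A assume A: "A \<in> \<S>"
  then have "A \<in> carrier_mat n n" using assms(1) by blast
  then have "mat_adjoint M * A = mat_adjoint (mat_adjoint A * M)"
    using M(1) by (simp add: mat_adjoint_mult)
  also have "mat_adjoint A * M = M * mat_adjoint A" using M(2)[OF assms(2)[OF A]] by simp
  also have "mat_adjoint \<dots> = A * mat_adjoint M"
    using M(1) \<open>A \<in> carrier_mat n n\<close> by (simp add: mat_adjoint_mult)
  finally show "mat_adjoint M * A = A * mat_adjoint M" .
qed

definition trace_expectation :: "nat \<Rightarrow> complex mat set \<Rightarrow> complex mat \<Rightarrow> complex mat \<Rightarrow> bool" where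
  "trace_expectation n \<V> A A' \<longleftrightarrow> A' \<in> matrix_commutant n \<V>
     \<and> (\<forall>S\<in>matrix_commutant n \<V>. mtrace (A' * S) = mtrace (A * S))"

subsection \<open>A variational parallel sum\<close>

definition parallel_form :: "real \<Rightarrow> complex mat \<Rightarrow> complex mat \<Rightarrow> complex mat \<Rightarrow> real" where
  "parallel_form t A B X = Re (mtrace (A * (X * mat_adjoint X)))
     + t * Re (mtrace (B * (mat_adjoint (1\<^sub>m (dim_row A) - X) * (1\<^sub>m (dim_row A) - X))))"

definition parallel_sum :: "real \<Rightarrow> complex mat \<Rightarrow> complex mat \<Rightarrow> real" where
  "parallel_sum t A B = (INF X \<in> carrier_mat (dim_row A) (dim_row A). parallel_form t A B X)"

lemma parallel_form_nonneg:
  assumes A: "psd n A" and B: "psd n B" and t: "0 \<le> t" and X: "X \<in> carrier_mat n n"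
  shows "0 \<le> parallel_form t A B X"
proof -
  have "psd n (mat_adjoint (1\<^sub>m n - X) * (1\<^sub>m n - X))"
    using psd_gram[of "mat_adjoint (1\<^sub>m n - X)" n n] X by simp
  then show ?thesis
    using mtrace_psd_mult_nonneg[OF A psd_gram[OF X]] mtrace_psd_mult_nonneg[OF B] t psd_carrier[OF A]
    by (simp add: parallel_form_def)
qed

lemma parallel_sum_le_form:
  assumes "psd n A" "psd n B" "0 \<le> t" "X \<in> carrier_mat n n"
  shows "parallel_sum t A B \<le> parallel_form t A B X"
proof -
  have "bdd_below (parallel_form t A B ` carrier_mat n n)"
    using parallel_form_nonneg[OF assms(1-3)] by (auto intro!: bdd_belowI[of _ 0])
  then show ?thesis
    unfolding parallel_sum_def using psd_carrier[OF assms(1)] assms(4) by (auto intro: cINF_lower)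
qed

lemma parallel_form_unitary_diag:
  assumes U: "unitary n U" and V: "unitary n V" and X: "X \<in> carrier_mat n n"
  shows "parallel_form t (unitary_diag n U p) (unitary_diag n V q) X = (\<Sum>i<n. \<Sum>j<n.
     p i * (cmod ((mat_adjoint U * X * V) $$ (i,j)))\<^sup>2
     + t * q j * (cmod ((mat_adjoint U * V) $$ (i,j) - (mat_adjoint U * X * V) $$ (i,j)))\<^sup>2)"
proof -
  note u = unitaryD[OF U] and v = unitaryD[OF V]
  define Z where "Z = 1\<^sub>m n - X"
  have Z: "Z \<in> carrier_mat n n" using X by (simp add: Z_def)
  have "mat_adjoint V * mat_adjoint Z * U = mat_adjoint (mat_adjoint U * V - mat_adjoint U * X * V)"
    using u v X by (simp add: Z_def mat_adjoint_mult mat_adjoint_minus mult_mat_minus_distrib mult_mat_assoc)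
  then have entry: "(mat_adjoint V * mat_adjoint Z * U) $$ (j,i)
      = cnj ((mat_adjoint U * V) $$ (i,j) - (mat_adjoint U * X * V) $$ (i,j))" if "i < n" "j < n" for i j
    using that u v X by simp
  have "Re (mtrace (unitary_diag n V q * (mat_adjoint Z * Z)))
      = (\<Sum>j<n. \<Sum>i<n. q j * (cmod ((mat_adjoint V * mat_adjoint Z * U) $$ (j,i)))\<^sup>2)"
    using mtrace_unitary_diag_mult_gram[OF V U, of "mat_adjoint Z" q] Z by simp
  also have "\<dots> = (\<Sum>i<n. \<Sum>j<n. q j
      * (cmod ((mat_adjoint U * V) $$ (i,j) - (mat_adjoint U * X * V) $$ (i,j)))\<^sup>2)"
    by (subst sum.swap, intro sum.cong refl) (simp add: entry complex_mod_cnj del: complex_cnj_diff)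
  finally show ?thesis
    using u by (simp add: parallel_form_def mtrace_unitary_diag_mult_gram[OF U V X] sum.distrib sum_distrib_left
        mult.assoc flip: Z_def)
qed

lemma weighted_square_sum_eq:
  fixes y k :: complex and p c :: real
  shows "(p + c) * (p * (cmod y)\<^sup>2 + c * (cmod (k - y))\<^sup>2)
    = p * c * (cmod k)\<^sup>2 + (cmod (complex_of_real (p + c) * y - complex_of_real c * k))\<^sup>2"
  unfolding cmod_power2 by (simp add: power2_eq_square algebra_simps)

lemma weighted_square_sum_ge:
  fixes y k :: complex
  assumes "0 \<le> p" "0 \<le> c"
  shows "(cmod k)\<^sup>2 * (p * c / (p + c)) \<le> p * (cmod y)\<^sup>2 + c * (cmod (k - y))\<^sup>2"
proof (cases "p + c = 0")
  case False
  then have "0 < p + c" using assms by simp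
  moreover have "p * c * (cmod k)\<^sup>2 \<le> (p + c) * (p * (cmod y)\<^sup>2 + c * (cmod (k - y))\<^sup>2)"
    unfolding weighted_square_sum_eq by simp
  ultimately show ?thesis by (simp add: pos_divide_le_eq mult.commute mult.assoc)
qed (use assms in simp)

lemma weighted_square_sum_minimum:
  fixes k :: complex
  assumes "0 \<le> p" "0 \<le> c"
  defines "y \<equiv> complex_of_real (c / (p + c)) * k"
  shows "p * (cmod y)\<^sup>2 + c * (cmod (k - y))\<^sup>2 = (cmod k)\<^sup>2 * (p * c / (p + c))"
proof (cases "p + c = 0")
  case False
  then have "complex_of_real (p + c) * y = complex_of_real c * k"
    unfolding y_def mult.assoc[symmetric] of_real_mult[symmetric] by simp
  then have "(p + c) * (p * (cmod y)\<^sup>2 + c * (cmod (k - y))\<^sup>2) = p * c * (cmod k)\<^sup>2"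
    unfolding weighted_square_sum_eq by simp
  then show ?thesis using False by (simp add: nonzero_eq_divide_eq mult.commute mult.assoc)
qed (use assms in simp)

abbreviation parallel_overlap :: "real \<Rightarrow> complex mat \<Rightarrow> complex mat \<Rightarrow> real" where
  "parallel_overlap t A B \<equiv> overlap_sum A B (\<lambda>x y. x * (t * y) / (x + t * y))"

lemma parallel_overlap_le_form:
  assumes A: "psd n A" and B: "psd n B" and t: "0 \<le> t" and X: "X \<in> carrier_mat n n"
  shows "parallel_overlap t A B \<le> parallel_form t A B X"
proof -
  note a = spectral_decomposition[OF A] and b = spectral_decomposition[OF B]
  note form = parallel_form_unitary_diag[OF a(1) b(1) X, of t "spectral_value A" "spectral_value B",
      unfolded a(3) b(3)]
  have dim: "dim_row A = n" "dim_row B = n" using psd_carrier[OF A] psd_carrier[OF B] by auto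
  show ?thesis
    unfolding form overlap_sum_def overlap_def dim
    by (intro sum_mono weighted_square_sum_ge mult_nonneg_nonneg t a(2) b(2))
qed

lemma parallel_form_attains_overlap:
  assumes A: "psd n A" and B: "psd n B" and t: "0 \<le> t"
  obtains X where "X \<in> matrix_commutant n (matrix_commutant n {A, B})"
    "parallel_form t A B X = parallel_overlap t A B"
proof
  note a = spectral_decomposition[OF A] and b = spectral_decomposition[OF B]
  note u = unitaryD[OF a(1)] and v = unitaryD[OF b(1)]
  define K where "K = mat_adjoint (spectral_basis A) * spectral_basis B"
  define \<phi> where "\<phi> x y = t * y / (x + t * y)" for x y :: real
  define Y where "Y = schur_multiplier (\<lambda>i j. \<phi> (spectral_value A i) (spectral_value B j)) K"
  have dim: "dim_row K = n" "dim_col K = n" "dim_row Y = n" "dim_col Y = n"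
    using u v by (simp_all add: K_def Y_def)
  let ?X = "spectral_basis A * Y * mat_adjoint (spectral_basis B)"
  show "?X \<in> matrix_commutant n (matrix_commutant n {A, B})"
  proof (rule matrix_commutantI)
    fix M assume M: "M \<in> matrix_commutant n {A, B}"
    show "?X * M = M * ?X"
      unfolding Y_def K_def
      by (rule schur_multiplier_commute[OF a(1) b(1), symmetric])
        (use matrix_commutantD[OF M] a(3) b(3) in simp_all)
  qed (use u v in simp)
  have coordinates: "mat_adjoint (spectral_basis A) * ?X * spectral_basis B = Y"
    using u v dim by (simp add: mult_mat_assoc unitary_cancel[OF a(1)])
  have X: "?X \<in> carrier_mat n n" using u v by simp
  note form = parallel_form_unitary_diag[OF a(1) b(1) X, of t "spectral_value A" "spectral_value B",
      unfolded a(3) b(3) coordinates, folded K_def]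
  have dim_AB: "dim_row A = n" "dim_row B = n" using psd_carrier[OF A] psd_carrier[OF B] by auto
  show "parallel_form t A B ?X = parallel_overlap t A B"
    unfolding form overlap_sum_def overlap_def dim_AB K_def[symmetric]
  proof (intro sum.cong refl)
    fix i j assume "i \<in> {..<n}" "j \<in> {..<n}"
    then have "Y $$ (i,j)
        = complex_of_real (t * spectral_value B j / (spectral_value A i + t * spectral_value B j)) * K $$ (i,j)"
      by (simp add: Y_def \<phi>_def dim)
    then show "spectral_value A i * (cmod (Y $$ (i,j)))\<^sup>2
        + t * spectral_value B j * (cmod (K $$ (i,j) - Y $$ (i,j)))\<^sup>2
        = (cmod (K $$ (i,j)))\<^sup>2 * (spectral_value A i * (t * spectral_value B j)
          / (spectral_value A i + t * spectral_value B j))"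
      using weighted_square_sum_minimum[OF a(2) mult_nonneg_nonneg[OF t b(2)]] by presburger
  qed
qed

lemma parallel_sum_eq_overlap:
  assumes A: "psd n A" and B: "psd n B" and t: "0 \<le> t"
  shows "parallel_sum t A B = parallel_overlap t A B"
proof -
  obtain X where X: "X \<in> matrix_commutant n (matrix_commutant n {A, B})"
    "parallel_form t A B X = parallel_overlap t A B"
    by (rule parallel_form_attains_overlap[OF assms])
  show ?thesis
    unfolding parallel_sum_def
  proof (rule cInf_eq_minimum)
    show "parallel_overlap t A B \<in> parallel_form t A B ` carrier_mat (dim_row A) (dim_row A)"
      using matrix_commutantD(1)[OF X(1)] X(2) psd_carrier[OF A] by (metis carrier_matD(1) imageI)
  qed (use parallel_overlap_le_form[OF assms] psd_carrier[OF A] in auto)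
qed

lemma parallel_sum_attained:
  assumes "psd n A" "psd n B" "0 \<le> t"
  obtains X where "X \<in> matrix_commutant n (matrix_commutant n {A, B})"
    "parallel_form t A B X = parallel_sum t A B"
  using parallel_form_attains_overlap[OF assms] unfolding parallel_sum_eq_overlap[OF assms] .

lemma parallel_sum_mono:
  assumes A: "psd n A" and B: "psd n B" and C: "psd n C" and le: "psd n (C - A)" and t: "0 \<le> t"
  shows "parallel_sum t A B \<le> parallel_sum t C B"
proof -
  obtain X where X: "X \<in> matrix_commutant n (matrix_commutant n {C, B})"
    "parallel_form t C B X = parallel_sum t C B"
    by (rule parallel_sum_attained[OF C B t])
  note carrier = matrix_commutantD(1)[OF X(1)]
  have "0 \<le> Re (mtrace ((C - A) * (X * mat_adjoint X)))"
    by (rule mtrace_psd_mult_nonneg[OF le psd_gram[OF carrier]])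
  then have "Re (mtrace (A * (X * mat_adjoint X))) \<le> Re (mtrace (C * (X * mat_adjoint X)))"
    using Re_mtrace_minus_mult(1)[OF psd_carrier[OF C] psd_carrier[OF A], of "X * mat_adjoint X"] carrier
    by simp
  then have "parallel_form t A B X \<le> parallel_form t C B X"
    using psd_carrier[OF A] psd_carrier[OF C] by (simp add: parallel_form_def)
  then show ?thesis using parallel_sum_le_form[OF A B t carrier] X(2) by simp
qed

text \<open>The minimiser for the averaged pair lies in the commutant of \<open>\<V>\<close>, where both pairs have the
  same expectations, so it competes in the minimisation for the original pair.\<close>

lemma parallel_sum_le_expectation:
  assumes A: "psd n A" and B: "psd n B" and A': "psd n A'" and B': "psd n B'" and t: "0 \<le> t"
    and \<V>: "\<V> \<subseteq> carrier_mat n n" "\<And>M. M \<in> \<V> \<Longrightarrow> mat_adjoint M \<in> \<V>"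
    and exp_A: "trace_expectation n \<V> A A'" and exp_B: "trace_expectation n \<V> B B'"
  shows "parallel_sum t A B \<le> parallel_sum t A' B'"
proof -
  obtain X where X: "X \<in> matrix_commutant n (matrix_commutant n {A', B'})"
    and min: "parallel_form t A' B' X = parallel_sum t A' B'"
    by (rule parallel_sum_attained[OF A' B' t])
  have "\<V> \<subseteq> matrix_commutant n {A', B'}"
    by (rule matrix_commutant_swap[OF _ \<V>(1)])
      (use exp_A exp_B in \<open>auto simp: trace_expectation_def\<close>)
  then have X\<V>: "X \<in> matrix_commutant n \<V>" using X matrix_commutant_antimono by blast
  let ?Z = "1\<^sub>m n - X"
  have Z\<V>: "?Z \<in> matrix_commutant n \<V>"
    by (intro minus_in_matrix_commutant one_in_matrix_commutant \<V>(1) X\<V>)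
  have "X * mat_adjoint X \<in> matrix_commutant n \<V>" "mat_adjoint ?Z * ?Z \<in> matrix_commutant n \<V>"
    using X\<V> Z\<V> by (auto intro!: mult_in_matrix_commutant adjoint_in_matrix_commutant \<V>)
  then have "parallel_form t A' B' X = parallel_form t A B X"
    using exp_A exp_B psd_carrier[OF A] psd_carrier[OF A']
    by (simp add: parallel_form_def trace_expectation_def)
  then show ?thesis
    using parallel_sum_le_form[OF A B t matrix_commutantD(1)[OF X\<V>]] min by simp
qed

lemma Re_mtrace_mult_unitary_diag_mono:
  assumes A: "psd n A" and U: "unitary n U" and le: "\<And>i. i < n \<Longrightarrow> f i \<le> g i"
  shows "Re (mtrace (A * unitary_diag n U f)) \<le> Re (mtrace (A * unitary_diag n U g))"
proof -
  have "psd n (unitary_diag n U g - unitary_diag n U f)"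
    unfolding unitary_diag_minus[OF U] using le by (intro psd_unitary_diag[OF U]) simp
  from mtrace_psd_mult_nonneg[OF A this] show ?thesis
    using Re_mtrace_minus_mult(2)[OF unitary_diag_carrier[OF U] unitary_diag_carrier[OF U] psd_carrier[OF A]]
    by simp
qed

lemma Re_mtrace_mult_unitary_diag_affine:
  assumes A: "A \<in> carrier_mat n n" and U: "unitary n U"
  shows "Re (mtrace (A * unitary_diag n U (\<lambda>i. a + b * f i)))
    = a * Re (mtrace A) + b * Re (mtrace (A * unitary_diag n U f))"
proof -
  have "mtrace A = mtrace (A * unitary_diag n U (\<lambda>_. 1))" using A by (simp add: unitary_diag_one[OF U])
  then show ?thesis
    unfolding mtrace_mult_unitary_diag[OF U A]
    by (simp add: distrib_right sum.distrib sum_distrib_left ac_simps)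
qed

lemma test_spectralE:
  assumes T: "psd n T" "psd n (1\<^sub>m n - T)"
  obtains U p where "unitary n U" "\<And>i. i < n \<Longrightarrow> 0 \<le> p i \<and> p i \<le> 1" "T = unitary_diag n U p"
proof -
  obtain U p where U: "unitary n U" and nonneg: "\<And>i. 0 \<le> p i" and T_eq: "T = unitary_diag n U p"
    using psd_spectralE[OF T(1)] by blast
  have "1\<^sub>m n - T = unitary_diag n U (\<lambda>i. 1 - p i)"
    unfolding T_eq unitary_diag_one[OF U, symmetric] unitary_diag_minus[OF U] ..
  then have "p i \<le> 1" if "i < n" for i
    using psd_unitary_diag_nonneg[OF U, of "\<lambda>i. 1 - p i" i] T(2) that by simp
  then show ?thesis using that[OF U _ T_eq] nonneg by blast
qed

text \<open>The competitor is \<open>X = 1 - x T\<close>, and \<open>T\<^sup>2 \<le> T\<close>.\<close>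

lemma parallel_sum_le_scaled_test:
  assumes A: "psd n A" and B: "psd n B" and T: "psd n T" "psd n (1\<^sub>m n - T)" and t: "0 \<le> t"
  shows "parallel_sum t A B
    \<le> Re (mtrace A) + (x\<^sup>2 - 2 * x) * Re (mtrace (A * T)) + t * (x\<^sup>2 * Re (mtrace (B * T)))"
proof -
  obtain U p where U: "unitary n U" and p: "\<And>i. i < n \<Longrightarrow> 0 \<le> p i \<and> p i \<le> 1"
    and T_eq: "T = unitary_diag n U p"
    using test_spectralE[OF T] by blast
  have sq: "x\<^sup>2 * (p i)\<^sup>2 \<le> x\<^sup>2 * p i" if "i < n" for i
    using p[OF that] by (intro mult_left_mono) (auto simp: power2_eq_square mult_left_le)
  define X where "X = unitary_diag n U (\<lambda>i. 1 - x * p i)"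
  note X = unitary_diag_carrier[OF U, of "\<lambda>i. 1 - x * p i", folded X_def]
  have compl: "1\<^sub>m n - X = unitary_diag n U (\<lambda>i. x * p i)"
    unfolding X_def unitary_diag_one[OF U, symmetric] unitary_diag_minus[OF U] by simp
  have "Re (mtrace (A * (X * mat_adjoint X)))
      \<le> Re (mtrace (A * unitary_diag n U (\<lambda>i. 1 + (x\<^sup>2 - 2 * x) * p i)))"
    unfolding X_def unitary_diag_adjoint[OF U] unitary_diag_mult[OF U]
    using sq by (intro Re_mtrace_mult_unitary_diag_mono[OF A U]) (simp add: power2_eq_square algebra_simps)
  then have A_part: "Re (mtrace (A * (X * mat_adjoint X)))
      \<le> Re (mtrace A) + (x\<^sup>2 - 2 * x) * Re (mtrace (A * T))"
    unfolding Re_mtrace_mult_unitary_diag_affine[OF psd_carrier[OF A] U] T_eq by simp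
  have "Re (mtrace (B * (mat_adjoint (1\<^sub>m n - X) * (1\<^sub>m n - X))))
      \<le> Re (mtrace (B * unitary_diag n U (\<lambda>i. 0 + x\<^sup>2 * p i)))"
    unfolding compl unitary_diag_adjoint[OF U] unitary_diag_mult[OF U]
    using sq by (intro Re_mtrace_mult_unitary_diag_mono[OF B U]) (simp add: power2_eq_square ac_simps)
  then have B_part: "Re (mtrace (B * (mat_adjoint (1\<^sub>m n - X) * (1\<^sub>m n - X)))) \<le> x\<^sup>2 * Re (mtrace (B * T))"
    unfolding Re_mtrace_mult_unitary_diag_affine[OF psd_carrier[OF B] U] T_eq by simp
  have dim: "dim_row A = n" using psd_carrier[OF A] by simp
  have "parallel_form t A B X
      \<le> Re (mtrace A) + (x\<^sup>2 - 2 * x) * Re (mtrace (A * T)) + t * (x\<^sup>2 * Re (mtrace (B * T)))"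
    unfolding parallel_form_def dim by (intro add_mono A_part mult_left_mono B_part t)
  then show ?thesis using parallel_sum_le_form[OF A B t X] by simp
qed

lemma parallel_sum_le_test:
  assumes "psd n A" "psd n B" "psd n T" "psd n (1\<^sub>m n - T)" "0 \<le> t"
  defines "a \<equiv> Re (mtrace (A * T))" and "b \<equiv> Re (mtrace (B * T))"
  shows "parallel_sum t A B \<le> Re (mtrace A) - a\<^sup>2 / (a + t * b)"
proof -
  define x where "x = a / (a + t * b)"
  have "x * (x * (a + t * b)) = x * a" unfolding x_def by (cases "a + t * b = 0") auto
  moreover have "a\<^sup>2 / (a + t * b) = x * a" by (simp add: x_def power2_eq_square)
  moreover have "parallel_sum t A B \<le> Re (mtrace A) + (x\<^sup>2 - 2 * x) * a + t * (x\<^sup>2 * b)"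
    unfolding a_def b_def by (rule parallel_sum_le_scaled_test[OF assms(1-5)])
  ultimately show ?thesis by (simp add: power2_eq_square algebra_simps)
qed

subsection \<open>An integral representation of powers\<close>

definition kernel_integral :: "real \<Rightarrow> real" where
  "kernel_integral s = (\<integral>\<tau>. exp (s * \<tau>) / (1 + exp \<tau>) \<partial>lborel)"

lemma integrable_kernel:
  fixes s :: real
  assumes "0 < s" "s < 1"
  shows "integrable lborel (\<lambda>\<tau>. exp (s * \<tau>) / (1 + exp \<tau>))"
proof -
  let ?f = "\<lambda>c \<tau>. indicator {0<..} \<tau> * exp (- (\<tau> * c)) :: real"
  have exp_tail: "integrable lborel (?f c)" if "0 < c" for c
    using integrable_I0i_exp_mscale[OF that] by (simp add: set_integrable_def)
  let ?g = "\<lambda>\<tau>. ?f (1 - s) \<tau> + ?f s (0 + (- 1) * \<tau>)"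
  have "integrable lborel ?g"
    using assms by (intro Bochner_Integration.integrable_add lborel_integrable_real_affine exp_tail) auto
  then show ?thesis
  proof (rule Bochner_Integration.integrable_bound)
    have "exp (s * \<tau>) / (1 + exp \<tau>) \<le> ?g \<tau>" if "\<tau> \<noteq> 0" for \<tau>
    proof (cases "0 < \<tau>")
      case True
      have "exp (s * \<tau>) / (1 + exp \<tau>) \<le> exp (s * \<tau>) / exp \<tau>"
        by (intro divide_left_mono) (auto intro!: mult_pos_pos add_pos_pos)
      also have "\<dots> = ?g \<tau>" using True by (simp add: algebra_simps flip: exp_diff)
      finally show ?thesis .
    next
      case False
      have "exp (s * \<tau>) / (1 + exp \<tau>) \<le> exp (s * \<tau>) / 1"
        by (intro divide_left_mono) (auto intro!: mult_pos_pos add_pos_pos)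
      also have "\<dots> = ?g \<tau>" using False that by (simp add: mult.commute)
      finally show ?thesis .
    qed
    moreover have "AE \<tau> in lborel. \<tau> \<noteq> (0 :: real)" by (rule AE_lborel_singleton)
    ultimately show "AE \<tau> in lborel. norm (exp (s * \<tau>) / (1 + exp \<tau>)) \<le> norm (?g \<tau>)"
      by (auto elim!: eventually_mono simp: abs_of_nonneg add_nonneg_nonneg)
  qed simp
qed

lemma kernel_integral_pos:
  assumes "0 < s" "s < 1"
  shows "0 < kernel_integral s"
proof -
  have pos: "0 < exp (s * \<tau>) / (1 + exp \<tau>)" for \<tau> :: real by (simp add: add_pos_pos)
  then have "0 \<le> kernel_integral s"
    unfolding kernel_integral_def by (intro Bochner_Integration.integral_nonneg less_imp_le)
  moreover have "kernel_integral s \<noteq> 0"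
  proof
    assume "kernel_integral s = 0"
    then have "AE \<tau> in lborel. exp (s * \<tau>) / (1 + exp \<tau>) = 0"
      using integral_nonneg_eq_0_iff_AE[OF integrable_kernel[OF assms]] pos
      by (simp add: kernel_integral_def less_imp_le)
    moreover have "exp (s * \<tau>) / (1 + exp \<tau>) \<noteq> 0" for \<tau> :: real using pos[of \<tau>] by linarith
    ultimately show False by (simp add: eventually_False ae_filter_eq_bot_iff)
  qed
  ultimately show ?thesis by simp
qed

text \<open>Substitute \<open>\<tau> \<mapsto> ln (x / y) + \<tau>\<close> in the kernel.\<close>

lemma powr_integral_representation:
  assumes s: "0 < s" "s < 1" and xy: "0 \<le> x" "0 \<le> y"
  shows "has_bochner_integral lborel (\<lambda>\<tau>. x * (exp \<tau> * y) / (x + exp \<tau> * y) * exp ((s - 1) * \<tau>))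
    (kernel_integral s * (x powr s * y powr (1 - s)))"
proof (cases "x = 0 \<or> y = 0")
  case False
  then have pos: "0 < x" "0 < y" using xy by auto
  define c where "c = ln (x / y)"
  have exp_c: "exp c = x / y" using pos by (simp add: c_def)
  have "has_bochner_integral lborel (\<lambda>\<tau>. (x powr s * y powr (1 - s)) * (exp (s * \<tau>) / (1 + exp \<tau>)))
      ((x powr s * y powr (1 - s)) * kernel_integral s)"
    unfolding kernel_integral_def
    by (intro has_bochner_integral_mult_right has_bochner_integral_integrable integrable_kernel s)
  moreover have "(x powr s * y powr (1 - s)) * (exp (s * \<tau>) / (1 + exp \<tau>))
      = x * (exp (c + 1 * \<tau>) * y) / (x + exp (c + 1 * \<tau>) * y) * exp ((s - 1) * (c + 1 * \<tau>))" for \<tau>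
  proof -
    have shift: "exp (c + 1 * \<tau>) * y = x * exp \<tau>" using pos by (simp add: exp_add exp_c)
    have "exp ((s - 1) * c) = x powr s * y powr (1 - s) / x"
      using pos by (simp add: c_def powr_def ln_div field_simps exp_diff exp_add)
    then have "exp ((s - 1) * (c + 1 * \<tau>)) = x powr s * y powr (1 - s) / x * (exp (s * \<tau>) / exp \<tau>)"
      by (simp add: distrib_left exp_add left_diff_distrib exp_diff)
    moreover have "x + x * exp \<tau> = x * (1 + exp \<tau>)" by (simp add: distrib_left)
    moreover have "1 + exp \<tau> \<noteq> 0" using exp_gt_zero[of \<tau>] by linarith
    ultimately show ?thesis unfolding shift using pos by simp
  qed
  ultimately show ?thesis
    by (subst lborel_has_bochner_integral_real_affine_iff[of 1 _ _ c]) (simp_all add: mult.commute)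
qed (auto simp: has_bochner_integral_zero)

lemma powr_complement_integral_representation:
  assumes s: "1 < s" "s < 2" and xy: "0 \<le> x" "0 \<le> y" "y = 0 \<Longrightarrow> x = 0"
  shows "has_bochner_integral lborel (\<lambda>\<tau>. (x - x * (exp \<tau> * y) / (x + exp \<tau> * y)) * exp ((s - 1) * \<tau>))
    (kernel_integral (s - 1) * (x powr s * y powr (1 - s)))"
proof (cases "y = 0")
  case False
  then have y: "0 < y" using xy by simp
  have integrand: "x / y * (x * (exp \<tau> * y) / (x + exp \<tau> * y) * exp ((s - 1 - 1) * \<tau>))
      = (x - x * (exp \<tau> * y) / (x + exp \<tau> * y)) * exp ((s - 1) * \<tau>)" for \<tau>
  proof -
    have denom: "x + exp \<tau> * y \<noteq> 0" using xy y by (smt (verit) exp_gt_zero mult_pos_pos)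
    have "exp ((s - 1) * \<tau>) = exp \<tau> * exp ((s - 1 - 1) * \<tau>)"
      by (simp add: algebra_simps flip: exp_add)
    then show ?thesis using denom y by (simp add: divide_simps) (simp add: algebra_simps)
  qed
  have powers: "x / y * (kernel_integral (s - 1) * (x powr (s - 1) * y powr (1 - (s - 1))))
      = kernel_integral (s - 1) * (x powr s * y powr (1 - s))"
  proof -
    have "y powr (1 - (s - 1)) = y * y powr (1 - s)" using y powr_add[of y 1 "1 - s"] by simp
    moreover have "x * x powr (s - 1) = x powr s" using xy powr_add[of x 1 "s - 1"] by (cases "x = 0") auto
    ultimately show ?thesis using y by simp
  qed
  have "has_bochner_integral lborel
      (\<lambda>\<tau>. x / y * (x * (exp \<tau> * y) / (x + exp \<tau> * y) * exp ((s - 1 - 1) * \<tau>)))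
      (x / y * (kernel_integral (s - 1) * (x powr (s - 1) * y powr (1 - (s - 1)))))"
    using s xy by (intro has_bochner_integral_mult_right powr_integral_representation) auto
  then show ?thesis unfolding integrand powers .
qed (use xy in \<open>simp add: has_bochner_integral_zero\<close>)

lemma complement_le_powr:
  fixes x y t s :: real
  assumes "0 \<le> x" "0 \<le> y" "y = 0 \<Longrightarrow> x = 0" "0 < t" "1 < s" "s < 2"
  shows "x - x * (t * y) / (x + t * y) \<le> t powr (1 - s) * (x powr s * y powr (1 - s))"
proof (cases "x = 0")
  case False
  then have x: "0 < x" and y: "0 < y" using assms by (auto simp: less_le)
  define r where "r = x / (t * y)"
  have r: "0 < r" using x y assms by (simp add: r_def)
  have "r / (r + 1) \<le> r powr (s - 1)"
  proof (cases "r \<le> 1")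
    case True
    have "r / (r + 1) \<le> r / 1" using r by (intro divide_left_mono) auto
    also have "\<dots> = r powr 1" using r by simp
    also have "\<dots> \<le> r powr (s - 1)" using r True assms by (intro powr_mono') auto
    finally show ?thesis .
  next
    case False
    have "r / (r + 1) \<le> 1" using r by simp
    also have "1 \<le> r powr (s - 1)" using False assms by (intro ge_one_powr_ge_zero) auto
    finally show ?thesis .
  qed
  then have "x * (r / (r + 1)) \<le> x * r powr (s - 1)" using x by (intro mult_left_mono) auto
  moreover have "x * (r / (r + 1)) = x - x * (t * y) / (x + t * y)"
    using x y \<open>0 < t\<close> add_pos_pos[OF x mult_pos_pos[OF \<open>0 < t\<close> y]]
    by (simp add: r_def divide_simps) (simp add: algebra_simps)
  moreover have "x * r powr (s - 1) = t powr (1 - s) * (x powr s * y powr (1 - s))"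
  proof -
    have "r powr (s - 1) = x powr (s - 1) * (t powr (1 - s) * y powr (1 - s))"
      using x y assms powr_minus_divide[of "t * y" "s - 1"] by (simp add: r_def powr_divide powr_mult)
    moreover have "x * x powr (s - 1) = x powr s" using x powr_add[of x 1 "s - 1"] by simp
    ultimately show ?thesis by (metis mult.assoc mult.left_commute)
  qed
  ultimately show ?thesis by simp
qed simp

lemma nonpos_if_le_powr_decay:
  fixes x c s :: real
  assumes "1 < s" "\<And>t. 0 < t \<Longrightarrow> x \<le> t powr (1 - s) * c"
  shows "x \<le> 0"
proof -
  have "((\<lambda>t::real. t powr (1 - s) * c) \<longlongrightarrow> 0 * c) at_top"
    using assms by (intro tendsto_intros tendsto_neg_powr filterlim_ident) auto
  then show ?thesis
    using assms(2) by (intro tendsto_lowerbound[of _ 0 at_top x])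
      (auto intro!: eventually_mono[OF eventually_gt_at_top[of "0::real"]])
qed

subsection \<open>Quasi-entropies\<close>

definition quasi_entropy :: "complex mat \<Rightarrow> complex mat \<Rightarrow> real \<Rightarrow> real" where
  "quasi_entropy A B s = Re (mtrace (mpow A s * mpow B (1 - s)))"

text \<open>For positive semidefinite matrices this says that the range of \<open>A\<close> is contained in that of \<open>B\<close>.\<close>

definition support_le :: "complex mat \<Rightarrow> complex mat \<Rightarrow> bool" where
  "support_le A B \<longleftrightarrow> Re (mtrace (A * mpow B 0)) = Re (mtrace A)"

lemma quasi_entropy_eq_overlap_sum:
  assumes "psd n A" "psd n B"
  shows "quasi_entropy A B s = overlap_sum A B (\<lambda>x y. x powr s * y powr (1 - s))"
  unfolding quasi_entropy_def by (rule Re_mtrace_mpow_mult_mpow[OF assms])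

lemma quasi_entropy_one:
  assumes "psd n A" "support_le A B"
  shows "quasi_entropy A B 1 = Re (mtrace A)"
  using assms by (simp add: quasi_entropy_def mpow_one support_le_def)

lemma support_leI:
  assumes A: "psd n A" and B: "psd n B" and le: "psd n (mpow B 0 - mpow A 0)"
  shows "support_le A B"
proof -
  note carrier = psd_carrier[OF A] psd_carrier[OF psd_mpow[OF A]] psd_carrier[OF psd_mpow[OF B]]
  have "Re (mtrace (A * mpow B 0)) \<le> Re (mtrace A)"
    using mtrace_psd_mult_nonneg[OF A psd_one_minus_support[OF B]]
      Re_mtrace_minus_mult(2)[OF one_carrier_mat carrier(3,1)] carrier(1) by simp
  moreover have "A * mpow A 0 = A" using mpow_mult[OF A, of 1 0] mpow_one[OF A] by simp
  then have "Re (mtrace A) \<le> Re (mtrace (A * mpow B 0))"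
    using mtrace_psd_mult_nonneg[OF A le] Re_mtrace_minus_mult(2)[OF carrier(3,2,1)] by simp
  ultimately show ?thesis by (simp add: support_le_def)
qed

lemma support_le_iff_overlap_support:
  assumes A: "psd n A" and B: "psd n B"
  shows "support_le A B \<longleftrightarrow> (\<forall>(x, y)\<in>overlap_support A B. y = 0 \<longrightarrow> x = 0)"
proof -
  let ?F = "\<lambda>x y. x - x * y powr 0 :: real"
  have "Re (mtrace (A * mpow B 0)) = overlap_sum A B (\<lambda>x y. x powr 1 * y powr 0)"
    using Re_mtrace_mpow_mult_mpow[OF A B, of 1 0] mpow_one[OF A] by simp
  also have "\<dots> = overlap_sum A B (\<lambda>x y. x * y powr 0)"
    using overlap_support_nonneg[OF A B] by (intro overlap_sum_cong) simp
  finally have "support_le A B \<longleftrightarrow> overlap_sum A B ?F = 0"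
    by (auto simp: support_le_def Re_mtrace_eq_overlap_sum[OF A B] overlap_sum_diff)
  also have "\<dots> \<longleftrightarrow> (\<forall>(x, y)\<in>overlap_support A B. ?F x y = 0)"
    using overlap_support_nonneg[OF A B] by (intro overlap_sum_eq_0_iff) simp
  finally show ?thesis by auto
qed

lemma support_leD:
  assumes "psd n A" "psd n B" "support_le A B" "(x, y) \<in> overlap_support A B" "y = 0"
  shows "x = 0"
  using assms support_le_iff_overlap_support[OF assms(1,2)] by auto

lemma trace_minus_parallel_sum_eq:
  assumes A: "psd n A" and B: "psd n B" and t: "0 \<le> t"
  shows "Re (mtrace A) - parallel_sum t A B = overlap_sum A B (\<lambda>x y. x - x * (t * y) / (x + t * y))"
  unfolding Re_mtrace_eq_overlap_sum[OF A B] parallel_sum_eq_overlap[OF A B t] overlap_sum_diff ..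

lemma trace_minus_parallel_sum_le:
  assumes A: "psd n A" and B: "psd n B" and supp: "support_le A B" and s: "1 < s" "s < 2" and t: "0 < t"
  shows "Re (mtrace A) - parallel_sum t A B \<le> t powr (1 - s) * quasi_entropy A B s"
  unfolding trace_minus_parallel_sum_eq[OF A B less_imp_le[OF t]] quasi_entropy_eq_overlap_sum[OF A B]
    overlap_sum_cmult[symmetric]
  using s t overlap_support_nonneg[OF A B] support_leD[OF A B supp]
  by (intro overlap_sum_mono complement_le_powr) auto

lemma has_bochner_integral_parallel_sum:
  assumes A: "psd n A" and B: "psd n B" and s: "0 < s" "s < 1"
  shows "has_bochner_integral lborel (\<lambda>\<tau>. parallel_sum (exp \<tau>) A B * exp ((s - 1) * \<tau>))
    (kernel_integral s * quasi_entropy A B s)"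
proof -
  have "has_bochner_integral lborel
      (\<lambda>\<tau>. overlap_sum A B (\<lambda>x y. exp ((s - 1) * \<tau>) * (x * (exp \<tau> * y) / (x + exp \<tau> * y))))
      (overlap_sum A B (\<lambda>x y. kernel_integral s * (x powr s * y powr (1 - s))))"
    using powr_integral_representation[OF s] overlap_support_nonneg[OF A B]
    by (intro has_bochner_integral_overlap_sum) (simp add: mult.commute)
  then show ?thesis
    by (simp only: overlap_sum_cmult parallel_sum_eq_overlap[OF A B] quasi_entropy_eq_overlap_sum[OF A B]
        exp_ge_zero mult.commute)
qed

lemma has_bochner_integral_trace_minus_parallel_sum:
  assumes A: "psd n A" and B: "psd n B" and supp: "support_le A B" and s: "1 < s" "s < 2"
  shows "has_bochner_integral lborel (\<lambda>\<tau>. (Re (mtrace A) - parallel_sum (exp \<tau>) A B) * exp ((s - 1) * \<tau>))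
    (kernel_integral (s - 1) * quasi_entropy A B s)"
proof -
  have "has_bochner_integral lborel
      (\<lambda>\<tau>. overlap_sum A B (\<lambda>x y. exp ((s - 1) * \<tau>) * (x - x * (exp \<tau> * y) / (x + exp \<tau> * y))))
      (overlap_sum A B (\<lambda>x y. kernel_integral (s - 1) * (x powr s * y powr (1 - s))))"
  proof (rule has_bochner_integral_overlap_sum)
    fix x y assume xy: "(x, y) \<in> overlap_support A B"
    show "has_bochner_integral lborel (\<lambda>\<tau>. exp ((s - 1) * \<tau>) * (x - x * (exp \<tau> * y) / (x + exp \<tau> * y)))
        (kernel_integral (s - 1) * (x powr s * y powr (1 - s)))"
      by (subst mult.commute)
        (rule powr_complement_integral_representation[OF s
            overlap_support_nonneg[OF A B xy] support_leD[OF A B supp xy]])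
  qed
  then show ?thesis
    by (simp only: overlap_sum_cmult trace_minus_parallel_sum_eq[OF A B] quasi_entropy_eq_overlap_sum[OF A B]
        exp_ge_zero mult.commute)
qed

lemma has_bochner_integral_le:
  fixes f g :: "'a \<Rightarrow> real"
  assumes "has_bochner_integral M f x" "has_bochner_integral M g y" "\<And>\<tau>. f \<tau> \<le> g \<tau>"
  shows "x \<le> y"
  using assms integral_mono[of M f g] by (simp add: has_bochner_integral_iff)

lemma quasi_entropy_mono:
  assumes A: "psd n A" "psd n B" and A': "psd m A'" "psd m B'" and s: "0 < s" "s < 1"
    and le: "\<And>t. 0 < t \<Longrightarrow> parallel_sum t A B \<le> parallel_sum t A' B'"
  shows "quasi_entropy A B s \<le> quasi_entropy A' B' s"
proof -
  have "kernel_integral s * quasi_entropy A B s \<le> kernel_integral s * quasi_entropy A' B' s"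
    by (rule has_bochner_integral_le[OF has_bochner_integral_parallel_sum[OF A s]
          has_bochner_integral_parallel_sum[OF A' s]]) (simp add: le mult_right_mono)
  then show ?thesis using kernel_integral_pos[OF s] by simp
qed

lemma parallel_sum_le_support_trace:
  assumes A: "psd n A" and B: "psd n B" and t: "0 < t"
  shows "parallel_sum t A B \<le> Re (mtrace (A * mpow B 0))"
proof -
  have "x * (t * y) / (x + t * y) \<le> x powr 1 * y powr 0" if "0 \<le> x" "0 \<le> y" for x y
  proof (cases "y = 0")
    case False
    then have "0 < x + t * y" using that t by (intro add_nonneg_pos mult_pos_pos) auto
    then show ?thesis using that t False by (simp add: pos_divide_le_eq distrib_left)
  qed simp
  then have "parallel_sum t A B \<le> overlap_sum A B (\<lambda>x y. x powr 1 * y powr 0)"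
    unfolding parallel_sum_eq_overlap[OF A B less_imp_le[OF t]]
    using overlap_support_nonneg[OF A B] by (intro overlap_sum_mono) blast
  then show ?thesis using Re_mtrace_mpow_mult_mpow[OF A B, of 1 0] mpow_one[OF A] by simp
qed

lemma support_le_if_parallel_sum_le:
  assumes A: "psd n A" "psd n B" and A': "psd m A'" "psd m B'" and supp: "support_le A B"
    and tr: "Re (mtrace A) = Re (mtrace A')"
    and le: "\<And>t. 0 < t \<Longrightarrow> parallel_sum t A B \<le> parallel_sum t A' B'"
  shows "support_le A' B'"
proof -
  let ?defect = "Re (mtrace A') - Re (mtrace (A' * mpow B' 0))"
  have "?defect \<le> t powr (1 - 3/2) * quasi_entropy A B (3/2)" if t: "0 < t" for t
    using parallel_sum_le_support_trace[OF A' t] le[OF t] tr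
      trace_minus_parallel_sum_le[OF A supp _ _ t, of "3/2"] by simp
  then have "?defect \<le> 0" by (intro nonpos_if_le_powr_decay[of "3/2"]) auto
  moreover have "0 \<le> ?defect"
    using mtrace_psd_mult_nonneg[OF A'(1) psd_one_minus_support[OF A'(2)]] psd_carrier[OF A'(1)]
      Re_mtrace_minus_mult(2)[OF one_carrier_mat psd_carrier[OF psd_mpow[OF A'(2)]] psd_carrier[OF A'(1)]]
    by simp
  ultimately show ?thesis by (simp add: support_le_def)
qed

lemma quasi_entropy_antimono:
  assumes A: "psd n A" "psd n B" and A': "psd m A'" "psd m B'" and supp: "support_le A B"
    and s: "1 < s" "s < 2" and tr: "Re (mtrace A) = Re (mtrace A')"
    and le: "\<And>t. 0 < t \<Longrightarrow> parallel_sum t A B \<le> parallel_sum t A' B'"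
  shows "quasi_entropy A' B' s \<le> quasi_entropy A B s"
proof -
  have supp': "support_le A' B'" by (rule support_le_if_parallel_sum_le[OF A A' supp tr le])
  have "kernel_integral (s - 1) * quasi_entropy A' B' s \<le> kernel_integral (s - 1) * quasi_entropy A B s"
    by (rule has_bochner_integral_le[OF has_bochner_integral_trace_minus_parallel_sum[OF A' supp' s]
          has_bochner_integral_trace_minus_parallel_sum[OF A supp s]])
      (rule mult_right_mono, simp_all add: le tr)
  then show ?thesis using kernel_integral_pos[of "s - 1"] s by simp
qed

lemma quasi_entropy_smult_right:
  assumes A: "psd n A" and B: "psd n B" and c: "0 \<le> c"
  shows "quasi_entropy A (complex_of_real c \<cdot>\<^sub>m B) s = c powr (1 - s) * quasi_entropy A B s"
  using psd_carrier[OF psd_mpow[OF A, of s]] psd_carrier[OF psd_mpow[OF B, of "1 - s"]]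
  by (simp add: quasi_entropy_def mpow_smult[OF B c] mult_mat_smult mtrace_smult)

lemma quasi_entropy_pos:
  assumes A: "psd n A" and B: "psd n B" and supp: "support_le A B" and tr: "0 < Re (mtrace A)"
  shows "0 < quasi_entropy A B s"
proof -
  have "quasi_entropy A B s \<noteq> 0"
  proof
    assume "quasi_entropy A B s = 0"
    then have "\<forall>(x, y)\<in>overlap_support A B. x powr s * y powr (1 - s) = 0"
      by (subst (asm) quasi_entropy_eq_overlap_sum[OF A B], subst (asm) overlap_sum_eq_0_iff) auto
    then have "x = 0" if "(x, y) \<in> overlap_support A B" for x y
      using that support_leD[OF A B supp that] by fastforce
    then have "overlap_sum A B (\<lambda>x y. x) = 0"
      using overlap_support_nonneg[OF A B] by (subst overlap_sum_eq_0_iff) auto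
    then show False using tr Re_mtrace_eq_overlap_sum[OF A B] by simp
  qed
  moreover have "0 \<le> quasi_entropy A B s"
    unfolding quasi_entropy_eq_overlap_sum[OF A B] by (rule overlap_sum_nonneg) simp
  ultimately show ?thesis by simp
qed

lemma overlap_sum_Hoelder:
  assumes F: "\<And>x y. (x, y) \<in> overlap_support A B \<Longrightarrow> 0 \<le> F x y" "0 < overlap_sum A B F"
    and G: "\<And>x y. (x, y) \<in> overlap_support A B \<Longrightarrow> 0 \<le> G x y" "0 < overlap_sum A B G"
    and c: "0 < c" "c < 1"
  shows "overlap_sum A B (\<lambda>x y. F x y powr (1 - c) * G x y powr c)
    \<le> overlap_sum A B F powr (1 - c) * overlap_sum A B G powr c"
proof -
  define f g where "f = overlap_sum A B F" and "g = overlap_sum A B G"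
  let ?N = "f powr (1 - c) * g powr c"
  have pos: "0 < f" "0 < g" using F(2) G(2) by (simp_all add: f_def g_def)
  have young: "F x y powr (1 - c) * G x y powr c \<le> ?N * ((1 - c) / f * F x y + c / g * G x y)"
    if xy: "(x, y) \<in> overlap_support A B" for x y
  proof (cases "F x y = 0 \<or> G x y = 0")
    case True
    then show ?thesis using F(1)[OF xy] G(1)[OF xy] c pos by auto
  next
    case False
    then have FG: "0 < F x y / f" "0 < G x y / g" using F(1)[OF xy] G(1)[OF xy] pos by auto
    have "F x y powr (1 - c) * G x y powr c = ?N * ((F x y / f) powr (1 - c) * (G x y / g) powr c)"
      using pos by (simp add: powr_divide)
    also have "\<dots> \<le> ?N * ((1 - c) * (F x y / f) + c * (G x y / g))"
      using Youngs_inequality_0[OF _ _ _ FG, of "1 - c" c] c by (intro mult_left_mono) auto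
    finally show ?thesis by simp
  qed
  have "overlap_sum A B (\<lambda>x y. F x y powr (1 - c) * G x y powr c)
      \<le> overlap_sum A B (\<lambda>x y. ?N * ((1 - c) / f * F x y + c / g * G x y))"
    by (rule overlap_sum_mono[OF young])
  also have "\<dots> = ?N"
    unfolding overlap_sum_cmult overlap_sum_add f_def[symmetric] g_def[symmetric] using pos by simp
  finally show ?thesis by (simp only: f_def g_def)
qed

lemma convex_on_ln_quasi_entropy:
  assumes A: "psd n A" and B: "psd n B" and supp: "support_le A B" and tr: "0 < Re (mtrace A)"
  shows "convex_on UNIV (\<lambda>s. ln (quasi_entropy A B s))"
proof (rule convex_onI)
  fix c x y :: real assume c: "0 < c" "c < 1"
  define z where "z = (1 - c) *\<^sub>R x + c *\<^sub>R y"
  note pos = quasi_entropy_pos[OF A B supp tr]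
  have "quasi_entropy A B z = overlap_sum A B (\<lambda>p q.
      (p powr x * q powr (1 - x)) powr (1 - c) * (p powr y * q powr (1 - y)) powr c)"
    unfolding quasi_entropy_eq_overlap_sum[OF A B]
  proof (rule overlap_sum_cong)
    fix p q :: real
    have "1 - z = (1 - x) * (1 - c) + (1 - y) * c" by (simp add: z_def algebra_simps)
    then have "p powr z * q powr (1 - z)
        = p powr (x * (1 - c)) * p powr (y * c) * (q powr ((1 - x) * (1 - c)) * q powr ((1 - y) * c))"
      unfolding powr_add[symmetric] by (simp add: z_def mult.commute add.commute)
    then show "p powr z * q powr (1 - z)
        = (p powr x * q powr (1 - x)) powr (1 - c) * (p powr y * q powr (1 - y)) powr c"
      by (simp add: powr_mult powr_powr)
  qed
  also have "\<dots> \<le> quasi_entropy A B x powr (1 - c) * quasi_entropy A B y powr c"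
    using pos c unfolding quasi_entropy_eq_overlap_sum[OF A B] by (intro overlap_sum_Hoelder) auto
  finally have "ln (quasi_entropy A B z) \<le> ln (quasi_entropy A B x powr (1 - c) * quasi_entropy A B y powr c)"
    using pos[of x] pos[of y] pos[of z] by simp
  then show "ln (quasi_entropy A B ((1 - c) *\<^sub>R x + c *\<^sub>R y))
      \<le> (1 - c) * ln (quasi_entropy A B x) + c * ln (quasi_entropy A B y)"
    using pos[of x] pos[of y] by (simp add: z_def ln_mult ln_powr)
qed simp

lemma quasi_entropy_ge_test:
  assumes A: "psd n A" and B: "psd n B" and supp: "support_le A B"
    and T: "psd n T" "psd n (1\<^sub>m n - T)" and s: "1 < s" "s < 2"
  defines "a \<equiv> Re (mtrace (A * T))" and "b \<equiv> Re (mtrace (B * T))"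
  assumes a: "0 < a"
  shows "0 < b" and "a powr s * b powr (1 - s) \<le> 2 * quasi_entropy A B s"
proof -
  have bound: "a\<^sup>2 / (a + t * b) \<le> t powr (1 - s) * quasi_entropy A B s" if "0 < t" for t
    using parallel_sum_le_test[OF A B T less_imp_le[OF that]] trace_minus_parallel_sum_le[OF A B supp s that]
    unfolding a_def b_def by linarith
  have "b \<noteq> 0"
  proof
    assume "b = 0"
    then have "a \<le> t powr (1 - s) * quasi_entropy A B s" if "0 < t" for t
      using bound[OF that] a by (simp add: power2_eq_square)
    then show False using nonpos_if_le_powr_decay[OF s(1), of a] a by fastforce
  qed
  moreover have "0 \<le> b" unfolding b_def by (rule mtrace_psd_mult_nonneg[OF B T(1)])
  ultimately show b: "0 < b" by simp
  have "a\<^sup>2 / (a + a / b * b) = a / 2" using a b by (simp add: power2_eq_square)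
  then have "a \<le> 2 * ((a / b) powr (1 - s) * quasi_entropy A B s)"
    using bound[of "a / b"] a b by simp
  then have "a * (a / b) powr (s - 1)
      \<le> 2 * ((a / b) powr (1 - s) * quasi_entropy A B s) * (a / b) powr (s - 1)"
    by (intro mult_right_mono) auto
  also have "\<dots> = 2 * quasi_entropy A B s * (a / b) powr ((1 - s) + (s - 1))" by (simp only: powr_add ac_simps)
  also have "\<dots> = 2 * quasi_entropy A B s" using a b by simp
  also have "a * (a / b) powr (s - 1) = a powr s * b powr (1 - s)"
    using a b powr_add[of a 1 "s - 1"] powr_minus_divide[of b "s - 1"] by (simp add: powr_divide)
  finally show "a powr s * b powr (1 - s) \<le> 2 * quasi_entropy A B s" .
qed

subsection \<open>Operator monotonicity and the Neyman--Pearson test\<close>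

theorem loewner_heinz:
  assumes A: "psd n A" and C: "psd n C" and le: "psd n (C - A)" and s: "0 < s" "s < 1"
  shows "psd n (mpow C s - mpow A s)"
proof (rule psdI_mtrace)
  note pA = psd_mpow[OF A, of s] and pC = psd_mpow[OF C, of s]
  show "mpow C s - mpow A s \<in> carrier_mat n n" using psd_carrier[OF pA] by simp
  show "mat_adjoint (mpow C s - mpow A s) = mpow C s - mpow A s"
    using psd_carrier[OF pA] psd_carrier[OF pC] psd_adjoint[OF pA] psd_adjoint[OF pC]
    by (simp add: mat_adjoint_minus)
  fix D assume D: "psd n D"
  let ?B = "mpow D (1 / (1 - s))"
  have B: "psd n ?B" by (rule psd_mpow[OF D])
  have BD: "mpow ?B (1 - s) = D" using mpow_mpow[OF D] s mpow_one[OF D] by simp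
  have "quasi_entropy A ?B s \<le> quasi_entropy C ?B s"
    by (rule quasi_entropy_mono[OF A B C B s]) (simp add: parallel_sum_mono[OF A B C le])
  then show "0 \<le> Re (mtrace ((mpow C s - mpow A s) * D))"
    using Re_mtrace_minus_mult(1)[OF psd_carrier[OF pC] psd_carrier[OF pA] psd_carrier[OF D]]
    by (simp add: quasi_entropy_def BD)
qed

text \<open>Ozawa's proof of the inequality of Audenaert et al.: \<open>C = B + P = A + M\<close> dominates both \<open>A\<close>
  and \<open>B\<close>, and operator monotonicity is applied three times.\<close>

theorem audenaert_inequality:
  assumes A: "psd n A" and B: "psd n B" and s: "0 < s" "s < 1"
    and P: "psd n P" and M: "psd n M" and jordan: "A - B = P - M"
  shows "Re (mtrace A) - Re (mtrace P) \<le> quasi_entropy A B s"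
proof -
  note carrier = psd_carrier[OF A] psd_carrier[OF B] psd_carrier[OF P] psd_carrier[OF M]
  define C where "C = B + P"
  have C: "psd n C" unfolding C_def by (rule psd_add[OF B P])
  have CB: "psd n (C - B)"
  proof -
    have "C - B = P" unfolding C_def using carrier by (intro eq_matI) auto
    then show ?thesis using P by simp
  qed
  have CA: "psd n (C - A)"
  proof -
    have "C - A = M"
    proof (rule eq_matI)
      fix i j assume "i < dim_row M" "j < dim_col M"
      then show "(C - A) $$ (i,j) = M $$ (i,j)"
        using arg_cong[OF jordan, of "\<lambda>X. X $$ (i,j)"] carrier by (simp add: C_def algebra_simps)
    qed (use carrier in auto)
    then show ?thesis using M by simp
  qed
  define r where "r = 1 - s"
  have r: "0 < r" "r < 1" using s by (auto simp: r_def)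
  have split: "mpow X s * mpow X r = X" if "psd n X" for X
    using mpow_mult[OF that, of s r] mpow_one[OF that] by (simp add: r_def)
  have "0 \<le> Re (mtrace (mpow A s * (mpow C r - mpow A r)))"
    by (rule mtrace_psd_mult_nonneg[OF psd_mpow[OF A] loewner_heinz[OF A C CA r]])
  moreover have "0 \<le> Re (mtrace ((mpow C s - mpow A s) * (mpow C r - mpow B r)))"
    by (rule mtrace_psd_mult_nonneg[OF loewner_heinz[OF A C CA s] loewner_heinz[OF B C CB r]])
  moreover have "0 \<le> Re (mtrace ((mpow C s - mpow B s) * mpow B r))"
    by (rule mtrace_psd_mult_nonneg[OF loewner_heinz[OF B C CB s] psd_mpow[OF B]])
  moreover have "Re (mtrace C) = Re (mtrace B) + Re (mtrace P)"
    unfolding C_def using carrier by (simp add: mtrace_add)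
  moreover have "mpow X a \<in> carrier_mat n n" if "psd n X" for X a
    by (rule psd_carrier[OF psd_mpow[OF that]])
  ultimately show ?thesis
    by (simp add: Re_mtrace_minus_mult[of _ n] split A B C quasi_entropy_def flip: r_def)
qed

theorem neyman_pearson_test:
  assumes A: "psd n A" and B: "psd n B" and s: "0 < s" "s < 1"
  obtains T where "psd n T" "psd n (1\<^sub>m n - T)" "T \<in> matrix_commutant n (matrix_commutant n {A, B})"
    "Re (mtrace (A * (1\<^sub>m n - T))) + Re (mtrace (B * T)) \<le> quasi_entropy A B s"
proof -
  note carrier = psd_carrier[OF A] psd_carrier[OF B]
  obtain U h where U: "unitary n U" and diag: "A - B = unitary_diag n U h"
    using hermitian_unitary_diag[of "A - B" n] carrier psd_adjoint[OF A] psd_adjoint[OF B]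
    by (auto simp: mat_adjoint_minus)
  define T where "T = unitary_diag n U (\<lambda>i. if h i > 0 then 1 else 0)"
  define P where "P = unitary_diag n U (\<lambda>i. max (h i) 0)"
  define M where "M = unitary_diag n U (\<lambda>i. max (- h i) 0)"
  have T: "psd n T" unfolding T_def by (rule psd_unitary_diag[OF U]) simp
  have compl: "psd n (1\<^sub>m n - T)"
    unfolding T_def unitary_diag_one[OF U, symmetric] unitary_diag_minus[OF U]
    by (rule psd_unitary_diag[OF U]) simp
  have "A - B = P - M"
    unfolding diag P_def M_def unitary_diag_minus[OF U] by (rule unitary_diag_cong) simp
  then have "Re (mtrace A) - Re (mtrace P) \<le> quasi_entropy A B s"
    by (intro audenaert_inequality[OF A B s]) (simp_all add: P_def M_def psd_unitary_diag[OF U])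
  moreover have "(A - B) * T = P"
    unfolding diag P_def T_def unitary_diag_mult[OF U] by (rule unitary_diag_cong) simp
  then have "Re (mtrace P) = Re (mtrace (A * T)) - Re (mtrace (B * T))"
    using Re_mtrace_minus_mult(1)[OF carrier psd_carrier[OF T]] by simp
  moreover have "Re (mtrace (A * (1\<^sub>m n - T))) = Re (mtrace A) - Re (mtrace (A * T))"
    using Re_mtrace_minus_mult(2)[OF one_carrier_mat psd_carrier[OF T] carrier(1)] carrier by simp
  ultimately have errors: "Re (mtrace (A * (1\<^sub>m n - T))) + Re (mtrace (B * T)) \<le> quasi_entropy A B s"
    by simp
  have "T * K = K * T" if "K \<in> matrix_commutant n {A, B}" for K
  proof -
    note K = matrix_commutantD[OF that]
    have "K * (A - B) = (A - B) * K"
      using K carrier by (simp add: mult_mat_minus_distrib)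
    then show ?thesis
      unfolding T_def diag
      by (rule unitary_diag_intertwiner_function[OF U U K(1), of h h "\<lambda>x. if x > 0 then 1 else 0", symmetric])
  qed
  then have "T \<in> matrix_commutant n (matrix_commutant n {A, B})"
    by (intro matrix_commutantI psd_carrier[OF T])
  with T compl errors show ?thesis using that by blast
qed

subsection \<open>Kronecker products\<close>

lemma sum_lessThan_mult:
  fixes f :: "nat \<Rightarrow> 'a::comm_monoid_add"
  shows "(\<Sum>i<a * b. f i) = (\<Sum>i<a. \<Sum>j<b. f (i * b + j))"
proof -
  have "(\<Sum>i<a * b. f i) = (\<Sum>i<a. sum f {i * b..<i * b + b})" by (simp add: sum.nat_group)
  also have "\<dots> = (\<Sum>i<a. \<Sum>j<b. f (i * b + j))"
    by (simp add: sum.atLeastLessThan_shift_0[of f] lessThan_atLeast0 add.commute)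
  finally show ?thesis .
qed

lemma mult_add_less:
  fixes i k a b :: nat
  assumes "i < a" "k < b"
  shows "i * b + k < a * b"
proof -
  have "i * b + k < Suc i * b" using assms by simp
  also have "\<dots> \<le> a * b" using assms by (intro mult_le_mono1) simp
  finally show ?thesis .
qed

lemma mult_add_eq_iff:
  fixes i j k l b :: nat
  assumes "k < b" "l < b"
  shows "i * b + k = j * b + l \<longleftrightarrow> i = j \<and> k = l"
proof
  assume "i * b + k = j * b + l"
  then have "(i * b + k) div b = (j * b + l) div b" "(i * b + k) mod b = (j * b + l) mod b" by auto
  then show "i = j \<and> k = l" using assms by simp
qed simp

lemma less_multE:
  fixes x a b :: nat
  assumes "x < a * b"
  obtains i k where "x = i * b + k" "i < a" "k < b"
proof -
  have "0 < b" using assms by (cases b) auto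
  then show ?thesis using assms that[of "x div b" "x mod b"] by (simp add: less_mult_imp_div_less)
qed

lemma dim_kron [simp]:
  "dim_row (kron A B) = dim_row A * dim_row B" "dim_col (kron A B) = dim_col A * dim_col B"
  by (simp_all add: kron_def)

lemma kron_carrier [simp]:
  "A \<in> carrier_mat a c \<Longrightarrow> B \<in> carrier_mat b d \<Longrightarrow> kron A B \<in> carrier_mat (a * b) (c * d)"
  by (intro carrier_matI) auto

lemma index_kron:
  assumes "A \<in> carrier_mat a c" "B \<in> carrier_mat b d" "i < a" "k < b" "j < c" "l < d"
  shows "kron A B $$ (i * b + k, j * d + l) = A $$ (i,j) * B $$ (k,l)"
  using assms by (simp add: kron_def mult_add_less)

lemma eq_kronI:
  assumes "X \<in> carrier_mat (a * b) (c * d)" "Y \<in> carrier_mat (a * b) (c * d)"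
    and "\<And>i k j l. i < a \<Longrightarrow> k < b \<Longrightarrow> j < c \<Longrightarrow> l < d
      \<Longrightarrow> X $$ (i * b + k, j * d + l) = Y $$ (i * b + k, j * d + l)"
  shows "X = Y"
proof (rule eq_matI)
  fix x y assume "x < dim_row Y" "y < dim_col Y"
  then have "x < a * b" "y < c * d" using assms(2) by auto
  then show "X $$ (x,y) = Y $$ (x,y)" using assms(3) by (elim less_multE) auto
qed (use assms in auto)

lemma kron_mult:
  assumes A: "A \<in> carrier_mat a b" "C \<in> carrier_mat b c"
    and B: "B \<in> carrier_mat a' b'" "D \<in> carrier_mat b' c'"
  shows "kron A B * kron C D = kron (A * C) (B * D)"
proof (rule eq_kronI[of _ a a' c c'])
  fix i k j l assume ij: "i < a" "k < a'" "j < c" "l < c'"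
  have "(kron A B * kron C D) $$ (i * a' + k, j * c' + l)
      = (\<Sum>x<b * b'. kron A B $$ (i * a' + k, x) * kron C D $$ (x, j * c' + l))"
    using A B ij by (simp add: index_mult_mat_sum mult_add_less)
  also have "\<dots> = (\<Sum>x<b. \<Sum>y<b'. (A $$ (i,x) * B $$ (k,y)) * (C $$ (x,j) * D $$ (y,l)))"
    unfolding sum_lessThan_mult using ij by (simp add: index_kron[OF A(1) B(1)] index_kron[OF A(2) B(2)])
  also have "\<dots> = (A * C) $$ (i,j) * (B * D) $$ (k,l)"
    using A B ij by (simp add: index_mult_mat_sum sum_product ac_simps)
  also have "\<dots> = kron (A * C) (B * D) $$ (i * a' + k, j * c' + l)"
    using A B ij by (simp add: index_kron[of _ a c _ a' c'])
  finally show "(kron A B * kron C D) $$ (i * a' + k, j * c' + l)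
      = kron (A * C) (B * D) $$ (i * a' + k, j * c' + l)" .
qed (use A B in auto)

lemma kron_adjoint: "mat_adjoint (kron A B) = kron (mat_adjoint A) (mat_adjoint B)"
  by (rule eq_kronI[of _ "dim_col A" "dim_col B" "dim_row A" "dim_row B"])
    (auto simp: mult_add_less
      index_kron[of "mat_adjoint A" "dim_col A" "dim_row A" "mat_adjoint B" "dim_col B" "dim_row B"]
      index_kron[of A "dim_row A" "dim_col A" B "dim_row B" "dim_col B"])

lemma div_mod_mult:
  fixes x b c :: nat
  shows "x div (b * c) = x div c div b" and "x mod (b * c) mod c = x mod c"
    and "0 < c \<Longrightarrow> x mod (b * c) div c = x div c mod b"
  using div_mult2_eq[of x c b] mod_mult2_eq[of x c b] by (simp_all add: mult.commute mod_mod_cancel)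

lemma kron_assoc: "kron (kron A B) C = kron A (kron B C)"
proof (rule eq_matI)
  fix x y assume xy: "x < dim_row (kron A (kron B C))" "y < dim_col (kron A (kron B C))"
  then have pos: "0 < dim_row B * dim_row C" "0 < dim_col B * dim_col C" by (auto intro!: gr0I)
  have "x div dim_row C < dim_row A * dim_row B" "y div dim_col C < dim_col A * dim_col B"
    using xy by (auto intro!: less_mult_imp_div_less simp: mult.assoc)
  then show "kron (kron A B) C $$ (x, y) = kron A (kron B C) $$ (x, y)"
    using xy pos by (simp add: kron_def mult.assoc div_mod_mult)
qed (simp_all add: mult.assoc)

lemma kron_one_right: "kron A (1\<^sub>m 1) = A"
  by (rule eq_matI) (auto simp: kron_def)

lemma kron_mat_diag:
  "kron (mat_diag a f) (mat_diag b g) = mat_diag (a * b) (\<lambda>i. f (i div b) * g (i mod b))"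
  by (rule eq_kronI[of _ a b a b])
    (auto simp: index_kron[of _ a a _ b b] mult_add_less mult_add_eq_iff mat_diag_def)

lemma kron_one: "kron (1\<^sub>m a) (1\<^sub>m b) = 1\<^sub>m (a * b)"
  using kron_mat_diag[of a "\<lambda>_. 1" b "\<lambda>_. 1"] by simp

lemma unitary_kron:
  assumes "unitary a U" "unitary b V"
  shows "unitary (a * b) (kron U V)"
  using unitaryD[OF assms(1)] unitaryD[OF assms(2)]
  by (intro unitaryI) (simp_all add: kron_adjoint kron_one kron_mult[of _ a a _ a _ b b _ b])

lemma kron_conj:
  assumes "V \<in> carrier_mat a a" "X \<in> carrier_mat a a" "W \<in> carrier_mat b b" "Y \<in> carrier_mat b b"
  shows "kron V W * kron X Y * mat_adjoint (kron V W)
    = kron (V * X * mat_adjoint V) (W * Y * mat_adjoint W)"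
  using assms by (simp add: kron_adjoint kron_mult[of _ a a _ a _ b b _ b])

lemma unitary_diag_kron:
  assumes "unitary a U" "unitary b V"
  shows "kron (unitary_diag a U f) (unitary_diag b V g)
    = unitary_diag (a * b) (kron U V) (\<lambda>i. f (i div b) * g (i mod b))"
proof -
  have "real_diag (a * b) (\<lambda>i. f (i div b) * g (i mod b)) = kron (real_diag a f) (real_diag b g)"
    by (simp add: kron_mat_diag)
  then show ?thesis
    unfolding unitary_diag_def kron_adjoint using unitaryD[OF assms(1)] unitaryD[OF assms(2)]
    by (simp add: kron_mult[of _ a a _ a _ b b _ b])
qed

lemma psd_kron:
  assumes "psd a A" "psd b B"
  shows "psd (a * b) (kron A B)"
proof -
  obtain U p where U: "unitary a U" "\<And>i. 0 \<le> p i" "A = unitary_diag a U p"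
    using psd_spectralE[OF assms(1)] by blast
  obtain V q where V: "unitary b V" "\<And>i. 0 \<le> q i" "B = unitary_diag b V q"
    using psd_spectralE[OF assms(2)] by blast
  show ?thesis
    unfolding U(3) V(3) unitary_diag_kron[OF U(1) V(1)]
    using U V by (simp add: psd_unitary_diag unitary_kron)
qed

lemma mpow_kron:
  assumes "psd a A" "psd b B"
  shows "mpow (kron A B) s = kron (mpow A s) (mpow B s)"
proof -
  obtain U p where U: "unitary a U" "\<And>i. 0 \<le> p i" "A = unitary_diag a U p"
    using psd_spectralE[OF assms(1)] by blast
  obtain V q where V: "unitary b V" "\<And>i. 0 \<le> q i" "B = unitary_diag b V q"
    using psd_spectralE[OF assms(2)] by blast
  then show ?thesis
    using U by (simp add: unitary_diag_kron mpow_unitary_diag unitary_kron powr_mult)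
qed

lemma mtrace_kron:
  assumes "A \<in> carrier_mat a a" "B \<in> carrier_mat b b"
  shows "mtrace (kron A B) = mtrace A * mtrace B"
  using assms by (simp add: mtrace_def sum_lessThan_mult index_kron[OF assms] sum_product)

lemma Re_mtrace_kron_mult:
  assumes "psd a A" "psd a C" "psd b B" "psd b D"
  shows "Re (mtrace (kron A B * kron C D)) = Re (mtrace (A * C)) * Re (mtrace (B * D))"
proof -
  note carrier = assms[THEN psd_carrier]
  have "mtrace (kron A B * kron C D) = mtrace (A * C) * mtrace (B * D)"
    using carrier by (simp add: kron_mult[of _ a a _ a _ b b _ b] mtrace_kron[of _ a _ b])
  also have "\<dots> = complex_of_real (Re (mtrace (A * C)) * Re (mtrace (B * D)))"
    using mtrace_psd_mult_real[OF assms(1,2)] mtrace_psd_mult_real[OF assms(3,4)] by simp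
  finally show ?thesis by simp
qed

lemma quasi_entropy_kron:
  assumes "psd a A" "psd a C" "psd b B" "psd b D"
  shows "quasi_entropy (kron A B) (kron C D) s = quasi_entropy A C s * quasi_entropy B D s"
  unfolding quasi_entropy_def mpow_kron[OF assms(1,3)] mpow_kron[OF assms(2,4)]
  by (rule Re_mtrace_kron_mult[OF psd_mpow[OF assms(1)] psd_mpow[OF assms(2)]
        psd_mpow[OF assms(3)] psd_mpow[OF assms(4)]])

lemma support_le_kron:
  assumes psd: "psd a A" "psd a C" "psd b B" "psd b D" and supp: "support_le A C" "support_le B D"
  shows "support_le (kron A B) (kron C D)"
proof -
  have "Re (mtrace (kron A B)) = Re (mtrace A) * Re (mtrace B)"
    using Re_mtrace_kron_mult[OF psd(1) psd_one psd(3) psd_one] psd(1,3)[THEN psd_carrier]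
    by (simp add: kron_one)
  then show ?thesis
    using supp Re_mtrace_kron_mult[OF psd(1) psd_mpow[OF psd(2)] psd(3) psd_mpow[OF psd(4)]]
    by (simp add: support_le_def mpow_kron[OF psd(2,4)])
qed

lemma mtrace_kron_mult:
  assumes A: "A \<in> carrier_mat a a" and B: "B \<in> carrier_mat b b" and S: "S \<in> carrier_mat (a * b) (a * b)"
  shows "mtrace (kron A B * S)
    = (\<Sum>i<a. \<Sum>k<b. \<Sum>j<a. \<Sum>l<b. A $$ (i,j) * B $$ (k,l) * S $$ (j * b + l, i * b + k))"
  using assms by (simp add: mtrace_mult_sum sum_lessThan_mult index_kron[OF A B])

lemma partial_trace_left:
  assumes B: "B \<in> carrier_mat b b" and S: "S \<in> carrier_mat (a * b) (a * b)"
  obtains R where "R \<in> carrier_mat a a"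
    "\<And>A. A \<in> carrier_mat a a \<Longrightarrow> mtrace (kron A B * S) = mtrace (A * R)"
proof
  let ?R = "mat a a (\<lambda>(j,i). \<Sum>k<b. \<Sum>l<b. B $$ (k,l) * S $$ (j * b + l, i * b + k))"
  show "?R \<in> carrier_mat a a" by simp
  show "mtrace (kron A B * S) = mtrace (A * ?R)" if A: "A \<in> carrier_mat a a" for A
  proof -
    have "mtrace (kron A B * S)
        = (\<Sum>i<a. \<Sum>j<a. \<Sum>k<b. \<Sum>l<b. A $$ (i,j) * B $$ (k,l) * S $$ (j * b + l, i * b + k))"
      unfolding mtrace_kron_mult[OF A B S] by (intro sum.cong refl sum.swap)
    then show ?thesis using A by (simp add: mtrace_mult_sum sum_distrib_left mult.assoc)
  qed
qed

lemma partial_trace_right: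
  assumes A: "A \<in> carrier_mat a a" and S: "S \<in> carrier_mat (a * b) (a * b)"
  obtains R where "R \<in> carrier_mat b b"
    "\<And>B. B \<in> carrier_mat b b \<Longrightarrow> mtrace (kron A B * S) = mtrace (B * R)"
proof
  let ?R = "mat b b (\<lambda>(l,k). \<Sum>i<a. \<Sum>j<a. A $$ (i,j) * S $$ (j * b + l, i * b + k))"
  show "?R \<in> carrier_mat b b" by simp
  show "mtrace (kron A B * S) = mtrace (B * ?R)" if B: "B \<in> carrier_mat b b" for B
  proof -
    let ?s = "\<lambda>i j k l. A $$ (i,j) * B $$ (k,l) * S $$ (j * b + l, i * b + k)"
    have "mtrace (kron A B * S) = (\<Sum>k<b. \<Sum>i<a. \<Sum>j<a. \<Sum>l<b. ?s i j k l)"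
      unfolding mtrace_kron_mult[OF A B S] by (rule sum.swap)
    also have "\<dots> = (\<Sum>k<b. \<Sum>i<a. \<Sum>l<b. \<Sum>j<a. ?s i j k l)" by (intro sum.cong refl sum.swap)
    also have "\<dots> = (\<Sum>k<b. \<Sum>l<b. \<Sum>i<a. \<Sum>j<a. ?s i j k l)" by (intro sum.cong refl sum.swap)
    also have "\<dots> = mtrace (B * ?R)"
      using B by (simp add: mtrace_mult_sum sum_distrib_left mult.assoc mult.left_commute)
    finally show ?thesis .
  qed
qed

subsection \<open>Tensor powers\<close>

lemma tpow_carrier [simp]: "A \<in> carrier_mat d d \<Longrightarrow> tpow A n \<in> carrier_mat (d ^ n) (d ^ n)"
proof (induction n)
  case (Suc n)
  then show ?case using kron_carrier[of "tpow A n" "d ^ n" "d ^ n" A d d] by (simp add: mult.commute)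
qed simp

lemma tpow_add: "tpow A (m + n) = kron (tpow A m) (tpow A n)"
  by (induction n) (simp_all add: kron_one_right[simplified] kron_assoc)

lemma tpow_mult:
  assumes "A \<in> carrier_mat d d" "B \<in> carrier_mat d d"
  shows "tpow (A * B) n = tpow A n * tpow B n"
proof (induction n)
  case (Suc n)
  then show ?case using assms by (simp add: kron_mult[of _ "d ^ n" "d ^ n" _ "d ^ n" _ d d _ d])
qed simp

lemma tpow_one: "tpow (1\<^sub>m d) n = 1\<^sub>m (d ^ n)"
  by (induction n) (simp_all add: kron_one mult.commute)

lemma unitary_tpow: "unitary d U \<Longrightarrow> unitary (d ^ n) (tpow U n)"
proof (induction n)
  case (Suc n)
  then show ?case using unitary_kron[of "d ^ n" "tpow U n" d U] by (simp add: mult.commute)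
qed simp

lemma psd_tpow: "psd d A \<Longrightarrow> psd (d ^ n) (tpow A n)"
proof (induction n)
  case (Suc n)
  then show ?case using psd_kron[of "d ^ n" "tpow A n" d A] by (simp add: mult.commute)
qed (simp add: psd_one)

lemma mtrace_tpow: "A \<in> carrier_mat d d \<Longrightarrow> mtrace (tpow A n) = mtrace A ^ n"
proof (induction n)
  case (Suc n)
  then show ?case using mtrace_kron[of "tpow A n" "d ^ n" A d] by simp
qed (simp add: mtrace_def)

lemma quasi_entropy_tpow:
  assumes "psd d A" "psd d B"
  shows "quasi_entropy (tpow A n) (tpow B n) s = quasi_entropy A B s ^ n"
proof (induction n)
  case (Suc n)
  then show ?case using quasi_entropy_kron[OF psd_tpow psd_tpow assms] assms by simp
qed (simp add: quasi_entropy_def mpow_one_mat mtrace_def)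

lemma support_le_tpow:
  assumes "psd d A" "psd d B" "support_le A B"
  shows "support_le (tpow A n) (tpow B n)"
proof (induction n)
  case (Suc n)
  then show ?case using support_le_kron[OF psd_tpow psd_tpow assms(1,2) _ assms(3)] assms by simp
qed (simp add: support_le_def mpow_one_mat)

subsection \<open>Group averages\<close>

locale compact_unitary_rep =
  fixes \<mu> :: "'g::{topological_group_add,t2_space} measure" and d :: nat and u :: "'g \<Rightarrow> complex mat"
  assumes compact_UNIV: "compact (UNIV :: 'g set)"
    and haar: "haar_prob \<mu>"
    and rep: "unitary_rep d u"
begin

sublocale prob_space \<mu>
  using haar by (simp add: haar_prob_def)

lemma sets_eq: "sets \<mu> = sets borel"
  using haar by (simp add: haar_prob_def)

lemma continuous_integrable:
  fixes f :: "'g \<Rightarrow> complex"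
  assumes "continuous_on UNIV f"
  shows "integrable \<mu> f"
proof -
  have "bounded (range f)"
    by (rule compact_imp_bounded[OF compact_continuous_image[OF assms compact_UNIV]])
  then obtain B where "\<And>x. norm (f x) \<le> B" unfolding bounded_iff by auto
  moreover have "f \<in> borel_measurable \<mu>"
    using borel_measurable_continuous_onI[OF assms] measurable_cong_sets[OF sets_eq refl] by blast
  ultimately show ?thesis by (intro integrable_const_bound[of _ B]) auto
qed

lemma left_translate_measurable: "(\<lambda>x. h + x) \<in> measurable \<mu> \<mu>"
proof -
  have "continuous_on UNIV (\<lambda>x. h + x)" by (intro continuous_intros)
  then show ?thesis
    using borel_measurable_continuous_onI measurable_cong_sets[OF sets_eq sets_eq] by blast
qed

lemma distr_left_translate: "distr \<mu> \<mu> (\<lambda>x. h + x) = \<mu>"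
proof (rule measure_eqI)
  fix A assume "A \<in> sets (distr \<mu> \<mu> (\<lambda>x. h + x))"
  then have A: "A \<in> sets \<mu>" by simp
  have "emeasure (distr \<mu> \<mu> (\<lambda>x. h + x)) A = emeasure \<mu> ((\<lambda>x. h + x) -` A \<inter> space \<mu>)"
    by (rule emeasure_distr[OF left_translate_measurable A])
  also have "(\<lambda>x. h + x) -` A \<inter> space \<mu> = (\<lambda>x. - h + x) ` A"
  proof (intro Set.set_eqI iffI)
    fix x assume "x \<in> (\<lambda>x. h + x) -` A \<inter> space \<mu>"
    then show "x \<in> (\<lambda>x. - h + x) ` A"
      by (intro image_eqI[of _ _ "h + x"]) (auto simp: add.assoc[symmetric])
  qed (use sets_eq_imp_space_eq[OF sets_eq] in \<open>auto simp: add.assoc[symmetric]\<close>)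
  also have "emeasure \<mu> \<dots> = emeasure \<mu> A"
    using haar A sets_eq by (auto simp: haar_prob_def)
  finally show "emeasure (distr \<mu> \<mu> (\<lambda>x. h + x)) A = emeasure \<mu> A" .
qed simp

lemma integral_left_translate:
  fixes f :: "'g \<Rightarrow> complex"
  assumes "continuous_on UNIV f"
  shows "(\<integral>g. f (h + g) \<partial>\<mu>) = (\<integral>g. f g \<partial>\<mu>)"
  using integral_distr[OF left_translate_measurable, of f h] continuous_integrable[OF assms]
  by (simp add: distr_left_translate)

definition \<pi> :: "nat \<Rightarrow> 'g \<Rightarrow> complex mat" where
  "\<pi> n g = tpow (u g) n"

lemma unitary_\<pi>: "unitary (d ^ n) (\<pi> n g)"
  unfolding \<pi>_def using rep by (intro unitary_tpow) (simp add: unitary_rep_def)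

lemma \<pi>_carrier [simp]:
  "\<pi> n g \<in> carrier_mat (d ^ n) (d ^ n)" "dim_row (\<pi> n g) = d ^ n" "dim_col (\<pi> n g) = d ^ n"
  using unitaryD[OF unitary_\<pi>] by auto

lemma range_\<pi>: "range (\<pi> n) \<subseteq> carrier_mat (d ^ n) (d ^ n)"
  by auto

lemma \<pi>_zero: "\<pi> n 0 = 1\<^sub>m (d ^ n)"
  using rep by (simp add: \<pi>_def unitary_rep_def tpow_one)

lemma \<pi>_add: "\<pi> n (g + h) = \<pi> n g * \<pi> n h"
proof -
  have "u g \<in> carrier_mat d d" for g using rep by (auto simp: unitary_rep_def unitary_def)
  then show ?thesis using rep by (simp add: \<pi>_def unitary_rep_def tpow_mult[of _ d])
qed

lemma \<pi>_adjoint: "mat_adjoint (\<pi> n g) = \<pi> n (- g)"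
proof -
  have "\<pi> n (- g) * \<pi> n g = 1\<^sub>m (d ^ n)" by (simp add: \<pi>_zero flip: \<pi>_add)
  moreover have "\<pi> n (- g) * (\<pi> n g * mat_adjoint (\<pi> n g)) = \<pi> n (- g)"
    by (simp add: unitaryD[OF unitary_\<pi>] right_mult_one_mat[OF \<pi>_carrier(1)])
  ultimately show ?thesis by (metis \<pi>_carrier dim_mat_adjoint(1) left_mult_one_mat' mult_mat_assoc)
qed

lemma \<pi>_tensor: "\<pi> (m + n) g = kron (\<pi> m g) (\<pi> n g)"
  by (simp add: \<pi>_def tpow_add)

lemma continuous_\<pi>: "i < d ^ n \<Longrightarrow> j < d ^ n \<Longrightarrow> continuous_on UNIV (\<lambda>g. \<pi> n g $$ (i,j))"
proof (induction n arbitrary: i j)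
  case 0
  then show ?case by (simp add: \<pi>_def)
next
  case (Suc n)
  have "i < d ^ n * d" "j < d ^ n * d" using Suc.prems by (auto simp: mult.commute)
  then obtain a b a' b' where i: "i = a * d + b" "a < d ^ n" "b < d"
    and j: "j = a' * d + b'" "a' < d ^ n" "b' < d"
    by (metis less_multE)
  have "\<pi> (Suc n) g $$ (i,j) = \<pi> n g $$ (a,a') * u g $$ (b,b')" for g
  proof -
    have "u g \<in> carrier_mat d d" using rep by (auto simp: unitary_rep_def unitary_def)
    then show ?thesis
      using i(2,3) j(2,3) unfolding i(1) j(1) by (simp add: \<pi>_def index_kron[of _ "d ^ n" "d ^ n" _ d d])
  qed
  then show ?case using Suc.IH i j rep by (auto simp: unitary_rep_def intro!: continuous_intros)
qed

abbreviation E :: "nat \<Rightarrow> complex mat \<Rightarrow> complex mat" where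
  "E n X \<equiv> twirl d \<mu> u n X"

abbreviation conj_\<pi> :: "nat \<Rightarrow> 'g \<Rightarrow> complex mat \<Rightarrow> complex mat" where
  "conj_\<pi> n g X \<equiv> \<pi> n g * X * mat_adjoint (\<pi> n g)"

lemma E_carrier [simp]:
  "E n X \<in> carrier_mat (d ^ n) (d ^ n)" "dim_row (E n X) = d ^ n" "dim_col (E n X) = d ^ n"
  by (simp_all add: twirl_def)

lemma index_E: "i < d ^ n \<Longrightarrow> j < d ^ n \<Longrightarrow> E n X $$ (i,j) = (\<integral>g. conj_\<pi> n g X $$ (i,j) \<partial>\<mu>)"
  by (simp add: twirl_def \<pi>_def)

lemma continuous_conj_\<pi>:
  assumes "X \<in> carrier_mat (d ^ n) (d ^ n)" "i < d ^ n" "j < d ^ n"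
  shows "continuous_on UNIV (\<lambda>g. conj_\<pi> n g X $$ (i,j))"
proof -
  have "conj_\<pi> n g X $$ (i,j)
      = (\<Sum>l<d ^ n. (\<Sum>k<d ^ n. \<pi> n g $$ (i,k) * X $$ (k,l)) * cnj (\<pi> n g $$ (j,l)))" for g
    using assms by (subst index_mult_mat_sum) (auto simp: index_mult_mat_sum)
  then show ?thesis using assms by (auto intro!: continuous_intros continuous_\<pi>)
qed

lemma mtrace_conj_\<pi>_sum:
  assumes "X \<in> carrier_mat (d ^ n) (d ^ n)" "R \<in> carrier_mat (d ^ n) (d ^ n)"
  shows "mtrace (conj_\<pi> n g X * R) = (\<Sum>i<d ^ n. \<Sum>k<d ^ n. conj_\<pi> n g X $$ (i,k) * R $$ (k,i))"
  using assms by (subst mtrace_mult_sum) auto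

lemma continuous_mtrace_conj_\<pi>:
  assumes "X \<in> carrier_mat (d ^ n) (d ^ n)" "R \<in> carrier_mat (d ^ n) (d ^ n)"
  shows "continuous_on UNIV (\<lambda>g. mtrace (conj_\<pi> n g X * R))"
  unfolding mtrace_conj_\<pi>_sum[OF assms] using assms
  by (auto intro!: continuous_on_sum continuous_on_mult continuous_conj_\<pi> continuous_on_const)

lemma mtrace_E_mult:
  assumes X: "X \<in> carrier_mat (d ^ n) (d ^ n)" and R: "R \<in> carrier_mat (d ^ n) (d ^ n)"
  shows "mtrace (E n X * R) = (\<integral>g. mtrace (conj_\<pi> n g X * R) \<partial>\<mu>)"
proof -
  have int: "integrable \<mu> (\<lambda>g. conj_\<pi> n g X $$ (i,k) * R $$ (k,i))" if "i < d ^ n" "k < d ^ n" for i k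
    using continuous_integrable[OF continuous_conj_\<pi>[OF X that]] by simp
  have "mtrace (E n X * R) = (\<Sum>i<d ^ n. \<Sum>k<d ^ n. (\<integral>g. conj_\<pi> n g X $$ (i,k) * R $$ (k,i) \<partial>\<mu>))"
    using R by (simp add: mtrace_mult_sum index_E)
  also have "\<dots> = (\<Sum>i<d ^ n. (\<integral>g. (\<Sum>k<d ^ n. conj_\<pi> n g X $$ (i,k) * R $$ (k,i)) \<partial>\<mu>))"
    by (intro sum.cong refl Bochner_Integration.integral_sum[symmetric] int) auto
  also have "\<dots> = (\<integral>g. mtrace (conj_\<pi> n g X * R) \<partial>\<mu>)"
    unfolding mtrace_conj_\<pi>_sum[OF X R]
    by (intro Bochner_Integration.integral_sum[symmetric] Bochner_Integration.integrable_sum int) auto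
  finally show ?thesis .
qed

lemma trace_functional_E:
  assumes X: "X \<in> carrier_mat (d ^ n) (d ^ n)" and R: "R \<in> carrier_mat (d ^ n) (d ^ n)"
    and F: "\<And>A. A \<in> carrier_mat (d ^ n) (d ^ n) \<Longrightarrow> F A = mtrace (A * R)"
    and inv: "\<And>g. F (conj_\<pi> n g X) = F X"
  shows "F (E n X) = F X"
proof -
  have "mtrace (conj_\<pi> n g X * R) = F X" for g using F[of "conj_\<pi> n g X"] inv by simp
  then show ?thesis using mtrace_E_mult[OF X R] F[of "E n X"] by (simp add: prob_space)
qed

lemma mtrace_E:
  assumes "X \<in> carrier_mat (d ^ n) (d ^ n)"
  shows "mtrace (E n X) = mtrace X"
  using assms mtrace_unitary_conj[OF unitary_\<pi>]
  by (intro trace_functional_E[of X n "1\<^sub>m (d ^ n)" mtrace])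
    (simp_all add: right_mult_one_mat[of _ "d ^ n" "d ^ n"])

lemma E_invariant:
  assumes X: "X \<in> carrier_mat (d ^ n) (d ^ n)"
  shows "conj_\<pi> n h (E n X) = E n X"
proof (rule mat_eq_if_mtrace_mult_eq)
  fix R :: "complex mat" assume R: "R \<in> carrier_mat (d ^ n) (d ^ n)"
  let ?R = "mat_adjoint (\<pi> n h) * R * \<pi> n h"
  have "mtrace (conj_\<pi> n h (E n X) * R) = mtrace (E n X * ?R)"
    using R by (intro mtrace_conj_mult) simp_all
  also have "\<dots> = (\<integral>g. mtrace (conj_\<pi> n g X * ?R) \<partial>\<mu>)"
    using X R by (intro mtrace_E_mult) simp_all
  also have "\<dots> = (\<integral>g. mtrace (conj_\<pi> n (h + g) X * R) \<partial>\<mu>)"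
  proof (rule Bochner_Integration.integral_cong[OF refl])
    fix g
    have "conj_\<pi> n (h + g) X = conj_\<pi> n h (conj_\<pi> n g X)"
      using X by (simp add: \<pi>_add mat_adjoint_mult mult_mat_assoc)
    then show "mtrace (conj_\<pi> n g X * ?R) = mtrace (conj_\<pi> n (h + g) X * R)"
      using X R mtrace_conj_mult[of "\<pi> n h" "d ^ n" "conj_\<pi> n g X" R] by simp
  qed
  also have "\<dots> = (\<integral>g. mtrace (conj_\<pi> n g X * R) \<partial>\<mu>)"
    by (rule integral_left_translate[OF continuous_mtrace_conj_\<pi>[OF X R]])
  also have "\<dots> = mtrace (E n X * R)" by (rule mtrace_E_mult[OF X R, symmetric])
  finally show "mtrace (conj_\<pi> n h (E n X) * R) = mtrace (E n X * R)" .
qed simp_all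

lemma E_commute:
  assumes X: "X \<in> carrier_mat (d ^ n) (d ^ n)"
  shows "E n X * \<pi> n h = \<pi> n h * E n X"
proof -
  have "E n X * \<pi> n h = conj_\<pi> n h (E n X) * \<pi> n h" by (simp only: E_invariant[OF X])
  also have "\<dots> = \<pi> n h * E n X"
    by (simp add: mult_mat_assoc unitaryD[OF unitary_\<pi>] right_mult_one_mat[OF E_carrier(1)])
  finally show ?thesis .
qed

lemma E_adjoint:
  assumes X: "X \<in> carrier_mat (d ^ n) (d ^ n)"
  shows "mat_adjoint (E n X) = E n (mat_adjoint X)"
proof (rule mat_eq_if_mtrace_mult_eq)
  fix R :: "complex mat" assume R: "R \<in> carrier_mat (d ^ n) (d ^ n)"
  have conj: "mat_adjoint (conj_\<pi> n g X) = conj_\<pi> n g (mat_adjoint X)" for g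
    using X by (simp add: mat_adjoint_mult mult_mat_assoc)
  have "mtrace (mat_adjoint (E n X) * R) = cnj (\<integral>g. mtrace (conj_\<pi> n g X * mat_adjoint R) \<partial>\<mu>)"
    using X R by (simp add: mtrace_adjoint_mult[of _ "d ^ n"] mtrace_E_mult)
  also have "\<dots> = (\<integral>g. mtrace (mat_adjoint (conj_\<pi> n g X) * R) \<partial>\<mu>)"
    using X R by (simp add: mtrace_adjoint_mult[of _ "d ^ n"])
  also have "\<dots> = mtrace (E n (mat_adjoint X) * R)"
    unfolding conj using X R by (simp add: mtrace_E_mult)
  finally show "mtrace (mat_adjoint (E n X) * R) = mtrace (E n (mat_adjoint X) * R)" .
qed simp_all

lemma psd_E:
  assumes X: "psd (d ^ n) X"
  shows "psd (d ^ n) (E n X)"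
proof (rule psdI_mtrace)
  show "mat_adjoint (E n X) = E n X" using E_adjoint[OF psd_carrier[OF X]] psd_adjoint[OF X] by simp
  fix B assume B: "psd (d ^ n) B"
  note carrier = psd_carrier[OF X] psd_carrier[OF B]
  have "Re (mtrace (E n X * B)) = (\<integral>g. Re (mtrace (conj_\<pi> n g X * B)) \<partial>\<mu>)"
    using continuous_integrable[OF continuous_mtrace_conj_\<pi>[OF carrier]]
    by (simp add: mtrace_E_mult[OF carrier])
  also have "\<dots> \<ge> 0"
    by (intro Bochner_Integration.integral_nonneg
        mtrace_psd_mult_nonneg[OF psd_unitary_conj[OF X unitary_\<pi>] B])
  finally show "0 \<le> Re (mtrace (E n X * B))" .
qed simp

lemma trace_expectation_E:
  assumes X: "X \<in> carrier_mat (d ^ n) (d ^ n)"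
  shows "trace_expectation (d ^ n) (range (\<pi> n)) X (E n X)"
  unfolding trace_expectation_def
proof (intro conjI ballI)
  show "E n X \<in> matrix_commutant (d ^ n) (range (\<pi> n))"
    using E_commute[OF X] by (auto intro!: matrix_commutantI)
  fix S assume S: "S \<in> matrix_commutant (d ^ n) (range (\<pi> n))"
  have "mtrace (conj_\<pi> n g X * S) = mtrace (X * S)" for g
    using matrix_commutantD[OF S] by (intro mtrace_unitary_conj_mult[OF unitary_\<pi> X]) auto
  then show "mtrace (E n X * S) = mtrace (X * S)"
    using trace_functional_E[OF X matrix_commutantD(1)[OF S], of "\<lambda>A. mtrace (A * S)"] by simp
qed

lemma parallel_sum_le_E:
  assumes "psd (d ^ n) X" "psd (d ^ n) Y" "0 \<le> t"
  shows "parallel_sum t X Y \<le> parallel_sum t (E n X) (E n Y)"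
  by (rule parallel_sum_le_expectation[where \<V>="range (\<pi> n)"])
    (use assms in \<open>auto simp: \<pi>_adjoint intro: psd_E trace_expectation_E psd_carrier\<close>)

lemma mtrace_kron_E:
  assumes X: "X \<in> carrier_mat (d ^ m) (d ^ m)" and Y: "Y \<in> carrier_mat (d ^ n) (d ^ n)"
    and S: "S \<in> carrier_mat (d ^ m * d ^ n) (d ^ m * d ^ n)"
    and comm: "\<And>g h. kron (\<pi> m g) (\<pi> n h) * S = S * kron (\<pi> m g) (\<pi> n h)"
  shows "mtrace (kron (E m X) (E n Y) * S) = mtrace (kron X Y * S)"
proof -
  have inv: "mtrace (kron (conj_\<pi> m g A) (conj_\<pi> n h B) * S) = mtrace (kron A B * S)"
    if "A \<in> carrier_mat (d ^ m) (d ^ m)" "B \<in> carrier_mat (d ^ n) (d ^ n)" for A B g h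
    unfolding kron_conj[OF \<pi>_carrier(1) that(1) \<pi>_carrier(1) that(2), symmetric]
    by (rule mtrace_unitary_conj_mult[OF unitary_kron[OF unitary_\<pi> unitary_\<pi>] kron_carrier[OF that] S comm])
  have conj_zero: "conj_\<pi> k 0 A = A" if "A \<in> carrier_mat (d ^ k) (d ^ k)" for k A
    using that by (simp add: \<pi>_zero)
  obtain R where R: "R \<in> carrier_mat (d ^ m) (d ^ m)"
    "\<And>A. A \<in> carrier_mat (d ^ m) (d ^ m) \<Longrightarrow> mtrace (kron A (E n Y) * S) = mtrace (A * R)"
    using partial_trace_left[OF E_carrier(1) S] by blast
  have "mtrace (kron (E m X) (E n Y) * S) = mtrace (kron X (E n Y) * S)"
    using inv[OF X E_carrier(1), of _ 0] conj_zero[OF E_carrier(1)]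
    by (intro trace_functional_E[OF X R(1), of "\<lambda>A. mtrace (kron A (E n Y) * S)"] R(2)) simp_all
  moreover obtain Q where Q: "Q \<in> carrier_mat (d ^ n) (d ^ n)"
    "\<And>B. B \<in> carrier_mat (d ^ n) (d ^ n) \<Longrightarrow> mtrace (kron X B * S) = mtrace (B * Q)"
    using partial_trace_right[OF X S] by blast
  have "mtrace (kron X (E n Y) * S) = mtrace (kron X Y * S)"
    using inv[OF X Y, of 0] conj_zero[OF X]
    by (intro trace_functional_E[OF Y Q(1), of "\<lambda>B. mtrace (kron X B * S)"] Q(2)) simp_all
  ultimately show ?thesis by simp
qed

text \<open>The commutant of all \<open>\<pi> m g \<otimes> \<pi> n h\<close> lies in that of \<open>\<pi> (m + n)\<close>, so the product of two averages
  is an average of the joint average.\<close>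

lemma trace_expectation_kron_E:
  assumes X: "X \<in> carrier_mat (d ^ m) (d ^ m)" and Y: "Y \<in> carrier_mat (d ^ n) (d ^ n)"
  defines "\<V> \<equiv> {kron (\<pi> m g) (\<pi> n h) | g h. True}"
  shows "trace_expectation (d ^ (m + n)) \<V> (E (m + n) (kron X Y)) (kron (E m X) (E n Y))"
  unfolding trace_expectation_def
proof (intro conjI ballI)
  have kron_comm: "kron (E m X) (E n Y) * kron (\<pi> m g) (\<pi> n h) = kron (\<pi> m g) (\<pi> n h) * kron (E m X) (E n Y)"
    for g h
    using E_commute[OF X] E_commute[OF Y]
    by (simp add: kron_mult[of _ "d ^ m" "d ^ m" _ "d ^ m" _ "d ^ n" "d ^ n" _ "d ^ n"])
  then show "kron (E m X) (E n Y) \<in> matrix_commutant (d ^ (m + n)) \<V>"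
    by (intro matrix_commutantI) (auto simp: \<V>_def power_add)
  fix S assume S: "S \<in> matrix_commutant (d ^ (m + n)) \<V>"
  have comm: "kron (\<pi> m g) (\<pi> n h) * S = S * kron (\<pi> m g) (\<pi> n h)" for g h
    by (rule matrix_commutantD(2)[OF S, symmetric]) (auto simp: \<V>_def)
  have carrier: "S \<in> carrier_mat (d ^ m * d ^ n) (d ^ m * d ^ n)"
    using matrix_commutantD(1)[OF S] by (simp add: power_add)
  have "S \<in> matrix_commutant (d ^ (m + n)) (range (\<pi> (m + n)))"
    using S by (rule set_mp[OF matrix_commutant_antimono, rotated]) (auto simp: \<V>_def \<pi>_tensor)
  moreover have "kron X Y \<in> carrier_mat (d ^ (m + n)) (d ^ (m + n))" using X Y by (simp add: power_add)
  ultimately have "mtrace (E (m + n) (kron X Y) * S) = mtrace (kron X Y * S)"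
    using trace_expectation_E by (simp add: trace_expectation_def)
  moreover have "mtrace (kron (E m X) (E n Y) * S) = mtrace (kron X Y * S)"
    by (rule mtrace_kron_E[OF X Y carrier comm])
  ultimately show "mtrace (kron (E m X) (E n Y) * S) = mtrace (E (m + n) (kron X Y) * S)" by simp
qed

lemma parallel_sum_E_le_kron_E:
  assumes X: "psd (d ^ m) X" "psd (d ^ m) X'" and Y: "psd (d ^ n) Y" "psd (d ^ n) Y'" and t: "0 \<le> t"
  shows "parallel_sum t (E (m + n) (kron X Y)) (E (m + n) (kron X' Y'))
    \<le> parallel_sum t (kron (E m X) (E n Y)) (kron (E m X') (E n Y'))"
proof -
  let ?\<V> = "{kron (\<pi> m g) (\<pi> n h) | g h. True}"
  have psd_kron_E: "psd (d ^ (m + n)) (E (m + n) (kron A B))" "psd (d ^ (m + n)) (kron (E m A) (E n B))"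
    if "psd (d ^ m) A" "psd (d ^ n) B" for A B
    using psd_E[of "m + n" "kron A B"] psd_kron[OF that] psd_kron[OF psd_E[OF that(1)] psd_E[OF that(2)]]
    by (simp_all add: power_add)
  show ?thesis
  proof (rule parallel_sum_le_expectation[where \<V>="?\<V>"])
    show "?\<V> \<subseteq> carrier_mat (d ^ (m + n)) (d ^ (m + n))" by (auto simp: power_add)
    show "mat_adjoint M \<in> ?\<V>" if "M \<in> ?\<V>" for M
      using that by (force simp: kron_adjoint \<pi>_adjoint)
  qed (use X Y t psd_kron_E trace_expectation_kron_E psd_carrier in auto)
qed

end

subsection \<open>Subadditive sequences and convex functions\<close>

lemma subadditive_le_slope:
  fixes a :: "nat \<Rightarrow> real"
  assumes sub: "\<And>m n. a (m + n) \<le> a m + a n" and k: "0 < k"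
  shows "a n \<le> real n * (a k / real k) + ((\<Sum>r<k. \<bar>a r\<bar>) + \<bar>a k\<bar>)"
proof -
  have mult: "a (q * k + r) \<le> real q * a k + a r" for q r
  proof (induction q)
    case (Suc q)
    have "a (Suc q * k + r) \<le> a k + a (q * k + r)" using sub[of k "q * k + r"] by (simp add: add.assoc)
    then show ?case using Suc by (simp add: algebra_simps)
  qed simp
  define q r where "q = n div k" and "r = n mod k"
  have r: "r < k" using k by (simp add: r_def)
  have n: "n = q * k + r" by (simp add: q_def r_def)
  have "real q * a k = real n * (a k / real k) - real r / real k * a k"
    using k by (simp add: n field_simps)
  moreover have "- (real r / real k * a k) \<le> \<bar>a k\<bar>"
  proof -
    have "real r / real k * \<bar>a k\<bar> \<le> 1 * \<bar>a k\<bar>" using r by (intro mult_right_mono) auto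
    then show ?thesis using abs_ge_minus_self[of "real r / real k * a k"] by (simp add: abs_mult)
  qed
  moreover have "a r \<le> (\<Sum>r<k. \<bar>a r\<bar>)"
    using member_le_sum[of r "{..<k}" "\<lambda>r. \<bar>a r\<bar>"] r by simp
  moreover have "a n \<le> real q * a k + a r" unfolding n by (rule mult)
  ultimately show ?thesis by linarith
qed

theorem Fekete_subadditive:
  fixes a :: "nat \<Rightarrow> real"
  assumes sub: "\<And>m n. a (m + n) \<le> a m + a n" and bound: "\<And>n. - (C * real n) \<le> a n"
  shows "(\<lambda>n. a n / real n) \<longlonglongrightarrow> (INF n\<in>{0<..}. a n / real n)" (is "_ \<longlonglongrightarrow> ?L")
proof (rule order_tendstoI)
  have "bdd_below ((\<lambda>n. a n / real n) ` {0<..})"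
  proof (rule bdd_belowI2)
    show "- C \<le> a n / real n" if "n \<in> {0<..}" for n
      using that bound[of n] by (simp add: le_divide_eq)
  qed
  then have lower: "?L \<le> a n / real n" if "0 < n" for n
    using that by (intro cINF_lower) auto
  show "\<forall>\<^sub>F n in sequentially. l < a n / real n" if "l < ?L" for l
    using that lower by (intro eventually_mono[OF eventually_gt_at_top[of 0]]) (meson less_le_trans)
  fix v assume "?L < v"
  then obtain k where k: "0 < k" "a k / real k < v"
    using cInf_lessD[of "(\<lambda>n. a n / real n) ` {0<..}" v] by auto
  define M where "M = (\<Sum>r<k. \<bar>a r\<bar>) + \<bar>a k\<bar>"
  have "(\<lambda>n. a k / real k + M / real n) \<longlonglongrightarrow> a k / real k + 0"
    by (intro tendsto_intros lim_const_over_n)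
  then have "\<forall>\<^sub>F n in sequentially. a k / real k + M / real n < v"
    using k by (intro order_tendstoD(2)) auto
  then show "\<forall>\<^sub>F n in sequentially. a n / real n < v"
    using eventually_gt_at_top[of 0]
  proof eventually_elim
    case (elim n)
    have "a n / real n \<le> (real n * (a k / real k) + M) / real n"
      using subadditive_le_slope[OF sub k(1), of n] by (intro divide_right_mono) (simp_all add: M_def)
    also have "\<dots> = a k / real k + M / real n" using elim(2) by (simp add: add_divide_distrib)
    finally show ?case using elim(1) by simp
  qed
qed

lemma convex_on_LIMSEQ:
  fixes f :: "nat \<Rightarrow> 'a::real_vector \<Rightarrow> real"
  assumes convex: "\<And>n. convex_on S (f n)" and lim: "\<And>x. x \<in> S \<Longrightarrow> (\<lambda>n. f n x) \<longlonglongrightarrow> g x"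
  shows "convex_on S g"
proof (rule convex_onI)
  show S: "convex S" using convex[of 0] by (rule convex_on_imp_convex)
  fix t x y assume t: "0 < (t :: real)" "t < 1" and xy: "x \<in> S" "y \<in> S"
  have "(1 - t) *\<^sub>R x + t *\<^sub>R y \<in> S" using S xy t by (intro convexD_alt) auto
  moreover have "f n ((1 - t) *\<^sub>R x + t *\<^sub>R y) \<le> (1 - t) * f n x + t * f n y" for n
    using convex_onD[OF convex] t xy by simp
  ultimately show "g ((1 - t) *\<^sub>R x + t *\<^sub>R y) \<le> (1 - t) * g x + t * g y"
    by (intro LIMSEQ_le[OF lim tendsto_add[OF tendsto_mult_left[OF lim] tendsto_mult_left[OF lim]]] xy) auto
qed

lemma convex_on_right_derivative:
  fixes f :: "real \<Rightarrow> real"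
  assumes f: "convex_on {a<..<b} f" and x: "a < x" "x < b"
  obtains D where "(f has_real_derivative D) (at x within {x..})"
proof -
  define g where "g y = (f x - f y) / (x - y)" for y
  define D where "D = Inf (g ` {x<..<b})"
  have mono: "g y \<le> g z" if "x < y" "y < z" "z < b" for y z
    unfolding g_def using that x by (intro convex_on_slope_le(1)[OF f]) auto
  obtain w where w: "a < w" "w < x" using dense[OF x(1)] by auto
  have "(f w - f x) / (w - x) \<le> g y" if "y \<in> {x<..<b}" for y
    using convex_on_slope_le[OF f, of w y x] that w unfolding g_def by auto
  then have bdd: "bdd_below (g ` {x<..<b})" by (rule bdd_belowI2)
  have "(g \<longlongrightarrow> D) (at_right x)"
  proof (rule order_tendstoI)
    fix l assume "l < D"
    then have "l < g y" if "y \<in> {x<..<b}" for y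
      using cINF_lower[OF bdd that] by (simp add: D_def)
    then show "\<forall>\<^sub>F y in at_right x. l < g y" unfolding eventually_at_right_field using x by auto
  next
    fix v assume "D < v"
    then obtain z where z: "z \<in> {x<..<b}" "g z < v"
      using cInf_lessD[of "g ` {x<..<b}" v] x by (auto simp: D_def)
    then have "g y < v" if "x < y" "y < z" for y using mono[of y z] that by auto
    then show "\<forall>\<^sub>F y in at_right x. g y < v" unfolding eventually_at_right_field using z by auto
  qed
  moreover have "g y = (f y - f x) / (y - x)" for y
    unfolding g_def by (metis minus_diff_eq minus_divide_divide)
  then have "g = (\<lambda>y. (f y - f x) / (y - x))" by (rule ext)
  ultimately have "(f has_real_derivative D) (at x within {x..})"
    by (simp add: has_field_derivative_iff at_within_Ici_at_right)
  then show ?thesis by (rule that)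
qed

lemma convex_on_left_derivative:
  fixes f :: "real \<Rightarrow> real"
  assumes f: "convex_on {a<..<b} f" and x: "a < x" "x < b"
  obtains D where "(f has_real_derivative D) (at x within {..x})"
proof -
  have "convex_on {- b<..<- a} (\<lambda>y. f (- y))"
  proof (rule convex_onI)
    fix t y z assume "0 < (t::real)" "t < 1" "y \<in> {- b<..<- a}" "z \<in> {- b<..<- a}"
    then show "f (- ((1 - t) *\<^sub>R y + t *\<^sub>R z)) \<le> (1 - t) * f (- y) + t * f (- z)"
      using convex_onD[OF f, of t "- y" "- z"] by simp
  qed simp
  then obtain D where "((\<lambda>y. f (- y)) has_real_derivative D) (at (- x) within {- x..})"
    using convex_on_right_derivative[of "- b" "- a" _ "- x"] x by auto
  then have "((\<lambda>y. f (- y)) \<circ> uminus has_real_derivative D * - 1) (at x within {..x})"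
    by (intro DERIV_image_chain) (auto intro!: derivative_eq_intros)
  then show ?thesis using that by (simp add: comp_def)
qed

subsection \<open>Hypothesis testing with group symmetry\<close>

lemma limsup_elog_rate_le:
  assumes "\<forall>\<^sub>F n in sequentially. 0 \<le> b n \<and> b n \<le> exp (- (real n * a))"
  shows "limsup (\<lambda>n. elog (b n) / ereal (real n)) \<le> ereal (- a)"
proof (rule Limsup_bounded)
  show "\<forall>\<^sub>F n in sequentially. elog (b n) / ereal (real n) \<le> ereal (- a)"
    using assms eventually_gt_at_top[of 0]
  proof eventually_elim
    case (elim n)
    show ?case
    proof (cases "b n = 0")
      case False
      then have "ln (b n) \<le> - (real n * a)"
        using elim ln_le_cancel_iff[of "b n" "exp (- (real n * a))"] by simp
      then show ?thesis using False elim(2) by (simp add: elog_def divide_le_eq mult.commute)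
    qed (use elim(2) in \<open>simp add: elog_def\<close>)
  qed
qed

locale hypothesis_test = compact_unitary_rep \<mu> d u
  for \<mu> :: "'g::{topological_group_add,t2_space} measure" and d u +
  fixes r0 r1 :: "complex mat"
  assumes state_r0: "state_mat d r0" and state_r1: "state_mat d r1" and supp: "support_le r0 r1"
begin

abbreviation \<rho> :: "nat \<Rightarrow> complex mat" where "\<rho> n \<equiv> E n (tpow r0 n)"
abbreviation \<sigma> :: "nat \<Rightarrow> complex mat" where "\<sigma> n \<equiv> E n (tpow r1 n)"

abbreviation \<psi>\<^sub>n :: "nat \<Rightarrow> real \<Rightarrow> real" where "\<psi>\<^sub>n \<equiv> psi_n d \<mu> u r0 r1"
abbreviation \<psi> :: "real \<Rightarrow> real" where "\<psi> \<equiv> psi d \<mu> u r0 r1"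

lemma psd_states: "psd d r0" "psd d r1"
  and mtrace_r0: "mtrace r0 = 1"
  using state_r0 state_r1 by (auto simp: state_mat_def)

lemma tpow_states_carrier [simp]:
  "tpow r0 n \<in> carrier_mat (d ^ n) (d ^ n)" "tpow r1 n \<in> carrier_mat (d ^ n) (d ^ n)"
  using psd_states by (simp_all add: psd_carrier)

lemma psd_tpow_states: "psd (d ^ n) (tpow r0 n)" "psd (d ^ n) (tpow r1 n)"
  using psd_states by (simp_all add: psd_tpow)

lemma psd_averages: "psd (d ^ n) (\<rho> n)" "psd (d ^ n) (\<sigma> n)"
  using psd_tpow_states by (simp_all add: psd_E)

lemma mtrace_\<rho>: "mtrace (\<rho> n) = 1"
  using psd_carrier[OF psd_states(1)] by (simp add: mtrace_E mtrace_tpow mtrace_r0)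

lemma parallel_sum_tpow_le: "0 < t \<Longrightarrow> parallel_sum t (tpow r0 n) (tpow r1 n) \<le> parallel_sum t (\<rho> n) (\<sigma> n)"
  by (intro parallel_sum_le_E psd_tpow_states) simp

lemma support_le_averages: "support_le (\<rho> n) (\<sigma> n)"
  by (rule support_le_if_parallel_sum_le[OF psd_tpow_states psd_averages support_le_tpow[OF psd_states supp] _
        parallel_sum_tpow_le]) (simp_all add: mtrace_E)

lemma psd_kron_averages:
  "psd (d ^ (m + n)) (kron (\<rho> m) (\<rho> n))" "psd (d ^ (m + n)) (kron (\<sigma> m) (\<sigma> n))"
  using psd_averages by (simp_all add: power_add psd_kron)

lemma parallel_sum_averages_le:
  "0 < t \<Longrightarrow> parallel_sum t (\<rho> (m + n)) (\<sigma> (m + n)) \<le> parallel_sum t (kron (\<rho> m) (\<rho> n)) (kron (\<sigma> m) (\<sigma> n))"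
  unfolding tpow_add by (intro parallel_sum_E_le_kron_E psd_tpow_states) simp

lemma psi_n_eq: "\<psi>\<^sub>n n s = ln (quasi_entropy (\<rho> n) (\<sigma> n) s)"
  by (simp add: psi_n_def quasi_entropy_def)

lemma quasi_entropy_averages_pos: "0 < quasi_entropy (\<rho> n) (\<sigma> n) s"
  by (rule quasi_entropy_pos[OF psd_averages support_le_averages]) (simp add: mtrace_\<rho>)

lemma psi_n_one: "\<psi>\<^sub>n n 1 = 0"
  by (simp add: psi_n_eq quasi_entropy_one[OF psd_averages(1) support_le_averages] mtrace_\<rho>)

lemma convex_psi_n: "convex_on UNIV (\<psi>\<^sub>n n)"
  using convex_on_ln_quasi_entropy[OF psd_averages support_le_averages, of n]
  by (simp add: mtrace_\<rho> flip: psi_n_eq)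

lemma psi_n_subadditive:
  assumes s: "0 < s" "s < 1"
  shows "\<psi>\<^sub>n (m + n) s \<le> \<psi>\<^sub>n m s + \<psi>\<^sub>n n s"
proof -
  have "quasi_entropy (\<rho> (m + n)) (\<sigma> (m + n)) s \<le> quasi_entropy (\<rho> m) (\<sigma> m) s * quasi_entropy (\<rho> n) (\<sigma> n) s"
    unfolding quasi_entropy_kron[OF psd_averages psd_averages, symmetric]
    by (rule quasi_entropy_mono[OF psd_averages psd_kron_averages s parallel_sum_averages_le])
  then show ?thesis
    using quasi_entropy_averages_pos[of _ s] by (simp add: psi_n_eq flip: ln_mult_pos)
qed

lemma psi_n_superadditive:
  assumes s: "1 < s" "s < 2"
  shows "\<psi>\<^sub>n m s + \<psi>\<^sub>n n s \<le> \<psi>\<^sub>n (m + n) s"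
proof -
  have "mtrace (kron (\<rho> m) (\<rho> n)) = 1" by (simp add: mtrace_kron[OF E_carrier(1) E_carrier(1)] mtrace_\<rho>)
  then have "quasi_entropy (\<rho> m) (\<sigma> m) s * quasi_entropy (\<rho> n) (\<sigma> n) s
      \<le> quasi_entropy (\<rho> (m + n)) (\<sigma> (m + n)) s"
    unfolding quasi_entropy_kron[OF psd_averages psd_averages, symmetric]
    by (intro quasi_entropy_antimono[OF psd_averages psd_kron_averages support_le_averages s _
          parallel_sum_averages_le]) (simp_all add: mtrace_\<rho>)
  then show ?thesis
    using quasi_entropy_averages_pos[of _ s] by (simp add: psi_n_eq flip: ln_mult_pos)
qed

lemma psi_n_le:
  assumes s: "1 < s" "s < 2"
  shows "\<psi>\<^sub>n n s \<le> ln (quasi_entropy r0 r1 s) * real n"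
proof -
  have "quasi_entropy (\<rho> n) (\<sigma> n) s \<le> quasi_entropy (tpow r0 n) (tpow r1 n) s"
    by (rule quasi_entropy_antimono[OF psd_tpow_states psd_averages support_le_tpow[OF psd_states supp] s _
          parallel_sum_tpow_le]) (simp_all add: mtrace_E)
  also have "\<dots> = quasi_entropy r0 r1 s ^ n" by (rule quasi_entropy_tpow[OF psd_states])
  finally have "\<psi>\<^sub>n n s \<le> ln (quasi_entropy r0 r1 s ^ n)"
    using quasi_entropy_averages_pos[of n s] by (simp add: psi_n_eq)
  moreover have "0 < quasi_entropy r0 r1 s"
    by (rule quasi_entropy_pos[OF psd_states supp]) (simp add: mtrace_r0)
  ultimately show ?thesis by (simp add: ln_realpow mult.commute)
qed

text \<open>Convexity and \<open>\<psi>\<^sub>n(1) = 0\<close> turn the upper bound at \<open>2 - s\<close> into a lower bound at \<open>s\<close>.\<close>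

lemma psi_n_ge:
  assumes s: "0 < s" "s < 1"
  shows "- (ln (quasi_entropy r0 r1 (2 - s)) * real n) \<le> \<psi>\<^sub>n n s"
proof -
  have "\<psi>\<^sub>n n ((1 - 1/2) *\<^sub>R s + (1/2) *\<^sub>R (2 - s)) \<le> (1 - 1/2) * \<psi>\<^sub>n n s + 1/2 * \<psi>\<^sub>n n (2 - s)"
    by (rule convex_onD[OF convex_psi_n]) auto
  moreover have "(1 - 1/2) *\<^sub>R s + (1/2) *\<^sub>R (2 - s) = 1" by (simp add: field_simps)
  ultimately have "0 \<le> \<psi>\<^sub>n n s + \<psi>\<^sub>n n (2 - s)" using psi_n_one[of n] by simp
  then show ?thesis using psi_n_le[of "2 - s" n] s by simp
qed

lemma convergent_psi_n:
  assumes s: "0 < s" "s < 2"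
  shows "convergent (\<lambda>n. \<psi>\<^sub>n n s / real n)"
proof -
  consider "s < 1" | "s = 1" | "1 < s" by linarith
  then show ?thesis
  proof cases
    case 1
    then show ?thesis
      using Fekete_subadditive[of "\<lambda>n. \<psi>\<^sub>n n s", OF psi_n_subadditive[OF s(1)] psi_n_ge[OF s(1)]]
      by (auto simp: convergent_def)
  next
    case 2
    then show ?thesis by (simp add: psi_n_one convergent_const)
  next
    case 3
    have "(\<lambda>n. - \<psi>\<^sub>n n s / real n) \<longlonglongrightarrow> (INF n\<in>{0<..}. - \<psi>\<^sub>n n s / real n)"
      using psi_n_superadditive[OF 3 s(2)] psi_n_le[OF 3 s(2)]
      by (intro Fekete_subadditive[where C="ln (quasi_entropy r0 r1 s)"]) (simp_all add: algebra_simps)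
    then have "convergent (\<lambda>n. - (\<psi>\<^sub>n n s / real n))" by (auto simp: convergent_def)
    then show ?thesis by (simp only: convergent_minus_iff[of "\<lambda>n. \<psi>\<^sub>n n s / real n"])
  qed
qed

lemma psi_LIMSEQ: "0 < s \<Longrightarrow> s < 2 \<Longrightarrow> (\<lambda>n. \<psi>\<^sub>n n s / real n) \<longlonglongrightarrow> \<psi> s"
  using convergent_psi_n by (simp add: psi_def convergent_LIMSEQ_iff)

lemma psi_one: "\<psi> 1 = 0"
  using LIMSEQ_unique[OF psi_LIMSEQ[of 1]] by (simp add: psi_n_one)

lemma convex_psi: "convex_on {0<..<2} \<psi>"
proof (rule convex_on_LIMSEQ[where f="\<lambda>n s. \<psi>\<^sub>n n s / real n"])
  show "convex_on {0<..<2} (\<lambda>s. \<psi>\<^sub>n n s / real n)" for n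
    by (intro convex_on_cdiv convex_on_subset[OF convex_psi_n]) auto
qed (simp add: psi_LIMSEQ)

definition is_test :: "nat \<Rightarrow> complex mat \<Rightarrow> bool" where
  "is_test n T \<longleftrightarrow> T \<in> commutant d u n \<and> psd (d ^ n) T \<and> psd (d ^ n) (1\<^sub>m (d ^ n) - T)"

lemma admissible_iff: "admissible d u r0 \<epsilon> T \<longleftrightarrow> (\<forall>n. is_test n (T n) \<and> beta0 d r0 n (T n) \<le> \<epsilon>)"
  by (auto simp: admissible_def is_test_def)

lemma commutant_eq: "commutant d u n = matrix_commutant (d ^ n) (range (\<pi> n))"
  by (auto simp: commutant_def matrix_commutant_def \<pi>_def)

lemma is_test_one: "is_test n (1\<^sub>m (d ^ n))"
proof -
  have "unitary_diag (d ^ n) (1\<^sub>m (d ^ n)) (\<lambda>_. 1 - 1) = 1\<^sub>m (d ^ n) - 1\<^sub>m (d ^ n)"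
    by (simp only: unitary_diag_minus[OF unitary_one, symmetric] unitary_diag_one[OF unitary_one])
  then have "psd (d ^ n) (1\<^sub>m (d ^ n) - 1\<^sub>m (d ^ n))"
    using psd_unitary_diag[OF unitary_one, of "d ^ n" "\<lambda>_. 1 - 1"] by simp
  then show ?thesis
    by (simp add: is_test_def commutant_eq psd_one one_in_matrix_commutant[OF range_\<pi>])
qed

lemma beta_eq:
  assumes T: "is_test n T"
  shows "beta0 d r0 n T = Re (mtrace (\<rho> n * (1\<^sub>m (d ^ n) - T)))"
    and "beta1 r1 n T = Re (mtrace (\<sigma> n * T))"
proof -
  have T: "T \<in> matrix_commutant (d ^ n) (range (\<pi> n))" using T by (simp add: is_test_def commutant_eq)
  then have "1\<^sub>m (d ^ n) - T \<in> matrix_commutant (d ^ n) (range (\<pi> n))"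
    by (intro minus_in_matrix_commutant one_in_matrix_commutant range_\<pi>)
  with T show "beta0 d r0 n T = Re (mtrace (\<rho> n * (1\<^sub>m (d ^ n) - T)))" "beta1 r1 n T = Re (mtrace (\<sigma> n * T))"
    using trace_expectation_E[of "tpow r0 n" n] trace_expectation_E[of "tpow r1 n" n]
    by (simp_all add: beta0_def beta1_def trace_expectation_def)
qed

lemma beta_nonneg:
  assumes T: "is_test n T"
  shows "0 \<le> beta0 d r0 n T" and "0 \<le> beta1 r1 n T"
  using T psd_averages by (auto simp: beta_eq[OF T] is_test_def intro: mtrace_psd_mult_nonneg)

lemma beta0_eq_minus:
  assumes T: "is_test n T"
  shows "beta0 d r0 n T = 1 - Re (mtrace (\<rho> n * T))"
proof -
  have "T \<in> carrier_mat (d ^ n) (d ^ n)" using T by (simp add: is_test_def psd_carrier)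
  then show ?thesis
    using Re_mtrace_minus_mult(2)[OF one_carrier_mat _ E_carrier(1), of T n "tpow r0 n"]
    by (simp add: beta_eq[OF T] right_mult_one_mat[OF E_carrier(1)] mtrace_\<rho>)
qed

lemma beta1_converse:
  assumes T: "is_test n T" and err: "beta0 d r0 n T \<le> \<epsilon>" and \<epsilon>: "\<epsilon> < 1" and s: "1 < s" "s < 2"
  shows "0 < beta1 r1 n T"
    and "(s * ln (1 - \<epsilon>) - ln 2 - \<psi>\<^sub>n n s) / (s - 1) \<le> ln (beta1 r1 n T)"
proof -
  define a where "a = Re (mtrace (\<rho> n * T))"
  define b where "b = beta1 r1 n T"
  have a: "1 - \<epsilon> \<le> a" using err by (simp add: beta0_eq_minus[OF T] a_def)
  then have "0 < a" using \<epsilon> by simp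
  then have b: "0 < b" and bound: "a powr s * b powr (1 - s) \<le> 2 * quasi_entropy (\<rho> n) (\<sigma> n) s"
    using quasi_entropy_ge_test[OF psd_averages support_le_averages _ _ s, of n T] T
    by (auto simp: a_def b_def beta_eq(2)[OF T] is_test_def)
  show "0 < beta1 r1 n T" using b by (simp add: b_def)
  have "s * ln (1 - \<epsilon>) + (1 - s) * ln b \<le> s * ln a + (1 - s) * ln b" using a \<epsilon> s by simp
  also have "\<dots> = ln (a powr s * b powr (1 - s))" using \<open>0 < a\<close> b by (simp add: ln_mult_pos ln_powr)
  also have "\<dots> \<le> ln (2 * quasi_entropy (\<rho> n) (\<sigma> n) s)"
    using bound \<open>0 < a\<close> b quasi_entropy_averages_pos by simp
  also have "\<dots> = ln 2 + \<psi>\<^sub>n n s" using quasi_entropy_averages_pos by (simp add: ln_mult_pos psi_n_eq)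
  finally have "s * ln (1 - \<epsilon>) - ln 2 - \<psi>\<^sub>n n s \<le> ln b * (s - 1)" by (simp add: algebra_simps)
  then show "(s * ln (1 - \<epsilon>) - ln 2 - \<psi>\<^sub>n n s) / (s - 1) \<le> ln (beta1 r1 n T)"
    using s by (simp add: divide_le_eq b_def)
qed

lemma s_lower_ge_slope:
  assumes \<epsilon>: "\<epsilon> < 1" and s: "1 < s" "s < 2"
  shows "ereal (- (\<psi> s / (s - 1))) \<le> s_lower d u r0 r1 \<epsilon>"
  unfolding s_lower_def
proof (rule INF_greatest)
  fix T assume "T \<in> {T. admissible d u r0 \<epsilon> T}"
  then have T: "is_test n (T n)" "beta0 d r0 n (T n) \<le> \<epsilon>" for n by (simp_all add: admissible_iff)
  define c where "c = s * ln (1 - \<epsilon>) - ln 2"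
  let ?f = "\<lambda>n. (c / real n - \<psi>\<^sub>n n s / real n) / (s - 1)"
  have "?f \<longlonglongrightarrow> (0 - \<psi> s) / (s - 1)"
    using s by (intro tendsto_intros lim_const_over_n psi_LIMSEQ) auto
  then have "(\<lambda>n. ereal (?f n)) \<longlonglongrightarrow> ereal (- (\<psi> s / (s - 1)))" by simp
  then have "ereal (- (\<psi> s / (s - 1))) = liminf (\<lambda>n. ereal (?f n))"
    by (rule lim_imp_Liminf[OF sequentially_bot, symmetric])
  also have "\<dots> \<le> liminf (\<lambda>n. elog (beta1 r1 n (T n)) / ereal (real n))"
  proof (rule Liminf_mono, rule eventually_sequentiallyI[of 1])
    fix n :: nat assume n: "1 \<le> n"
    note bound = beta1_converse[OF T \<epsilon> s, of n]
    have "?f n = (c - \<psi>\<^sub>n n s) / (s - 1) / real n" by (simp add: diff_divide_distrib mult.commute)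
    also have "\<dots> \<le> ln (beta1 r1 n (T n)) / real n"
      using bound(2) unfolding c_def by (intro divide_right_mono) auto
    finally show "ereal (?f n) \<le> elog (beta1 r1 n (T n)) / ereal (real n)"
      using bound(1) n by (simp add: elog_def)
  qed
  finally show "ereal (- (\<psi> s / (s - 1))) \<le> liminf (\<lambda>n. elog (beta1 r1 n (T n)) / ereal (real n))" .
qed

lemma psi_slope_tendsto:
  "(\<psi> has_real_derivative D) (at 1 within S) \<Longrightarrow> ((\<lambda>s. \<psi> s / (s - 1)) \<longlongrightarrow> D) (at 1 within S)"
  by (simp add: has_field_derivative_iff psi_one)

lemma s_lower_ge_right_derivative:
  assumes "\<epsilon> < 1" and "(\<psi> has_real_derivative D) (at 1 within {1..})"
  shows "ereal (- D) \<le> s_lower d u r0 r1 \<epsilon>"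
proof (rule tendsto_upperbound)
  show "((\<lambda>s. ereal (- (\<psi> s / (s - 1)))) \<longlongrightarrow> ereal (- D)) (at_right 1)"
    using psi_slope_tendsto[OF assms(2)] by (intro tendsto_intros) (simp add: at_within_Ici_at_right)
  show "\<forall>\<^sub>F s in at_right 1. ereal (- (\<psi> s / (s - 1))) \<le> s_lower d u r0 r1 \<epsilon>"
    unfolding eventually_at_right_field using s_lower_ge_slope[OF assms(1)] by (intro exI[of _ 2]) auto
qed simp

lemma s_lower_le_s_upper: "s_lower d u r0 r1 \<epsilon> \<le> s_upper d u r0 r1 \<epsilon>"
  unfolding s_lower_def s_upper_def
  by (rule INF_mono) (use Liminf_le_Limsup[OF sequentially_bot] in blast)

lemma optimal_test:
  assumes s: "0 < s" "s < 1"
  obtains T where "is_test n T"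
    "beta0 d r0 n T + exp (real n * a) * beta1 r1 n T \<le> exp (real n * (a * (1 - s)) + \<psi>\<^sub>n n s)"
proof -
  define c where "c = exp (real n * a)"
  let ?B = "complex_of_real c \<cdot>\<^sub>m \<sigma> n"
  have B: "psd (d ^ n) ?B" using psd_smult[OF psd_averages(2)] by (simp add: c_def)
  obtain T where T: "psd (d ^ n) T" "psd (d ^ n) (1\<^sub>m (d ^ n) - T)"
    and bicommutant: "T \<in> matrix_commutant (d ^ n) (matrix_commutant (d ^ n) {\<rho> n, ?B})"
    and bound: "Re (mtrace (\<rho> n * (1\<^sub>m (d ^ n) - T))) + Re (mtrace (?B * T)) \<le> quasi_entropy (\<rho> n) ?B s"
    by (rule neyman_pearson_test[OF psd_averages(1) B s])
  have "range (\<pi> n) \<subseteq> matrix_commutant (d ^ n) {\<rho> n, ?B}"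
    by (auto intro!: matrix_commutantI simp: E_commute mult_mat_smult)
  then have "T \<in> matrix_commutant (d ^ n) (range (\<pi> n))"
    using bicommutant matrix_commutant_antimono by blast
  then have test: "is_test n T" using T by (simp add: is_test_def commutant_eq)
  have "Re (mtrace (?B * T)) = c * beta1 r1 n T"
    using psd_carrier[OF T(1)] by (simp add: beta_eq(2)[OF test] mult_mat_smult mtrace_smult)
  moreover have "quasi_entropy (\<rho> n) ?B s = exp (real n * (a * (1 - s)) + \<psi>\<^sub>n n s)"
    using quasi_entropy_averages_pos[of n s]
    by (simp add: quasi_entropy_smult_right[OF psd_averages] c_def powr_def exp_add psi_n_eq ac_simps)
  ultimately show ?thesis
    using that[OF test] bound by (simp add: beta_eq(1)[OF test] c_def)
qed

lemma s_upper_le_rate: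
  assumes \<epsilon>: "0 \<le> \<epsilon>" and P: "\<And>n. is_test n (P n)"
    and type1: "\<forall>\<^sub>F n in sequentially. beta0 d r0 n (P n) \<le> \<epsilon>"
    and type2: "\<forall>\<^sub>F n in sequentially. beta1 r1 n (P n) \<le> exp (- (real n * a))"
  shows "s_upper d u r0 r1 \<epsilon> \<le> ereal (- a)"
proof -
  define T where "T n = (if beta0 d r0 n (P n) \<le> \<epsilon> then P n else 1\<^sub>m (d ^ n))" for n
  have "beta0 d r0 n (1\<^sub>m (d ^ n)) = 0" for n
    by (simp add: beta0_eq_minus[OF is_test_one] right_mult_one_mat[OF E_carrier(1)] mtrace_\<rho>)
  then have "admissible d u r0 \<epsilon> T" using P \<epsilon> by (simp add: admissible_iff T_def is_test_one)
  moreover have "limsup (\<lambda>n. elog (beta1 r1 n (T n)) / ereal (real n)) \<le> ereal (- a)"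
  proof (rule limsup_elog_rate_le)
    show "\<forall>\<^sub>F n in sequentially. 0 \<le> beta1 r1 n (T n) \<and> beta1 r1 n (T n) \<le> exp (- (real n * a))"
      using type1 type2 by eventually_elim (simp add: T_def beta_nonneg[OF P])
  qed
  ultimately show ?thesis unfolding s_upper_def by (intro INF_lower2[of T]) auto
qed

lemma s_upper_le_slope:
  assumes \<epsilon>: "0 < \<epsilon>" and s: "0 < s" "s < 1" and slope: "a * (1 - s) + \<psi> s < 0"
  shows "s_upper d u r0 r1 \<epsilon> \<le> ereal (- a)"
proof -
  define e where "e n = real n * (a * (1 - s)) + \<psi>\<^sub>n n s" for n
  have "\<exists>T. is_test n T \<and> beta0 d r0 n T + exp (real n * a) * beta1 r1 n T \<le> exp (e n)" for n
    using optimal_test[OF s] unfolding e_def by metis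
  then obtain P where P: "is_test n (P n)"
    and bound: "beta0 d r0 n (P n) + exp (real n * a) * beta1 r1 n (P n) \<le> exp (e n)" for n
    by metis
  have "(\<lambda>n. a * (1 - s) + \<psi>\<^sub>n n s / real n) \<longlonglongrightarrow> a * (1 - s) + \<psi> s"
    using s by (intro tendsto_intros psi_LIMSEQ) auto
  then have "filterlim (\<lambda>n. (a * (1 - s) + \<psi>\<^sub>n n s / real n) * real n) at_bot sequentially"
    using slope by (rule filterlim_tendsto_neg_mult_at_bot) (rule filterlim_real_sequentially)
  then have "\<forall>\<^sub>F n in sequentially. (a * (1 - s) + \<psi>\<^sub>n n s / real n) * real n \<le> min 0 (ln \<epsilon>)"
    unfolding filterlim_at_bot by blast
  then have "\<forall>\<^sub>F n in sequentially. e n \<le> 0 \<and> e n \<le> ln \<epsilon>"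
    using eventually_gt_at_top[of 0] by eventually_elim (simp add: e_def distrib_left mult.commute)
  then have small: "\<forall>\<^sub>F n in sequentially. exp (e n) \<le> 1 \<and> exp (e n) \<le> \<epsilon>"
    by eventually_elim (use \<epsilon> in \<open>simp flip: ln_ge_iff\<close>)
  show ?thesis
  proof (rule s_upper_le_rate[OF less_imp_le[OF \<epsilon>] P])
    show "\<forall>\<^sub>F n in sequentially. beta0 d r0 n (P n) \<le> \<epsilon>"
      using small
    proof eventually_elim
      case (elim n)
      have "0 \<le> exp (real n * a) * beta1 r1 n (P n)" using beta_nonneg(2)[OF P] by simp
      then show ?case using bound[of n] elim by linarith
    qed
    show "\<forall>\<^sub>F n in sequentially. beta1 r1 n (P n) \<le> exp (- (real n * a))"
      using small
    proof eventually_elim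
      case (elim n)
      then have "exp (real n * a) * beta1 r1 n (P n) \<le> 1"
        using bound[of n] beta_nonneg(1)[OF P, of n] by linarith
      then show ?case by (simp add: exp_minus field_simps)
    qed
  qed
qed

lemma s_upper_le_left_derivative:
  assumes \<epsilon>: "0 < \<epsilon>" and D: "(\<psi> has_real_derivative D) (at 1 within {..1})"
  shows "s_upper d u r0 r1 \<epsilon> \<le> ereal (- D)"
proof (rule tendsto_lowerbound)
  show "((\<lambda>a. ereal (- a)) \<longlongrightarrow> ereal (- D)) (at_left D)" by (intro tendsto_intros)
  have "s_upper d u r0 r1 \<epsilon> \<le> ereal (- a)" if "a < D" for a
  proof -
    have "\<forall>\<^sub>F s in at_left 1. a < \<psi> s / (s - 1)"
      using order_tendstoD(1)[OF psi_slope_tendsto[OF D] that] by (simp add: at_within_Iic_at_left)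
    then have "\<forall>\<^sub>F s in at_left 1. a < \<psi> s / (s - 1) \<and> s \<in> {0<..<1}"
      using eventually_at_left_real[of 0 1] by (simp add: eventually_conj)
    then obtain s where "a < \<psi> s / (s - 1)" "0 < s" "s < 1"
      using eventually_happens by fastforce
    then show ?thesis
      by (intro s_upper_le_slope[OF \<epsilon>, of s]) (simp_all add: less_divide_eq algebra_simps)
  qed
  then show "\<forall>\<^sub>F a in at_left D. s_upper d u r0 r1 \<epsilon> \<le> ereal (- a)"
    unfolding eventually_at_left_field by (intro exI[of _ "D - 1"]) simp
qed simp

end

theorem theorem4p5:
  fixes d :: nat and \<mu> :: "'g::{topological_group_add,t2_space} measure"
    and u :: "'g \<Rightarrow> complex mat" and r0 r1 :: "complex mat" and \<epsilon> :: real
  assumes G_compact: "compact (UNIV :: 'g set)"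
    and haar: "haar_prob \<mu>"
    and rep: "unitary_rep d u"
    and st0: "state_mat d r0" and st1: "state_mat d r1"
    and supp1_inv: "mpow r1 0 \<in> commutant d u 1"
    and supp_le: "psd d (mpow r1 0 - mpow r0 0)"
    and eps: "0 < \<epsilon>" "\<epsilon> < 1"
  shows "\<exists>Dp Dm. (psi d \<mu> u r0 r1 has_real_derivative Dp) (at 1 within {1..}) \<and>
                (psi d \<mu> u r0 r1 has_real_derivative Dm) (at 1 within {..1}) \<and>
                ereal (- Dp) \<le> s_lower d u r0 r1 \<epsilon> \<and>
                s_lower d u r0 r1 \<epsilon> \<le> s_upper d u r0 r1 \<epsilon> \<and>
                s_upper d u r0 r1 \<epsilon> \<le> ereal (- Dm)"
proof -
  have "psd d r0" "psd d r1" using st0 st1 by (simp_all add: state_mat_def)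
  then have "support_le r0 r1" using supp_le by (rule support_leI)
  then interpret hypothesis_test \<mu> d u r0 r1
    by unfold_locales (use G_compact haar rep st0 st1 in auto)
  obtain Dp where Dp: "(\<psi> has_real_derivative Dp) (at 1 within {1..})"
    using convex_on_right_derivative[OF convex_psi, of 1] by auto
  obtain Dm where Dm: "(\<psi> has_real_derivative Dm) (at 1 within {..1})"
    using convex_on_left_derivative[OF convex_psi, of 1] by auto
  show ?thesis
    using Dp Dm s_lower_ge_right_derivative[OF eps(2) Dp] s_lower_le_s_upper
      s_upper_le_left_derivative[OF eps(1) Dm]
    by blast
qed

end
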